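(* Let $H\in(0,1/4)$ and let $$\widetilde H_k=\frac12\left(\log_2\frac{V_{2^k}^{H,2}}{V_{2^{k+1}}^{H,2}}+1\right).$$ Then $$2^{k/2}\left(\widetilde H_k-H\right)\Rightarrow N(0,(\sigma'_H)^2),\quad k\to\infty$$ (convergence in distribution), where $$\sigma'_H=\frac1{2\log2}\left(\rho'_{H,0}+2\sum_{m=1}^\infty\rho'_{H,m}\right)^{1/2},$$ $$\rho'_{H,m}=\mathsf{E}\Big[\Big((B_1^H)^2-2^{2H-1}(B_{1/2}^H)^2-2^{2H-1}(B_1^H-B_{1/2}^H)^2\Big)\Big((B_{m+1}^H-B_m^H)^2-2^{2H-1}(B_{m+1/2}^H-B_m^H)^2-2^{2H-1}(B_{m+1}^H-B_{m+1/2}^H)^2\Big)\Big].$$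
   Context: Mixed model: $M_t^H=aB_t^H+bW_t$, $t\in[0,T]$, where $T>0$, $a>0$, $b>0$, $W$ is a standard Wiener process and $B^H=\{B^H_t,t\ge0\}$ is a fractional Brownian motion with Hurst parameter $H$ (centered Gaussian, $\mathsf{E}[B^H_tB^H_s]=\frac12(t^{2H}+s^{2H}-|t-s|^{2H})$), independent of $W$. For $n\ge1$, $\Delta_i^nX=X_{T(i+1)/n}-X_{Ti/n}$, $i=0,\dots,n-1$, and $V_n^{H,2}=\sum_{i=0}^{n-1}(\Delta_i^nM^H)^2$. $\log$ is the natural logarithm. *)

theory Defs
  imports "HOL-Probability.Probability"
begin

text \<open>The normal law with mean \<open>\<mu>\<close> and \<^emph>\<open>variance\<close> \<open>v \<ge> 0\<close>. The case \<open>v = 0\<close> is separate because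
  \<^const>\<open>normal_density\<close> with standard deviation \<open>0\<close> is identically zero.\<close>

definition normal_law :: "real \<Rightarrow> real \<Rightarrow> real measure" where
  "normal_law \<mu> v =
     (if v = 0 then return borel \<mu> else density lborel (\<lambda>x. ennreal (normal_density \<mu> (sqrt v) x)))"

text \<open>Linear combinations may have degenerate (zero variance) normal laws.\<close>

definition gaussian_process :: "'a measure \<Rightarrow> real set \<Rightarrow> (real \<Rightarrow> 'a \<Rightarrow> real) \<Rightarrow> bool" where
  "gaussian_process M I X \<longleftrightarrow>
     (\<forall>t\<in>I. X t \<in> borel_measurable M) \<and>
     (\<forall>J c. finite J \<longrightarrow> J \<subseteq> I \<longrightarrow>
        (\<exists>\<mu> v. v \<ge> 0 \<and> distr M borel (\<lambda>\<omega>. \<Sum>t\<in>J. c t * X t \<omega>) = normal_law \<mu> v))"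

definition fractional_brownian_motion :: "'a measure \<Rightarrow> real \<Rightarrow> (real \<Rightarrow> 'a \<Rightarrow> real) \<Rightarrow> bool" where
  "fractional_brownian_motion M H B \<longleftrightarrow>
     gaussian_process M {0..} B \<and>
     (\<forall>t\<ge>0. integral\<^sup>L M (B t) = 0) \<and>
     (\<forall>t\<ge>0. \<forall>s\<ge>0. integral\<^sup>L M (\<lambda>\<omega>. B t \<omega> * B s \<omega>) =
        1/2 * (t powr (2*H) + s powr (2*H) - \<bar>t - s\<bar> powr (2*H)))"

definition wiener_process :: "'a measure \<Rightarrow> (real \<Rightarrow> 'a \<Rightarrow> real) \<Rightarrow> bool" where
  "wiener_process M W \<longleftrightarrow>
     (\<forall>t\<ge>0. W t \<in> borel_measurable M) \<and>
     (AE \<omega> in M. W 0 \<omega> = 0) \<and>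
     (\<forall>(\<tau> :: nat \<Rightarrow> real) n. 0 \<le> \<tau> 0 \<longrightarrow> mono \<tau> \<longrightarrow>
        prob_space.indep_vars M (\<lambda>_. borel) (\<lambda>i \<omega>. W (\<tau> (Suc i)) \<omega> - W (\<tau> i) \<omega>) {..<n}) \<and>
     (\<forall>s t. 0 \<le> s \<longrightarrow> s < t \<longrightarrow>
        distr M borel (\<lambda>\<omega>. W t \<omega> - W s \<omega>) = normal_law 0 (t - s)) \<and>
     (AE \<omega> in M. continuous_on {0..} (\<lambda>t. W t \<omega>))"

text \<open>Independence of the two processes as random elements of \<open>\<real>\<^bsup>[0,\<infinity>)\<^esup>\<close> with the product
  \<open>\<sigma>\<close>-algebra, i.e. of the \<open>\<sigma>\<close>-algebras they generate.\<close>

definition independent_processes ::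
    "'a measure \<Rightarrow> (real \<Rightarrow> 'a \<Rightarrow> real) \<Rightarrow> (real \<Rightarrow> 'a \<Rightarrow> real) \<Rightarrow> bool" where
  "independent_processes M X Y \<longleftrightarrow>
     prob_space.indep_var M
       (PiM {0..} (\<lambda>_. borel)) (\<lambda>\<omega>. \<lambda>t\<in>{0..}. X t \<omega>)
       (PiM {0..} (\<lambda>_. borel)) (\<lambda>\<omega>. \<lambda>t\<in>{0..}. Y t \<omega>)"

definition mixed_process ::
    "real \<Rightarrow> real \<Rightarrow> (real \<Rightarrow> 'a \<Rightarrow> real) \<Rightarrow> (real \<Rightarrow> 'a \<Rightarrow> real) \<Rightarrow> real \<Rightarrow> 'a \<Rightarrow> real" where
  "mixed_process a b B W t \<omega> = a * B t \<omega> + b * W t \<omega>"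

definition grid_increment :: "real \<Rightarrow> nat \<Rightarrow> nat \<Rightarrow> (real \<Rightarrow> 'a \<Rightarrow> real) \<Rightarrow> 'a \<Rightarrow> real" where
  "grid_increment T n i X \<omega> =
     X (T * (real i + 1) / real n) \<omega> - X (T * real i / real n) \<omega>"

definition quadratic_variation :: "real \<Rightarrow> nat \<Rightarrow> (real \<Rightarrow> 'a \<Rightarrow> real) \<Rightarrow> 'a \<Rightarrow> real" where
  "quadratic_variation T n X \<omega> = (\<Sum>i<n. (grid_increment T n i X \<omega>)\<^sup>2)"

text \<open>The conventions \<open>x / 0 = 0\<close> and \<open>log 2 0 = 0\<close> only matter where a quadratic variation
  vanishes, which is a null event in the mixed model.\<close>

definition H_estimator :: "real \<Rightarrow> (real \<Rightarrow> 'a \<Rightarrow> real) \<Rightarrow> nat \<Rightarrow> 'a \<Rightarrow> real" where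
  "H_estimator T X k \<omega> =
     1/2 * (log 2 (quadratic_variation T (2 ^ k) X \<omega> /
                   quadratic_variation T (2 ^ (k + 1)) X \<omega>) + 1)"

definition rho' :: "'a measure \<Rightarrow> real \<Rightarrow> (real \<Rightarrow> 'a \<Rightarrow> real) \<Rightarrow> nat \<Rightarrow> real" where
  "rho' M H B m = integral\<^sup>L M (\<lambda>\<omega>.
     ((B 1 \<omega>)\<^sup>2
        - 2 powr (2*H - 1) * (B (1/2) \<omega>)\<^sup>2
        - 2 powr (2*H - 1) * (B 1 \<omega> - B (1/2) \<omega>)\<^sup>2) *
     ((B (real m + 1) \<omega> - B (real m) \<omega>)\<^sup>2
        - 2 powr (2*H - 1) * (B (real m + 1/2) \<omega> - B (real m) \<omega>)\<^sup>2
        - 2 powr (2*H - 1) * (B (real m + 1) \<omega> - B (real m + 1/2) \<omega>)\<^sup>2))"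

definition rho'_sum :: "'a measure \<Rightarrow> real \<Rightarrow> (real \<Rightarrow> 'a \<Rightarrow> real) \<Rightarrow> real" where
  "rho'_sum M H B = rho' M H B 0 + 2 * (\<Sum>m. rho' M H B (Suc m))"

definition sigma' :: "'a measure \<Rightarrow> real \<Rightarrow> (real \<Rightarrow> 'a \<Rightarrow> real) \<Rightarrow> real" where
  "sigma' M H B = 1 / (2 * ln 2) * sqrt (rho'_sum M H B)"

end

theory Submission
  imports Defs
begin

text \<open>Write \<open>n = 2\<^sup>k\<close> and let \<open>p\<^sub>n\<close> be the quadratic variation of the mixed process divided by the mean
  \<open>a\<^sup>2 (T/n)\<^sup>2\<^sup>H n\<close> of its fractional part. Then \<open>p\<^sub>n = 1 + P\<^sub>n + R\<^sub>n\<close>, where \<open>P\<^sub>n = O(n\<^sup>-\<^sup>1\<^sup>/\<^sup>2)\<close> comes from the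
  fractional Brownian motion alone, and \<open>\<surd>n R\<^sub>n\<close> tends to \<open>0\<close> in probability exactly because \<open>H < 1/4\<close>.
  The estimation error is \<open>(ln p\<^sub>n - ln p\<^sub>2\<^sub>n) / (2 ln 2)\<close>, so after linearising the logarithm it remains to
  prove a central limit theorem for \<open>\<surd>n (P\<^sub>n - P\<^sub>2\<^sub>n)\<close>, a quadratic form \<open>F\<close> in Gaussian variables.
  Gaussian integration by parts gives \<open>E F\<^sup>m\<^sup>+\<^sup>1 = 2 m E[F\<^sup>m\<^sup>-\<^sup>1 g]\<close> with a second quadratic form \<open>g\<close>, whose variance
  tends to \<open>0\<close> since the correlations of fractional Brownian increments are absolutely summable for \<open>H < 1/2\<close>.
  Hence the moments of \<open>F\<close> converge to those of a normal law, which determines the limit law.\<close>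

section \<open>Normal moments\<close>

text \<open>The Gaussian hypothesis speaks only of the law of each single linear combination.
  Integration by parts is therefore extracted from one-dimensional normal moments: the moments of L
  + e X are differentiated at e = 0, and polarisation carries the result to all polynomials. The
  increments of the grid with 2n steps are the halves of the cells of the grid with n steps. Written
  on these n cells, each with its two halves, the difference of the two normalised quadratic
  variations becomes one quadratic form in 3n normalised increments, and the relative weight
  -2^(2H-1) of the halves makes the means cancel. By self-similarity the covariances of the cells do
  not depend on the mesh, and concavity of x^(2H) makes disjoint increments negatively correlated,
  so that sums of absolute covariances telescope to a bound uniform in n. The threshold 1/4 comes
  from the quadratic variation of the Wiener process. Its mean b^2 T, divided by a fractional part
  of order n^(1-2H) and multiplied by sqrt n, leaves n^(2H-1/2). The cross term is centred and
  already negligible for H < 1/2.\<close>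

fun gauss_moment :: "real \<Rightarrow> nat \<Rightarrow> real" where
  "gauss_moment v 0 = 1"
| "gauss_moment v (Suc 0) = 0"
| "gauss_moment v (Suc (Suc k)) = real (Suc k) * v * gauss_moment v k"

lemma gauss_moment_even: "gauss_moment v (2 * k) = fact (2 * k) / (2 ^ k * fact k) * v ^ k"
proof (induction k)
  case (Suc k)
  have f: "fact (2 * Suc k) = (2 * real k + 2) * (2 * real k + 1) * fact (2 * k)"
    by (simp add: algebra_simps)
  have p: "2 ^ Suc k * fact (Suc k) = 2 * 2 ^ k * ((real k + 1) * fact k)"
    by simp
  have "gauss_moment v (2 * Suc k) = (2 * real k + 1) * v * (fact (2 * k) / (2 ^ k * fact k) * v ^ k)"
    using Suc by (simp add: add.commute)
  also have "\<dots> = (2 * real k + 2) * (2 * real k + 1) * fact (2 * k) / (2 * 2 ^ k * ((real k + 1) * fact k)) * (v * v ^ k)"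
    by (simp add: divide_simps)
  finally show ?case unfolding f p by simp
qed simp

lemma gauss_moment_odd: "gauss_moment v (2 * k + 1) = 0"
  by (induction k) simp_all

lemma gauss_moment_mono:
  assumes "0 \<le> u" "u \<le> v"
  shows "gauss_moment u (2 * k) \<le> gauss_moment v (2 * k)"
  unfolding gauss_moment_even using assms by (intro mult_left_mono power_mono) auto

lemma gauss_moment_even_nonneg: "0 \<le> v \<Longrightarrow> 0 \<le> gauss_moment v (2 * k)"
  unfolding gauss_moment_even by simp

text \<open>This is the heat equation: a derivative in the variance is half a second derivative in
  space, which lowers the power by two. For k < 2 the factor k (k - 1) vanishes, so the truncated
  \<open>k - 2\<close> is harmless. It serves to differentiate moments along a line of Gaussian
  variables, where only the variance moves.\<close>

lemma DERIV_gauss_moment: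
  "((\<lambda>v. gauss_moment v k) has_real_derivative (real k * (real k - 1) / 2 * gauss_moment v (k - 2))) (at v)"
proof (induction v k rule: gauss_moment.induct)
  case (3 v k)
  have eq: "real (Suc k) * (gauss_moment v k + v * (real k * (real k - 1) / 2 * gauss_moment v (k - 2)))
      = real (Suc (Suc k)) * (real (Suc (Suc k)) - 1) / 2 * gauss_moment v k"
  proof -
    consider "k = 0" | "k = Suc 0" | j where "k = Suc (Suc j)" by (metis nat.exhaust)
    then show ?thesis
    proof cases
      case (3 j)
      have "v * (real k * (real k - 1) / 2 * gauss_moment v (k - 2)) = real k / 2 * (real (Suc j) * v * gauss_moment v j)"
        using 3 by simp
      also have "\<dots> = real k / 2 * gauss_moment v k" using 3 by simp
      finally have eq: "v * (real k * (real k - 1) / 2 * gauss_moment v (k - 2)) = real k / 2 * gauss_moment v k" .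
      show ?thesis unfolding eq by (simp add: field_simps)
    qed simp_all
  qed
  have "((\<lambda>v. real (Suc k) * (v * gauss_moment v k)) has_real_derivative
     real (Suc k) * (gauss_moment v k + v * (real k * (real k - 1) / 2 * gauss_moment v (k - 2)))) (at v)"
    by (auto intro!: derivative_eq_intros 3)
  then show ?case unfolding eq by (simp add: mult.assoc)
qed auto

lemma normal_law_moments:
  assumes "0 \<le> v"
  shows "integrable (normal_law 0 v) (\<lambda>x. x ^ k)" (is ?A)
    and "(\<integral>x. x ^ k \<partial>normal_law 0 v) = gauss_moment v k" (is ?B)
proof -
  have "?A \<and> ?B"
  proof (cases "v = 0")
    case True
    have "integrable (return borel (0::real)) (\<lambda>x. x ^ k)"
      by (subst integrable_iff_bounded) (auto simp: nn_integral_return)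
    moreover have "(\<integral>x. x ^ k \<partial>return borel (0::real)) = 0 ^ k"
      by (subst integral_return) auto
    moreover have "gauss_moment 0 k = 0 ^ k"
    proof -
      consider "k = 0" | "k = Suc 0" | j where "k = Suc (Suc j)" by (metis nat.exhaust)
      then show ?thesis by cases auto
    qed
    ultimately show ?thesis using True by (simp add: normal_law_def)
  next
    case False
    then have v: "0 < v" "0 < sqrt v" using assms by auto
    have "?A" using integrable_normal_moment[OF v(2), of 0 k] v
      by (simp add: normal_law_def integrable_density)
    moreover have "(\<integral>x. x ^ k \<partial>normal_law 0 v) = (\<integral>x. normal_density 0 (sqrt v) x * x ^ k \<partial>lborel)"
      using v by (simp add: normal_law_def integral_density)
    moreover have "\<dots> = gauss_moment v k"
    proof (cases "even k")
      case True
      then obtain j where k: "k = 2 * j" by (auto elim: evenE)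
      show ?thesis unfolding k gauss_moment_even using integral_normal_moment_even[OF v(2), of 0 j] v
        by (simp add: field_simps)
    next
      case False
      then obtain j where k: "k = 2 * j + 1" by (auto elim: oddE)
      show ?thesis unfolding k gauss_moment_odd using integral_normal_moment_odd[OF v(2), of 0 j] by simp
    qed
    ultimately show ?thesis by simp
  qed
  then show ?A ?B by auto
qed

lemma real_distribution_normal_law:
  assumes "0 \<le> v"
  shows "real_distribution (normal_law 0 v)"
proof (cases "v = 0")
  case True
  then show ?thesis
    unfolding normal_law_def real_distribution_def real_distribution_axioms_def by (simp add: prob_space_return)
next
  case False
  then show ?thesis using assms
    unfolding normal_law_def real_distribution_def real_distribution_axioms_def
    by (simp add: prob_space_normal_density)
qed

text \<open>Method of moments: the characteristic function is approximated by its Taylor polynomials, with an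
  error controlled by the even moments of the limit.\<close>

lemma char_tendsto_of_moments:
  fixes \<mu> :: "nat \<Rightarrow> real measure"
  assumes "\<And>n. real_distribution (\<mu> n)"
    and int: "\<And>n k. integrable (\<mu> n) (\<lambda>x. x ^ k)"
    and lim: "\<And>k. (\<lambda>n. \<integral>x. x ^ k \<partial>\<mu> n) \<longlonglongrightarrow> gauss_moment v k"
  shows "(\<lambda>n. char (\<mu> n) t) \<longlonglongrightarrow> complex_of_real (exp (- v * t\<^sup>2 / 2))"
proof -
  define S where "S N n = (\<Sum>k\<le>2*N. ((\<i> * complex_of_real t)^k / fact k) * complex_of_real (\<integral>x. x ^ k \<partial>\<mu> n))" for N n
  define L where "L N = (\<Sum>k\<le>2*N. ((\<i> * complex_of_real t)^k / fact k) * complex_of_real (gauss_moment v k))" for N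
  \<comment> \<open>Odd moments vanish and the even ones contribute (-1)^j t^(2j) v^j / (2^j j!), so
    the Taylor sums in the limit moments are partial sums of the exponential series.\<close>
  have L_eq: "L N = complex_of_real (\<Sum>j\<le>N. (- v * t\<^sup>2 / 2) ^ j /\<^sub>R fact j)" for N
  proof (induction N)
    case (Suc N)
    have odd: "gauss_moment v (Suc (2 * N)) = 0" using gauss_moment_odd[of v N] by simp
    have "(\<i> * complex_of_real t)^(2 * Suc N) = ((\<i> * complex_of_real t)\<^sup>2) ^ Suc N"
      by (simp only: power_mult)
    also have "\<dots> = complex_of_real ((- (t\<^sup>2)) ^ Suc N)"
      by (simp add: power_mult_distrib)
    finally have pw: "(\<i> * complex_of_real t)^(2 * Suc N) = complex_of_real ((- (t\<^sup>2)) ^ Suc N)" .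
    have "(\<i> * complex_of_real t)^(2 * Suc N) / fact (2 * Suc N) * complex_of_real (gauss_moment v (2 * Suc N))
       = complex_of_real ((- (t\<^sup>2)) ^ Suc N / fact (2 * Suc N) * gauss_moment v (2 * Suc N))"
      unfolding pw by (simp del: fact_Suc mult_Suc_right)
    also have "(- (t\<^sup>2)) ^ Suc N / fact (2 * Suc N) * gauss_moment v (2 * Suc N)
       = (- (t\<^sup>2)) ^ Suc N * v ^ Suc N / (2 ^ Suc N * fact (Suc N))"
      unfolding gauss_moment_even by (simp del: fact_Suc mult_Suc_right)
    also have "\<dots> = (- v * t\<^sup>2 / 2) ^ Suc N /\<^sub>R fact (Suc N)"
    proof -
      have "(- v * t\<^sup>2 / 2) ^ Suc N = ((- (t\<^sup>2)) * v / 2) ^ Suc N"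
        by (rule arg_cong[where f="\<lambda>x. x ^ Suc N"]) simp
      then show ?thesis by (simp only: power_mult_distrib power_divide) (simp add: field_simps del: fact_Suc)
    qed
    finally have *: "(\<i> * complex_of_real t)^(2 * Suc N) / fact (2 * Suc N) * complex_of_real (gauss_moment v (2 * Suc N))
       = complex_of_real ((- v * t\<^sup>2 / 2) ^ Suc N /\<^sub>R fact (Suc N))" .
    have "2 * Suc N = Suc (Suc (2 * N))" by simp
    then have "L (Suc N) = L N + (\<i> * complex_of_real t)^(2 * Suc N) / fact (2 * Suc N) * complex_of_real (gauss_moment v (2 * Suc N))"
      unfolding L_def using odd by (simp del: fact_Suc gauss_moment.simps power_Suc)
    then show ?case unfolding * Suc by simp
  qed (simp add: L_def)
  have "(\<lambda>N. \<Sum>j<N. (- v * t\<^sup>2 / 2) ^ j /\<^sub>R fact j) \<longlonglongrightarrow> exp (- v * t\<^sup>2 / 2)"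
    using exp_converges[of "- v * t\<^sup>2 / 2"] by (simp add: sums_def)
  then have "(\<lambda>N. \<Sum>j<Suc N. (- v * t\<^sup>2 / 2) ^ j /\<^sub>R fact j) \<longlonglongrightarrow> exp (- v * t\<^sup>2 / 2)"
    by (rule LIMSEQ_Suc)
  then have L_lim: "L \<longlonglongrightarrow> complex_of_real (exp (- v * t\<^sup>2 / 2))"
    unfolding L_eq lessThan_Suc_atMost by (intro tendsto_of_real)
  have S_lim: "S N \<longlonglongrightarrow> L N" for N
    unfolding S_def L_def by (intro tendsto_sum tendsto_mult tendsto_const tendsto_of_real lim)
  \<comment> \<open>Limit of the Taylor error as n grows. The even order 2N turns the absolute
    moment of the error bound into an ordinary moment, whose limit is known; the factorials then
    leave 2 (t^2 v / 2)^N / N!.\<close>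
  define R where "R N = 2 * \<bar>t\<bar> ^ (2 * N) / fact (2 * N) * gauss_moment v (2 * N)" for N
  have R_eq: "R N = 2 * ((t\<^sup>2 * v / 2) ^ N /\<^sub>R fact N)" for N
    unfolding R_def gauss_moment_even power_mult
    by (simp add: power_mult_distrib power_divide field_simps)
  have "(\<lambda>N. (t\<^sup>2 * v / 2) ^ N /\<^sub>R fact N) \<longlonglongrightarrow> 0"
    by (rule summable_LIMSEQ_zero[OF summable_exp_generic])
  then have R_lim: "R \<longlonglongrightarrow> 0" unfolding R_eq using tendsto_mult_right_zero by blast
  have bound: "norm (char (\<mu> n) t - S N n) \<le> 2 * \<bar>t\<bar> ^ (2 * N) / fact (2 * N) * (\<integral>x. x ^ (2 * N) \<partial>\<mu> n)" for N n
  proof -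
    interpret real_distribution "\<mu> n" by fact
    show ?thesis using char_approx1[of "2 * N" t, OF int] unfolding S_def by (simp add: power_even_abs)
  qed
  show ?thesis
  proof (rule LIMSEQ_I)
    fix e :: real assume e: "0 < e"
    obtain N1 where N1: "\<And>N. N \<ge> N1 \<Longrightarrow> norm (R N) < e/4" using LIMSEQ_D[OF R_lim, of "e/4"] e by auto
    obtain N2 where N2: "\<And>N. N \<ge> N2 \<Longrightarrow> norm (L N - complex_of_real (exp (- v * t\<^sup>2 / 2))) < e/4"
      using LIMSEQ_D[OF L_lim, of "e/4"] e by auto
    \<comment> \<open>The order is fixed before n. The Taylor error then costs e/2, namely e/4 for
      its limit and e/4 for the distance to it, and the two remaining comparisons cost e/4
      each.\<close>
    define N where "N = max N1 N2"
    have "(\<lambda>n. 2 * \<bar>t\<bar> ^ (2 * N) / fact (2 * N) * (\<integral>x. x ^ (2 * N) \<partial>\<mu> n)) \<longlonglongrightarrow> R N"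
      unfolding R_def by (intro tendsto_mult tendsto_const lim)
    from LIMSEQ_D[OF this, of "e/4"] e obtain M1 where M1: "\<And>n. n \<ge> M1 \<Longrightarrow>
       norm (2 * \<bar>t\<bar> ^ (2 * N) / fact (2 * N) * (\<integral>x. x ^ (2 * N) \<partial>\<mu> n) - R N) < e/4" by auto
    obtain M2 where M2: "\<And>n. n \<ge> M2 \<Longrightarrow> norm (S N n - L N) < e/4"
      using LIMSEQ_D[OF S_lim, of "e/4"] e by auto
    have "norm (char (\<mu> n) t - complex_of_real (exp (- v * t\<^sup>2 / 2))) < e" if n: "n \<ge> max M1 M2" for n
    proof -
      have "norm (char (\<mu> n) t - complex_of_real (exp (- v * t\<^sup>2 / 2)))
        \<le> norm (char (\<mu> n) t - S N n) + norm (S N n - L N) + norm (L N - complex_of_real (exp (- v * t\<^sup>2 / 2)))"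
        by norm
      moreover have "norm (char (\<mu> n) t - S N n) < e/2"
        using bound[of n N] M1[of n] N1[of N] n by (auto simp: N_def abs_real_def split: if_splits)
      moreover have "norm (S N n - L N) < e/4" using M2 n by simp
      moreover have "norm (L N - complex_of_real (exp (- v * t\<^sup>2 / 2))) < e/4" using N2[of N] by (simp add: N_def)
      ultimately show ?thesis by linarith
    qed
    then show "\<exists>no. \<forall>n\<ge>no. norm (char (\<mu> n) t - complex_of_real (exp (- v * t\<^sup>2 / 2))) < e" by blast
  qed
qed

text \<open>The method of moments applied to a constant sequence; this treats the degenerate law
  along with the others.\<close>

lemma char_normal_law:
  assumes "0 \<le> v"
  shows "char (normal_law 0 v) t = complex_of_real (exp (- v * t\<^sup>2 / 2))"
proof -
  have "(\<lambda>n::nat. char (normal_law 0 v) t) \<longlonglongrightarrow> complex_of_real (exp (- v * t\<^sup>2 / 2))"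
    using assms by (intro char_tendsto_of_moments) (simp_all add: real_distribution_normal_law normal_law_moments)
  then show ?thesis by (simp add: LIMSEQ_const_iff)
qed

section \<open>Gaussian integration by parts\<close>

text \<open>A class closed under sums and products, so that integrability of every polynomial in
  Gaussian variables follows by applying closure rules.\<close>

definition finite_moments :: "'a measure \<Rightarrow> ('a \<Rightarrow> real) \<Rightarrow> bool" where
  "finite_moments M X \<longleftrightarrow> X \<in> borel_measurable M \<and> (\<forall>k. integrable M (\<lambda>\<omega>. \<bar>X \<omega>\<bar> ^ k))"

lemma finite_moments_measurable: "finite_moments M X \<Longrightarrow> X \<in> borel_measurable M"
  by (simp add: finite_moments_def)

lemma finite_moments_integrable_power:
  assumes "finite_moments M X"
  shows "integrable M (\<lambda>\<omega>. X \<omega> ^ k)"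
proof -
  have [measurable]: "X \<in> borel_measurable M" using assms by (simp add: finite_moments_def)
  show ?thesis
  proof (rule Bochner_Integration.integrable_bound)
    show "integrable M (\<lambda>\<omega>. \<bar>X \<omega>\<bar> ^ k)" using assms by (simp add: finite_moments_def)
  qed (auto simp: power_abs)
qed

lemma finite_moments_integrable: "finite_moments M X \<Longrightarrow> integrable M X"
  using finite_moments_integrable_power[of M X 1] by simp

lemma (in finite_measure) finite_moments_const: "finite_moments M (\<lambda>_. c)"
  by (simp add: finite_moments_def)

lemma finite_moments_add:
  assumes "finite_moments M X" "finite_moments M Y"
  shows "finite_moments M (\<lambda>\<omega>. X \<omega> + Y \<omega>)"
  unfolding finite_moments_def
proof safe
  have [measurable]: "X \<in> borel_measurable M" "Y \<in> borel_measurable M"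
    using assms by (simp_all add: finite_moments_def)
  show "(\<lambda>\<omega>. X \<omega> + Y \<omega>) \<in> borel_measurable M" by measurable
  fix k
  have *: "\<bar>x + y\<bar> ^ k \<le> 2 ^ k * (\<bar>x\<bar> ^ k + \<bar>y\<bar> ^ k)" for x y :: real
  proof -
    have "\<bar>x + y\<bar> ^ k \<le> (2 * max \<bar>x\<bar> \<bar>y\<bar>) ^ k" by (intro power_mono) auto
    also have "\<dots> = 2 ^ k * max \<bar>x\<bar> \<bar>y\<bar> ^ k" by (simp add: power_mult_distrib)
    also have "max \<bar>x\<bar> \<bar>y\<bar> ^ k \<le> \<bar>x\<bar> ^ k + \<bar>y\<bar> ^ k" by (cases "\<bar>x\<bar> \<le> \<bar>y\<bar>") auto
    finally show ?thesis by simp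
  qed
  show "integrable M (\<lambda>\<omega>. \<bar>X \<omega> + Y \<omega>\<bar> ^ k)"
  proof (rule Bochner_Integration.integrable_bound)
    show "integrable M (\<lambda>\<omega>. 2 ^ k * (\<bar>X \<omega>\<bar> ^ k + \<bar>Y \<omega>\<bar> ^ k))"
      using assms by (auto simp: finite_moments_def)
  qed (auto intro!: * order_trans[OF * abs_ge_self])
qed

lemma finite_moments_mult:
  assumes "finite_moments M X" "finite_moments M Y"
  shows "finite_moments M (\<lambda>\<omega>. X \<omega> * Y \<omega>)"
  unfolding finite_moments_def
proof safe
  have [measurable]: "X \<in> borel_measurable M" "Y \<in> borel_measurable M"
    using assms by (simp_all add: finite_moments_def)
  show "(\<lambda>\<omega>. X \<omega> * Y \<omega>) \<in> borel_measurable M" by measurable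
  fix k
  have *: "\<bar>x * y\<bar> ^ k \<le> \<bar>x\<bar> ^ (2 * k) + \<bar>y\<bar> ^ (2 * k)" for x y :: real
  proof -
    have "\<bar>x\<bar> ^ k * \<bar>y\<bar> ^ k \<le> (\<bar>x\<bar> ^ k)\<^sup>2 + (\<bar>y\<bar> ^ k)\<^sup>2"
      using sum_squares_bound[of "\<bar>x\<bar> ^ k" "\<bar>y\<bar> ^ k"] by (simp add: algebra_simps)
        (smt (verit) zero_le_power2 mult_nonneg_nonneg abs_ge_zero zero_le_power)
    then show ?thesis by (simp only: power_mult_distrib abs_mult power_even_eq)
  qed
  show "integrable M (\<lambda>\<omega>. \<bar>X \<omega> * Y \<omega>\<bar> ^ k)"
  proof (rule Bochner_Integration.integrable_bound)
    show "integrable M (\<lambda>\<omega>. \<bar>X \<omega>\<bar> ^ (2 * k) + \<bar>Y \<omega>\<bar> ^ (2 * k))"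
      using assms by (auto simp: finite_moments_def)
  qed (auto intro!: * order_trans[OF * abs_ge_self])
qed

lemma (in finite_measure) finite_moments_power:
  "finite_moments M X \<Longrightarrow> finite_moments M (\<lambda>\<omega>. X \<omega> ^ k)"
  by (induction k) (auto intro: finite_moments_const finite_moments_mult)

lemma (in finite_measure) finite_moments_sum:
  "(\<And>i. i \<in> I \<Longrightarrow> finite_moments M (X i)) \<Longrightarrow> finite_moments M (\<lambda>\<omega>. \<Sum>i\<in>I. X i \<omega>)"
  by (induction I rule: infinite_finite_induct) (auto intro: finite_moments_const finite_moments_add)

lemma (in finite_measure) finite_moments_diff:
  assumes "finite_moments M X" "finite_moments M Y"
  shows "finite_moments M (\<lambda>\<omega>. X \<omega> - Y \<omega>)"
  using finite_moments_add[OF assms(1) finite_moments_mult[OF finite_moments_const[of "-1"] assms(2)]] by simp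

text \<open>The binomial theorem makes the expectation a polynomial in e, whose derivative at 0 is
  its linear coefficient; no limit is exchanged with an integral.\<close>

lemma (in finite_measure) DERIV_moment:
  assumes "finite_moments M P" "finite_moments M L" "finite_moments M L'"
  shows "((\<lambda>e. \<integral>\<omega>. P \<omega> * (L \<omega> + e * L' \<omega>) ^ m \<partial>M) has_real_derivative
          real m * (\<integral>\<omega>. P \<omega> * L' \<omega> * L \<omega> ^ (m - 1) \<partial>M)) (at 0)"
proof -
  note fm = assms finite_moments_power finite_moments_mult finite_moments_const
  define A where "A k = real (m choose k) * (\<integral>\<omega>. P \<omega> * (L' \<omega> ^ k * L \<omega> ^ (m - k)) \<partial>M)" for k
  have eq: "(\<integral>\<omega>. P \<omega> * (L \<omega> + e * L' \<omega>) ^ m \<partial>M) = (\<Sum>k\<le>m. A k * e ^ k)" for e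
  proof -
    have "(\<integral>\<omega>. P \<omega> * (L \<omega> + e * L' \<omega>) ^ m \<partial>M)
       = (\<integral>\<omega>. (\<Sum>k\<le>m. real (m choose k) * e ^ k * (P \<omega> * (L' \<omega> ^ k * L \<omega> ^ (m - k)))) \<partial>M)"
    proof (rule Bochner_Integration.integral_cong[OF refl])
      fix \<omega>
      have "(L \<omega> + e * L' \<omega>) ^ m = (\<Sum>k\<le>m. real (m choose k) * (e * L' \<omega>) ^ k * L \<omega> ^ (m - k))"
        by (subst add.commute, subst binomial_ring) simp
      then show "P \<omega> * (L \<omega> + e * L' \<omega>) ^ m =
          (\<Sum>k\<le>m. real (m choose k) * e ^ k * (P \<omega> * (L' \<omega> ^ k * L \<omega> ^ (m - k))))"
        by (simp add: sum_distrib_left power_mult_distrib mult_ac)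
    qed
    also have "\<dots> = (\<Sum>k\<le>m. \<integral>\<omega>. real (m choose k) * e ^ k * (P \<omega> * (L' \<omega> ^ k * L \<omega> ^ (m - k))) \<partial>M)"
      by (intro Bochner_Integration.integral_sum finite_moments_integrable fm)
    also have "\<dots> = (\<Sum>k\<le>m. A k * e ^ k)"
      by (intro sum.cong refl) (simp add: A_def)
    finally show ?thesis .
  qed
  have "((\<lambda>e. \<Sum>k\<le>m. A k * e ^ k) has_real_derivative (\<Sum>k\<le>m. A k * (real k * 0 ^ (k - 1)))) (at 0)"
    by (intro DERIV_sum) (auto intro!: derivative_eq_intros)
  also have "(\<Sum>k\<le>m. A k * (real k * 0 ^ (k - 1))) = (\<Sum>k\<le>m. if k = 1 then A 1 else 0)"
    by (intro sum.cong refl) (auto simp: power_0_left)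
  also have "\<dots> = (if 1 \<le> m then A 1 else 0)" by (subst sum.delta) auto
  also have "\<dots> = real m * (\<integral>\<omega>. P \<omega> * L' \<omega> * L \<omega> ^ (m - 1) \<partial>M)"
    by (auto simp: A_def mult.assoc)
  finally show ?thesis unfolding eq .
qed

lemma (in prob_space) distr_normal_moments:
  assumes X[measurable]: "X \<in> borel_measurable M" and v: "0 \<le> v" "distr M borel X = normal_law 0 v"
  shows "integrable M (\<lambda>\<omega>. X \<omega> ^ k)" and "expectation (\<lambda>\<omega>. X \<omega> ^ k) = gauss_moment v k"
    and "finite_moments M X"
proof -
  have 1: "integrable M (\<lambda>\<omega>. X \<omega> ^ k)" for k
    using normal_law_moments(1)[OF v(1), of k] integrable_distr_eq[of X M borel "\<lambda>x. x ^ k"]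
    by (simp add: v(2))
  then show "integrable M (\<lambda>\<omega>. X \<omega> ^ k)" .
  show "expectation (\<lambda>\<omega>. X \<omega> ^ k) = gauss_moment v k"
    using normal_law_moments(2)[OF v(1), of k] integral_distr[of X M borel "\<lambda>x. x ^ k"]
    by (simp add: v(2))
  have "integrable M (\<lambda>\<omega>. \<bar>X \<omega>\<bar> ^ k)" for k
    using integrable_abs[OF 1[of k]] by (simp add: power_abs)
  then show "finite_moments M X" by (simp add: finite_moments_def)
qed

text \<open>A linear space of centred normal variables: joint normality is encoded by closure under
  linear combinations, with zero variance allowed.\<close>

locale gaussian_space = prob_space M for M :: "'a measure" +
  fixes G :: "('a \<Rightarrow> real) set"
  assumes G_zero: "(\<lambda>_. 0) \<in> G"
    and G_add: "X \<in> G \<Longrightarrow> Y \<in> G \<Longrightarrow> (\<lambda>\<omega>. X \<omega> + Y \<omega>) \<in> G"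
    and G_scale: "X \<in> G \<Longrightarrow> (\<lambda>\<omega>. c * X \<omega>) \<in> G"
    and G_measurable: "X \<in> G \<Longrightarrow> X \<in> borel_measurable M"
    and G_normal: "X \<in> G \<Longrightarrow> \<exists>v\<ge>0. distr M borel X = normal_law 0 v"
begin

lemma G_moments:
  assumes "X \<in> G"
  shows "integrable M (\<lambda>\<omega>. X \<omega> ^ k)"
    and "expectation (\<lambda>\<omega>. X \<omega> ^ k) = gauss_moment (expectation (\<lambda>\<omega>. X \<omega> * X \<omega>)) k"
proof -
  obtain v where v: "v \<ge> 0" "distr M borel X = normal_law 0 v" using G_normal[OF assms] by auto
  note m = distr_normal_moments[OF G_measurable[OF assms] v]
  show "integrable M (\<lambda>\<omega>. X \<omega> ^ k)" by (rule m(1))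
  show "expectation (\<lambda>\<omega>. X \<omega> ^ k) = gauss_moment (expectation (\<lambda>\<omega>. X \<omega> * X \<omega>)) k"
    using m(2)[of k] m(2)[of "Suc (Suc 0)"] by simp
qed

lemma finite_moments_G: "X \<in> G \<Longrightarrow> finite_moments M X"
  using G_normal distr_normal_moments(3) G_measurable by blast

abbreviation cov :: "('a \<Rightarrow> real) \<Rightarrow> ('a \<Rightarrow> real) \<Rightarrow> real" where
  "cov X Y \<equiv> expectation (\<lambda>\<omega>. X \<omega> * Y \<omega>)"

lemma cov_commute: "cov X Y = cov Y X"
  by (simp add: mult.commute)

lemma integrable_G_mult: "X \<in> G \<Longrightarrow> Y \<in> G \<Longrightarrow> integrable M (\<lambda>\<omega>. X \<omega> * Y \<omega>)"
  by (intro finite_moments_integrable finite_moments_mult finite_moments_G)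

lemma cov_add_scale:
  assumes "X \<in> G" "L \<in> G" "L' \<in> G"
  shows "cov X (\<lambda>\<omega>. L \<omega> + e * L' \<omega>) = cov X L + e * cov X L'"
proof -
  have "cov X (\<lambda>\<omega>. L \<omega> + e * L' \<omega>) = expectation (\<lambda>\<omega>. X \<omega> * L \<omega> + e * (X \<omega> * L' \<omega>))"
    by (simp add: algebra_simps)
  also have "\<dots> = cov X L + e * cov X L'"
    using integrable_G_mult[OF assms(1,2)] integrable_G_mult[OF assms(1,3)] by simp
  finally show ?thesis .
qed

text \<open>The moment of order m + 1 of L + e X is differentiated at e = 0 in two ways: under the
  expectation, and as a normal moment whose variance is a quadratic polynomial in e with slope 2 cov
  X L at 0. Comparing the results gives integration by parts for a pure power.\<close>

lemma expectation_mult_power: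
  assumes X: "X \<in> G" and L: "L \<in> G"
  shows "expectation (\<lambda>\<omega>. X \<omega> * L \<omega> ^ m) = real m * expectation (\<lambda>\<omega>. L \<omega> ^ (m - 1)) * cov X L"
proof -
  have G: "(\<lambda>\<omega>. L \<omega> + e * X \<omega>) \<in> G" for e using G_add[OF L G_scale[OF X]] .
  define v where "v e = cov L L + 2 * e * cov X L + e\<^sup>2 * cov X X" for e
  have v: "cov (\<lambda>\<omega>. L \<omega> + e * X \<omega>) (\<lambda>\<omega>. L \<omega> + e * X \<omega>) = v e" for e
  proof -
    let ?Z = "\<lambda>\<omega>. L \<omega> + e * X \<omega>"
    have "cov ?Z ?Z = cov ?Z L + e * cov ?Z X" by (rule cov_add_scale[OF G L X])
    also have "cov ?Z L = cov L ?Z" by (rule cov_commute)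
    also have "cov L ?Z = cov L L + e * cov L X" by (rule cov_add_scale[OF L L X])
    also have "cov L X = cov X L" by (rule cov_commute)
    also have "cov ?Z X = cov X ?Z" by (rule cov_commute)
    also have "cov X ?Z = cov X L + e * cov X X" by (rule cov_add_scale[OF X L X])
    finally show ?thesis unfolding v_def by (simp only: power2_eq_square distrib_left)
  qed
  have "((\<lambda>e. expectation (\<lambda>\<omega>. 1 * (L \<omega> + e * X \<omega>) ^ Suc m)) has_real_derivative
      real (Suc m) * expectation (\<lambda>\<omega>. 1 * X \<omega> * L \<omega> ^ (Suc m - 1))) (at 0)"
    by (intro DERIV_moment finite_moments_const finite_moments_G X L)
  then have 1: "((\<lambda>e. gauss_moment (v e) (Suc m)) has_real_derivative
      real (Suc m) * expectation (\<lambda>\<omega>. X \<omega> * L \<omega> ^ m)) (at 0)"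
    using G_moments(2)[OF G, of _ "Suc m"] unfolding v by simp
  have "(v has_real_derivative 2 * cov X L) (at 0)"
    unfolding v_def by (auto intro!: derivative_eq_intros)
  from DERIV_chain2[OF DERIV_gauss_moment this]
  have 2: "((\<lambda>e. gauss_moment (v e) (Suc m)) has_real_derivative
      real (Suc m) * (real (Suc m) - 1) / 2 * gauss_moment (v 0) (Suc m - 2) * (2 * cov X L)) (at 0)" .
  have "real (Suc m) * expectation (\<lambda>\<omega>. X \<omega> * L \<omega> ^ m)
     = real (Suc m) * (real m * gauss_moment (cov L L) (m - 1) * cov X L)"
    using DERIV_unique[OF 1 2] by (simp add: v_def numeral_2_eq_2)
  then have "expectation (\<lambda>\<omega>. X \<omega> * L \<omega> ^ m) = real m * gauss_moment (cov L L) (m - 1) * cov X L"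
    by (subst (asm) mult_cancel_left) simp
  then show ?thesis using G_moments(2)[OF L, of "m - 1"] by simp
qed

text \<open>\<open>wick P D\<close> says that \<open>P\<close> is a polynomial in elements of \<open>G\<close> and that \<open>D X\<close> is its derivative in
  the direction \<open>X\<close>, where a linear \<open>L\<close> has the constant derivative \<open>cov X L\<close>.\<close>

inductive wick :: "('a \<Rightarrow> real) \<Rightarrow> (('a \<Rightarrow> real) \<Rightarrow> 'a \<Rightarrow> real) \<Rightarrow> bool" where
  wick_const: "wick (\<lambda>_. c) (\<lambda>_ _. 0)"
| wick_lin: "L \<in> G \<Longrightarrow> wick L (\<lambda>X _. cov X L)"
| wick_add: "wick P D \<Longrightarrow> wick Q E \<Longrightarrow> wick (\<lambda>\<omega>. P \<omega> + Q \<omega>) (\<lambda>X \<omega>. D X \<omega> + E X \<omega>)"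
| wick_mult: "wick P D \<Longrightarrow> wick Q E \<Longrightarrow> wick (\<lambda>\<omega>. P \<omega> * Q \<omega>) (\<lambda>X \<omega>. D X \<omega> * Q \<omega> + P \<omega> * E X \<omega>)"

definition ibp :: "('a \<Rightarrow> real) \<Rightarrow> (('a \<Rightarrow> real) \<Rightarrow> 'a \<Rightarrow> real) \<Rightarrow> bool" where
  "ibp P D \<longleftrightarrow> finite_moments M P \<and>
     (\<forall>X\<in>G. finite_moments M (D X) \<and> expectation (\<lambda>\<omega>. X \<omega> * P \<omega>) = expectation (D X))"

text \<open>Integration by parts strengthened by an arbitrary power of a linear variable. The extra
  power is the material from which polarisation extracts new linear factors, and this makes the
  induction over products possible.\<close>

definition ibp_powers :: "('a \<Rightarrow> real) \<Rightarrow> (('a \<Rightarrow> real) \<Rightarrow> 'a \<Rightarrow> real) \<Rightarrow> bool" where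
  "ibp_powers P D \<longleftrightarrow> (\<forall>L\<in>G. \<forall>m. ibp (\<lambda>\<omega>. P \<omega> * L \<omega> ^ m)
     (\<lambda>X \<omega>. D X \<omega> * L \<omega> ^ m + P \<omega> * (real m * L \<omega> ^ (m - 1) * cov X L)))"

lemma ibp_powers_imp_ibp: "ibp_powers P D \<Longrightarrow> ibp P D"
  unfolding ibp_powers_def by (drule bspec[OF _ G_zero], drule spec[where x=0]) simp

lemma ibp_powers_one: "ibp_powers (\<lambda>_. 1) (\<lambda>_ _. 0)"
  unfolding ibp_powers_def ibp_def
  by (auto intro!: finite_moments_power finite_moments_mult finite_moments_const
      simp: expectation_mult_power finite_moments_G)

lemma ibp_add:
  assumes "ibp P D" "ibp Q E"
  shows "ibp (\<lambda>\<omega>. P \<omega> + Q \<omega>) (\<lambda>X \<omega>. D X \<omega> + E X \<omega>)"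
  unfolding ibp_def
proof (intro conjI ballI)
  show "finite_moments M (\<lambda>\<omega>. P \<omega> + Q \<omega>)"
    using assms unfolding ibp_def by (blast intro: finite_moments_add)
  fix X assume X: "X \<in> G"
  have D: "finite_moments M (D X)" "cov X P = expectation (D X)"
    and E: "finite_moments M (E X)" "cov X Q = expectation (E X)"
    using assms X by (simp_all add: ibp_def)
  show "finite_moments M (\<lambda>\<omega>. D X \<omega> + E X \<omega>)"
    using D(1) E(1) by (rule finite_moments_add)
  have "expectation (\<lambda>\<omega>. X \<omega> * (P \<omega> + Q \<omega>)) = cov X P + cov X Q"
    unfolding distrib_left using assms finite_moments_G[OF X]
    by (intro Bochner_Integration.integral_add finite_moments_integrable finite_moments_mult)
      (simp_all add: ibp_def)
  also have "\<dots> = expectation (\<lambda>\<omega>. D X \<omega> + E X \<omega>)"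
    using D E by (simp add: finite_moments_integrable)
  finally show "expectation (\<lambda>\<omega>. X \<omega> * (P \<omega> + Q \<omega>)) = expectation (\<lambda>\<omega>. D X \<omega> + E X \<omega>)" .
qed

lemma ibp_scale:
  assumes "ibp P D"
  shows "ibp (\<lambda>\<omega>. c * P \<omega>) (\<lambda>X \<omega>. c * D X \<omega>)"
  using assms unfolding ibp_def
  by (simp add: mult.left_commute finite_moments_mult finite_moments_const)

text \<open>Polarisation: the identity for \<open>P (L + e L')\<^sup>m\<^sup>+\<^sup>1\<close> is differentiated at \<open>e = 0\<close>.\<close>

lemma ibp_powers_lin:
  assumes PD: "ibp_powers P D" and L': "L' \<in> G"
  shows "ibp_powers (\<lambda>\<omega>. L' \<omega> * P \<omega>) (\<lambda>X \<omega>. cov X L' * P \<omega> + L' \<omega> * D X \<omega>)"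
  unfolding ibp_powers_def
proof (intro ballI allI)
  fix L m assume L: "L \<in> G"
  have P: "finite_moments M P" and D: "X \<in> G \<Longrightarrow> finite_moments M (D X)" for X
    using ibp_powers_imp_ibp[OF PD] by (auto simp: ibp_def)
  note fm = P D L L' finite_moments_power finite_moments_mult finite_moments_const finite_moments_G finite_moments_add
  show "ibp (\<lambda>\<omega>. L' \<omega> * P \<omega> * L \<omega> ^ m)
     (\<lambda>X \<omega>. (cov X L' * P \<omega> + L' \<omega> * D X \<omega>) * L \<omega> ^ m + L' \<omega> * P \<omega> * (real m * L \<omega> ^ (m - 1) * cov X L))"
    unfolding ibp_def
  proof (intro conjI ballI)
    show "finite_moments M (\<lambda>\<omega>. L' \<omega> * P \<omega> * L \<omega> ^ m)" by (intro fm)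
    fix X assume X: "X \<in> G"
    show "finite_moments M (\<lambda>\<omega>. (cov X L' * P \<omega> + L' \<omega> * D X \<omega>) * L \<omega> ^ m +
         L' \<omega> * P \<omega> * (real m * L \<omega> ^ (m - 1) * cov X L))"
      by (intro fm X)
    \<comment> \<open>The difference of the two sides of the known identity for exponent m + 1, with
      L replaced by L + e L'. It vanishes for every e, hence so does its derivative at 0; cancelling
      the factor m + 1 leaves the identity with the additional factor L'.\<close>
    define f where "f e = expectation (\<lambda>\<omega>. (X \<omega> * P \<omega>) * (L \<omega> + e * L' \<omega>) ^ Suc m)
        - expectation (\<lambda>\<omega>. D X \<omega> * (L \<omega> + e * L' \<omega>) ^ Suc m)
        - real (Suc m) * (cov X L + e * cov X L') * expectation (\<lambda>\<omega>. P \<omega> * (L \<omega> + e * L' \<omega>) ^ m)" for e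
    have "f e = 0" for e
    proof -
      have G: "(\<lambda>\<omega>. L \<omega> + e * L' \<omega>) \<in> G" using G_add[OF L G_scale[OF L']] .
      then have "ibp (\<lambda>\<omega>. P \<omega> * (L \<omega> + e * L' \<omega>) ^ Suc m) (\<lambda>X \<omega>. D X \<omega> * (L \<omega> + e * L' \<omega>) ^ Suc m +
          P \<omega> * (real (Suc m) * (L \<omega> + e * L' \<omega>) ^ (Suc m - 1) * cov X (\<lambda>\<omega>. L \<omega> + e * L' \<omega>)))"
        by (rule PD[unfolded ibp_powers_def, rule_format])
      then have "expectation (\<lambda>\<omega>. X \<omega> * (P \<omega> * (L \<omega> + e * L' \<omega>) ^ Suc m)) =
        expectation (\<lambda>\<omega>. D X \<omega> * (L \<omega> + e * L' \<omega>) ^ Suc m +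
          P \<omega> * (real (Suc m) * (L \<omega> + e * L' \<omega>) ^ (Suc m - 1) * cov X (\<lambda>\<omega>. L \<omega> + e * L' \<omega>)))"
        unfolding ibp_def using X by (elim conjE, drule_tac bspec) simp_all
      also have "\<dots> = expectation (\<lambda>\<omega>. D X \<omega> * (L \<omega> + e * L' \<omega>) ^ Suc m +
          (real (Suc m) * (cov X L + e * cov X L')) * (P \<omega> * (L \<omega> + e * L' \<omega>) ^ m))"
        unfolding cov_add_scale[OF X L L'] by (simp add: mult_ac)
      also have "\<dots> = expectation (\<lambda>\<omega>. D X \<omega> * (L \<omega> + e * L' \<omega>) ^ Suc m) +
          expectation (\<lambda>\<omega>. (real (Suc m) * (cov X L + e * cov X L')) * (P \<omega> * (L \<omega> + e * L' \<omega>) ^ m))"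
        by (intro Bochner_Integration.integral_add finite_moments_integrable fm X)
      finally show ?thesis unfolding f_def by (simp add: mult.assoc)
    qed
    then have "f = (\<lambda>_. 0)" by auto
    then have 0: "(f has_real_derivative 0) (at 0)" by simp
    have "(f has_real_derivative
        (real (Suc m) * expectation (\<lambda>\<omega>. X \<omega> * P \<omega> * L' \<omega> * L \<omega> ^ (Suc m - 1)))
        - (real (Suc m) * expectation (\<lambda>\<omega>. D X \<omega> * L' \<omega> * L \<omega> ^ (Suc m - 1)))
        - (real (Suc m) * cov X L' * expectation (\<lambda>\<omega>. P \<omega> * (L \<omega> + 0 * L' \<omega>) ^ m)
          + (real m * expectation (\<lambda>\<omega>. P \<omega> * L' \<omega> * L \<omega> ^ (m - 1))) * (real (Suc m) * (cov X L + 0 * cov X L')))) (at 0)"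
      unfolding f_def by (intro DERIV_diff DERIV_mult DERIV_moment fm X) (auto intro!: derivative_eq_intros)
    from DERIV_unique[OF this 0]
    have "real (Suc m) * (expectation (\<lambda>\<omega>. X \<omega> * P \<omega> * L' \<omega> * L \<omega> ^ m)
       - expectation (\<lambda>\<omega>. D X \<omega> * L' \<omega> * L \<omega> ^ m) - cov X L' * expectation (\<lambda>\<omega>. P \<omega> * L \<omega> ^ m)
       - real m * cov X L * expectation (\<lambda>\<omega>. P \<omega> * L' \<omega> * L \<omega> ^ (m - 1))) = 0"
      by (simp del: of_nat_Suc add: algebra_simps)
    then have *: "expectation (\<lambda>\<omega>. X \<omega> * P \<omega> * L' \<omega> * L \<omega> ^ m) =
        expectation (\<lambda>\<omega>. D X \<omega> * L' \<omega> * L \<omega> ^ m) + cov X L' * expectation (\<lambda>\<omega>. P \<omega> * L \<omega> ^ m)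
       + real m * cov X L * expectation (\<lambda>\<omega>. P \<omega> * L' \<omega> * L \<omega> ^ (m - 1))"
      by (simp del: of_nat_Suc)
    have "expectation (\<lambda>\<omega>. X \<omega> * (L' \<omega> * P \<omega> * L \<omega> ^ m)) = expectation (\<lambda>\<omega>. X \<omega> * P \<omega> * L' \<omega> * L \<omega> ^ m)"
      by (simp add: mult_ac)
    also have "\<dots> = expectation (\<lambda>\<omega>. D X \<omega> * L' \<omega> * L \<omega> ^ m) + expectation (\<lambda>\<omega>. cov X L' * (P \<omega> * L \<omega> ^ m))
       + expectation (\<lambda>\<omega>. real m * cov X L * (P \<omega> * L' \<omega> * L \<omega> ^ (m - 1)))"
      unfolding * by simp
    also have "\<dots> = expectation (\<lambda>\<omega>. D X \<omega> * L' \<omega> * L \<omega> ^ m + cov X L' * (P \<omega> * L \<omega> ^ m)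
       + real m * cov X L * (P \<omega> * L' \<omega> * L \<omega> ^ (m - 1)))"
      by (subst Bochner_Integration.integral_add[symmetric], (intro finite_moments_integrable fm X)+)+ simp
    also have "\<dots> = expectation (\<lambda>\<omega>. (cov X L' * P \<omega> + L' \<omega> * D X \<omega>) * L \<omega> ^ m +
         L' \<omega> * P \<omega> * (real m * L \<omega> ^ (m - 1) * cov X L))"
      by (intro Bochner_Integration.integral_cong refl) (simp add: algebra_simps)
    finally show "expectation (\<lambda>\<omega>. X \<omega> * (L' \<omega> * P \<omega> * L \<omega> ^ m)) = expectation (\<lambda>\<omega>. (cov X L' * P \<omega> + L' \<omega> * D X \<omega>) * L \<omega> ^ m +
         L' \<omega> * P \<omega> * (real m * L \<omega> ^ (m - 1) * cov X L))" .
  qed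
qed

text \<open>Induction on the polynomial P with the cofactor Q arbitrary: for a product the
  hypothesis for the second factor is applied to Q, and the one for the first factor to the result.
  Linear factors are the polarisation step.\<close>

lemma wick_ibp_powers:
  assumes "wick P D" "ibp_powers Q E"
  shows "ibp_powers (\<lambda>\<omega>. P \<omega> * Q \<omega>) (\<lambda>X \<omega>. D X \<omega> * Q \<omega> + P \<omega> * E X \<omega>)"
  using assms
proof (induction arbitrary: Q E)
  case (wick_const c)
  show ?case unfolding ibp_powers_def
  proof (intro ballI allI)
    fix L m assume "L \<in> G"
    then have "ibp (\<lambda>\<omega>. c * (Q \<omega> * L \<omega> ^ m))
        (\<lambda>X \<omega>. c * (E X \<omega> * L \<omega> ^ m + Q \<omega> * (real m * L \<omega> ^ (m - 1) * cov X L)))"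
      using wick_const unfolding ibp_powers_def by (intro ibp_scale) blast
    then show "ibp (\<lambda>\<omega>. c * Q \<omega> * L \<omega> ^ m)
        (\<lambda>X \<omega>. (0 * Q \<omega> + c * E X \<omega>) * L \<omega> ^ m + c * Q \<omega> * (real m * L \<omega> ^ (m - 1) * cov X L))"
      by (simp add: distrib_left mult.assoc)
  qed
next
  case (wick_lin L)
  then show ?case by (simp add: ibp_powers_lin)
next
  case (wick_add P D P' D')
  show ?case unfolding ibp_powers_def
  proof (intro ballI allI)
    fix L m assume L: "L \<in> G"
    have "ibp (\<lambda>\<omega>. P \<omega> * Q \<omega> * L \<omega> ^ m + P' \<omega> * Q \<omega> * L \<omega> ^ m)
      (\<lambda>X \<omega>. ((D X \<omega> * Q \<omega> + P \<omega> * E X \<omega>) * L \<omega> ^ m + P \<omega> * Q \<omega> * (real m * L \<omega> ^ (m - 1) * cov X L))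
        + ((D' X \<omega> * Q \<omega> + P' \<omega> * E X \<omega>) * L \<omega> ^ m + P' \<omega> * Q \<omega> * (real m * L \<omega> ^ (m - 1) * cov X L)))"
      using wick_add.IH[OF wick_add.prems] L unfolding ibp_powers_def by (intro ibp_add) blast+
    then show "ibp (\<lambda>\<omega>. (P \<omega> + P' \<omega>) * Q \<omega> * L \<omega> ^ m)
      (\<lambda>X \<omega>. ((D X \<omega> + D' X \<omega>) * Q \<omega> + (P \<omega> + P' \<omega>) * E X \<omega>) * L \<omega> ^ m
        + (P \<omega> + P' \<omega>) * Q \<omega> * (real m * L \<omega> ^ (m - 1) * cov X L))"
      by (rule arg_cong2[where f=ibp, THEN iffD1, rotated 2]) (auto simp: fun_eq_iff algebra_simps)
  qed
next
  case (wick_mult P D P' D')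
  from wick_mult.IH(1)[OF wick_mult.IH(2)[OF wick_mult.prems]]
  show ?case by (simp add: algebra_simps)
qed

theorem wick_ibp:
  assumes "wick P D"
  shows "ibp P D"
  using ibp_powers_imp_ibp[OF wick_ibp_powers[OF assms ibp_powers_one]] by simp

end

section \<open>Quadratic forms in Gaussian variables\<close>

text \<open>Jensen's inequality with equal weights for the power q + 1, which is convex on the
  nonnegative reals.\<close>

lemma sum_power_le_card:
  fixes x :: "'b \<Rightarrow> real"
  assumes "\<And>k. k \<in> K \<Longrightarrow> 0 \<le> x k"
  shows "(\<Sum>k\<in>K. x k) ^ Suc q \<le> real (card K) ^ q * (\<Sum>k\<in>K. x k ^ Suc q)"
proof (cases "finite K \<and> K \<noteq> {}")
  case True
  then have c: "0 < real (card K)" by (auto simp: card_gt_0_iff)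
  have conv: "convex_on {0..} (\<lambda>x::real. x ^ Suc q)"
    using convex_on_subset[OF convex_power_even, of "Suc q" "{0..}"] convex_power_odd[of "Suc q"] by blast
  have "(\<lambda>x. x ^ Suc q) (\<Sum>k\<in>K. (1 / real (card K)) *\<^sub>R x k) \<le> (\<Sum>k\<in>K. 1 / real (card K) * (\<lambda>x. x ^ Suc q) (x k))"
    by (rule convex_on_sum[OF _ _ conv]) (use True c assms in auto)
  then have "((\<Sum>k\<in>K. x k) / real (card K)) ^ Suc q \<le> (\<Sum>k\<in>K. x k ^ Suc q) / real (card K)"
    by (simp add: sum_divide_distrib[symmetric] del: power_Suc)
  then have "(\<Sum>k\<in>K. x k) ^ Suc q / real (card K) ^ Suc q \<le> (\<Sum>k\<in>K. x k ^ Suc q) / real (card K)"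
    by (simp only: power_divide)
  then show ?thesis using c by (simp add: divide_simps mult_ac) 
qed auto

text \<open>A Young inequality with crude constants: either y is at most e x, or x is at most y / e.
  The parameter e makes one term small at the expense of the other.\<close>

lemma power_mult_le_young:
  fixes x y e :: real
  assumes "0 \<le> x" "0 \<le> y" "0 < e"
  shows "x ^ q * y \<le> e * x ^ Suc q + (1 / e) ^ q * y ^ Suc q"
proof (cases "y \<le> e * x")
  case True
  then have "x ^ q * y \<le> x ^ q * (e * x)" using assms by (intro mult_left_mono) auto
  also have "\<dots> = e * x ^ Suc q" by simp
  finally show ?thesis using assms by (smt (verit) zero_le_power mult_nonneg_nonneg divide_nonneg_pos)
next
  case False
  then have "x \<le> 1 / e * y" using assms by (simp add: field_simps)
  then have "x ^ q \<le> (1 / e * y) ^ q" using assms by (intro power_mono)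
  then have "x ^ q * y \<le> (1 / e * y) ^ q * y" using assms by (intro mult_right_mono)
  also have "\<dots> = (1 / e) ^ q * y ^ Suc q" by (simp only: power_mult_distrib power_Suc2 mult.assoc)
  finally show ?thesis using assms by (smt (verit) zero_le_power mult_nonneg_nonneg)
qed

context gaussian_space
begin

lemma wick_finite_moments: "wick P D \<Longrightarrow> finite_moments M P"
  using wick_ibp by (auto simp: ibp_def)

lemma wick_expectation:
  "wick P D \<Longrightarrow> X \<in> G \<Longrightarrow> expectation (\<lambda>\<omega>. X \<omega> * P \<omega>) = expectation (D X)"
  using wick_ibp by (auto simp: ibp_def)

lemma wick_cong: "wick P D \<Longrightarrow> (\<And>\<omega>. P \<omega> = P' \<omega>) \<Longrightarrow> (\<And>X \<omega>. D X \<omega> = D' X \<omega>) \<Longrightarrow> wick P' D'"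
  by (metis ext)

lemma wick_scale: "wick P D \<Longrightarrow> wick (\<lambda>\<omega>. c * P \<omega>) (\<lambda>X \<omega>. c * D X \<omega>)"
  by (rule wick_cong[OF wick_mult[OF wick_const[of c]]]) auto

lemma wick_power:
  assumes "wick P D"
  shows "wick (\<lambda>\<omega>. P \<omega> ^ m) (\<lambda>X \<omega>. real m * P \<omega> ^ (m - 1) * D X \<omega>)"
proof (induction m)
  case 0
  show ?case by (rule wick_cong[OF wick_const[of 1]]) auto
next
  case (Suc m)
  show ?case
    by (rule wick_cong[OF wick_mult[OF assms Suc]]) (cases m; simp add: algebra_simps)+
qed

lemma wick_sum:
  assumes "\<And>i. i \<in> I \<Longrightarrow> wick (P i) (D i)"
  shows "wick (\<lambda>\<omega>. \<Sum>i\<in>I. P i \<omega>) (\<lambda>X \<omega>. \<Sum>i\<in>I. D i X \<omega>)"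
  using assms
proof (induction I rule: infinite_finite_induct)
  case (insert i I)
  have "wick (\<lambda>\<omega>. P i \<omega> + (\<Sum>i\<in>I. P i \<omega>)) (\<lambda>X \<omega>. D i X \<omega> + (\<Sum>i\<in>I. D i X \<omega>))"
    using insert by (intro wick_add) auto
  with insert show ?case by simp
qed (auto intro: wick_const[of 0])

text \<open>One integration by parts in X reduces the fourth moment to second moments.\<close>

lemma isserlis:
  assumes "X \<in> G" "Y \<in> G" "Z \<in> G" "V \<in> G"
  shows "expectation (\<lambda>\<omega>. X \<omega> * (Y \<omega> * (Z \<omega> * V \<omega>))) =
    cov X Y * cov Z V + cov X Z * cov Y V + cov X V * cov Y Z"
proof -
  have "wick (\<lambda>\<omega>. Y \<omega> * (Z \<omega> * V \<omega>))
    (\<lambda>X \<omega>. cov X Y * (Z \<omega> * V \<omega>) + Y \<omega> * (cov X Z * V \<omega> + Z \<omega> * cov X V))"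
    by (intro wick_mult wick_lin assms)
  then have "expectation (\<lambda>\<omega>. X \<omega> * (Y \<omega> * (Z \<omega> * V \<omega>))) =
    expectation (\<lambda>\<omega>. cov X Y * (Z \<omega> * V \<omega>) + Y \<omega> * (cov X Z * V \<omega> + Z \<omega> * cov X V))"
    using assms(1) by (rule wick_expectation)
  also have "\<dots> = expectation (\<lambda>\<omega>. cov X Y * (Z \<omega> * V \<omega>) + cov X Z * (Y \<omega> * V \<omega>) + cov X V * (Y \<omega> * Z \<omega>))"
    by (intro Bochner_Integration.integral_cong refl) (simp add: algebra_simps)
  also have "\<dots> = cov X Y * cov Z V + cov X Z * cov Y V + cov X V * cov Y Z"
    using assms by (simp add: integrable_G_mult)
  finally show ?thesis .
qed

text \<open>An element of the second Wiener chaos, diagonal in variables \<open>U k\<close> that may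
  be correlated. Carrying the correlations in \<open>U\<close> keeps the coefficients a single
  family.\<close>

definition quad :: "'k set \<Rightarrow> ('k \<Rightarrow> 'a \<Rightarrow> real) \<Rightarrow> ('k \<Rightarrow> real) \<Rightarrow> 'a \<Rightarrow> real" where
  "quad K U d \<omega> = (\<Sum>k\<in>K. d k * ((U k \<omega>)\<^sup>2 - cov (U k) (U k)))"

text \<open>Up to the factor \<open>4\<close> this is the squared gradient of \<open>quad K U d\<close>.\<close>

definition quad_grad :: "'k set \<Rightarrow> ('k \<Rightarrow> 'a \<Rightarrow> real) \<Rightarrow> ('k \<Rightarrow> real) \<Rightarrow> 'a \<Rightarrow> real" where
  "quad_grad K U d \<omega> = (\<Sum>k\<in>K. \<Sum>l\<in>K. d k * d l * cov (U k) (U l) * (U k \<omega> * U l \<omega>))"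

lemma wick_quad:
  assumes "\<And>k. k \<in> K \<Longrightarrow> U k \<in> G"
  shows "wick (quad K U d) (\<lambda>X \<omega>. \<Sum>k\<in>K. 2 * d k * cov X (U k) * U k \<omega>)"
proof -
  have "wick (\<lambda>\<omega>. \<Sum>k\<in>K. d k * (U k \<omega> * U k \<omega> + - cov (U k) (U k)))
     (\<lambda>X \<omega>. \<Sum>k\<in>K. d k * ((cov X (U k) * U k \<omega> + U k \<omega> * cov X (U k)) + 0))"
    using assms by (intro wick_sum wick_scale wick_add wick_mult wick_lin wick_const)
  then show ?thesis
    by (rule wick_cong) (auto simp: quad_def power2_eq_square intro!: sum.cong)
qed

lemma finite_moments_quad:
  assumes "\<And>k. k \<in> K \<Longrightarrow> U k \<in> G"
  shows "finite_moments M (quad K U d)"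
  using wick_quad[OF assms] by (rule wick_finite_moments)

lemma finite_moments_quad_grad:
  assumes "\<And>k. k \<in> K \<Longrightarrow> U k \<in> G"
  shows "finite_moments M (quad_grad K U d)"
  unfolding quad_grad_def using assms
  by (intro finite_moments_sum finite_moments_mult finite_moments_const) (simp_all add: finite_moments_G)

text \<open>One factor F is expanded, and integration by parts is applied to U k times (U k F^m).
  Differentiating the second U k produces the variance, which the centring of F cancels;
  differentiating F^m produces m F^(m-1) times the gradient of F.\<close>

lemma quad_moment_Suc:
  assumes U: "\<And>k. k \<in> K \<Longrightarrow> U k \<in> G"
  shows "expectation (\<lambda>\<omega>. quad K U d \<omega> ^ Suc m) =
    2 * real m * expectation (\<lambda>\<omega>. quad K U d \<omega> ^ (m - 1) * quad_grad K U d \<omega>)"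
proof -
  let ?F = "quad K U d"
  have fm: "finite_moments M ?F" by (rule finite_moments_quad[OF U])
  note fms = fm finite_moments_power finite_moments_mult finite_moments_const
  define D where "D X \<omega> = (\<Sum>l\<in>K. 2 * d l * cov X (U l) * U l \<omega>)" for X \<omega>
  have w: "wick ?F D" unfolding D_def by (rule wick_quad[OF U])
  have fmD: "finite_moments M (D X)" for X
    unfolding D_def using U by (intro finite_moments_sum finite_moments_mult finite_moments_const) (simp_all add: finite_moments_G)
  have step: "expectation (\<lambda>\<omega>. U k \<omega> * (U k \<omega> * ?F \<omega> ^ m)) = cov (U k) (U k) * expectation (\<lambda>\<omega>. ?F \<omega> ^ m)
      + expectation (\<lambda>\<omega>. U k \<omega> * (real m * ?F \<omega> ^ (m - 1) * D (U k) \<omega>))" if k: "k \<in> K" for k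
  proof -
    have "expectation (\<lambda>\<omega>. U k \<omega> * (U k \<omega> * ?F \<omega> ^ m)) =
        expectation (\<lambda>\<omega>. cov (U k) (U k) * ?F \<omega> ^ m + U k \<omega> * (real m * ?F \<omega> ^ (m - 1) * D (U k) \<omega>))"
      by (rule wick_expectation[OF wick_mult[OF wick_lin wick_power[OF w]]]) (use U k in auto)
    also have "\<dots> = expectation (\<lambda>\<omega>. cov (U k) (U k) * ?F \<omega> ^ m)
        + expectation (\<lambda>\<omega>. U k \<omega> * (real m * ?F \<omega> ^ (m - 1) * D (U k) \<omega>))"
      using finite_moments_G[OF U[OF k]]
      by (intro Bochner_Integration.integral_add finite_moments_integrable fms fmD)
    finally show ?thesis by simp
  qed
  have "expectation (\<lambda>\<omega>. ?F \<omega> ^ Suc m) =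
      expectation (\<lambda>\<omega>. \<Sum>k\<in>K. d k * (U k \<omega> * (U k \<omega> * ?F \<omega> ^ m)) - d k * cov (U k) (U k) * ?F \<omega> ^ m)"
  proof (rule Bochner_Integration.integral_cong[OF refl])
    fix \<omega>
    have "?F \<omega> * z = (\<Sum>k\<in>K. d k * (U k \<omega> * (U k \<omega> * z)) - d k * cov (U k) (U k) * z)" for z
      unfolding quad_def sum_distrib_right by (intro sum.cong refl) (simp add: algebra_simps power2_eq_square)
    then show "?F \<omega> ^ Suc m = (\<Sum>k\<in>K. d k * (U k \<omega> * (U k \<omega> * ?F \<omega> ^ m)) - d k * cov (U k) (U k) * ?F \<omega> ^ m)"
      unfolding power_Suc .
  qed
  also have "\<dots> = (\<Sum>k\<in>K. expectation (\<lambda>\<omega>. d k * (U k \<omega> * (U k \<omega> * ?F \<omega> ^ m)) - d k * cov (U k) (U k) * ?F \<omega> ^ m))"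
    by (intro Bochner_Integration.integral_sum finite_moments_integrable finite_moments_diff fms)
      (simp_all add: finite_moments_G U)
  also have "\<dots> = (\<Sum>k\<in>K. d k * expectation (\<lambda>\<omega>. U k \<omega> * (real m * ?F \<omega> ^ (m - 1) * D (U k) \<omega>)))"
  proof (rule sum.cong[OF refl])
    fix k assume k: "k \<in> K"
    have "expectation (\<lambda>\<omega>. d k * (U k \<omega> * (U k \<omega> * ?F \<omega> ^ m)) - d k * cov (U k) (U k) * ?F \<omega> ^ m)
       = expectation (\<lambda>\<omega>. d k * (U k \<omega> * (U k \<omega> * ?F \<omega> ^ m))) - expectation (\<lambda>\<omega>. d k * cov (U k) (U k) * ?F \<omega> ^ m)"
      using finite_moments_G[OF U[OF k]]
      by (intro Bochner_Integration.integral_diff finite_moments_integrable fms)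
    then show "expectation (\<lambda>\<omega>. d k * (U k \<omega> * (U k \<omega> * ?F \<omega> ^ m)) - d k * cov (U k) (U k) * ?F \<omega> ^ m)
       = d k * expectation (\<lambda>\<omega>. U k \<omega> * (real m * ?F \<omega> ^ (m - 1) * D (U k) \<omega>))"
      using step[OF k] by (simp add: algebra_simps)
  qed
  also have "\<dots> = (\<Sum>k\<in>K. expectation (\<lambda>\<omega>. d k * (U k \<omega> * (real m * ?F \<omega> ^ (m - 1) * D (U k) \<omega>))))"
    by simp
  also have "\<dots> = expectation (\<lambda>\<omega>. \<Sum>k\<in>K. d k * (U k \<omega> * (real m * ?F \<omega> ^ (m - 1) * D (U k) \<omega>)))"
    by (intro Bochner_Integration.integral_sum[symmetric] finite_moments_integrable fms fmD)
      (simp_all add: finite_moments_G U)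
  also have "\<dots> = expectation (\<lambda>\<omega>. (2 * real m) * (?F \<omega> ^ (m - 1) * quad_grad K U d \<omega>))"
    unfolding D_def quad_grad_def
    by (intro Bochner_Integration.integral_cong refl) (simp add: sum_distrib_left sum_distrib_right mult_ac)
  finally show ?thesis by simp
qed

lemma expectation_quad: "(\<And>k. k \<in> K \<Longrightarrow> U k \<in> G) \<Longrightarrow> expectation (quad K U d) = 0"
  using quad_moment_Suc[of K U d 0] by simp

lemma expectation_quad_grad:
  assumes "\<And>k. k \<in> K \<Longrightarrow> U k \<in> G"
  shows "expectation (quad_grad K U d) = (\<Sum>k\<in>K. \<Sum>l\<in>K. d k * d l * (cov (U k) (U l))\<^sup>2)"
proof -
  have "expectation (quad_grad K U d) = (\<Sum>k\<in>K. expectation (\<lambda>\<omega>. \<Sum>l\<in>K. d k * d l * cov (U k) (U l) * (U k \<omega> * U l \<omega>)))"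
    unfolding quad_grad_def using assms
    by (intro Bochner_Integration.integral_sum finite_moments_integrable finite_moments_sum finite_moments_mult finite_moments_const)
      (simp_all add: finite_moments_G)
  also have "\<dots> = (\<Sum>k\<in>K. \<Sum>l\<in>K. expectation (\<lambda>\<omega>. d k * d l * cov (U k) (U l) * (U k \<omega> * U l \<omega>)))"
    using assms
    by (intro sum.cong refl Bochner_Integration.integral_sum finite_moments_integrable finite_moments_mult finite_moments_const)
      (simp_all add: finite_moments_G)
  finally show ?thesis by (simp add: power2_eq_square mult.assoc)
qed

lemma quad_second_moment:
  assumes "\<And>k. k \<in> K \<Longrightarrow> U k \<in> G"
  shows "expectation (\<lambda>\<omega>. (quad K U d \<omega>)\<^sup>2) = 2 * (\<Sum>k\<in>K. \<Sum>l\<in>K. d k * d l * (cov (U k) (U l))\<^sup>2)"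
  using quad_moment_Suc[OF assms, where d=d and m=1] expectation_quad_grad[OF assms, where d=d]
  by (simp add: numeral_2_eq_2)

text \<open>Isserlis' formula turns the variance into sums of products of four covariances. One is
  bounded pointwise by C and three are summed along rows, so only one free index remains and the
  cardinality enters to the first power. If D^2 times the cardinality stays bounded, the variance is
  of order D^2.\<close>

lemma quad_grad_variance:
  assumes U: "\<And>k. k \<in> K \<Longrightarrow> U k \<in> G"
    and d: "\<And>k. k \<in> K \<Longrightarrow> \<bar>d k\<bar> \<le> D"
    and C: "\<And>k. k \<in> K \<Longrightarrow> (\<Sum>l\<in>K. \<bar>cov (U k) (U l)\<bar>) \<le> C"
    and K: "finite K"
  shows "expectation (\<lambda>\<omega>. (quad_grad K U d \<omega> - expectation (quad_grad K U d))\<^sup>2) \<le> 2 * D ^ 4 * C ^ 4 * real (card K)"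
proof (cases "K = {}")
  case True
  then have "quad_grad K U d = (\<lambda>_. 0)" by (auto simp: quad_grad_def)
  with True show ?thesis by simp
next
  case False
  then obtain k0 where "k0 \<in> K" by auto
  have D0: "0 \<le> D" using d[OF \<open>k0 \<in> K\<close>] by simp
  have C0: "0 \<le> C" by (rule order_trans[OF sum_nonneg C[OF \<open>k0 \<in> K\<close>]]) simp
  define \<Gamma> where "\<Gamma> k l = cov (U k) (U l)" for k l
  have row: "(\<Sum>l\<in>K. \<bar>\<Gamma> k l\<bar>) \<le> C" if "k \<in> K" for k using C[OF that] by (simp add: \<Gamma>_def)
  have \<Gamma>C: "\<bar>\<Gamma> k l\<bar> \<le> C" if "k \<in> K" "l \<in> K" for k l
    using member_le_sum[of l K "\<lambda>l. \<bar>\<Gamma> k l\<bar>"] row[OF that(1)] that K by simp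
  let ?S = "K \<times> K"
  define w where "w x = d (fst x) * d (snd x) * \<Gamma> (fst x) (snd x)" for x
  define V where "V x \<omega> = U (fst x) \<omega> * U (snd x) \<omega>" for x \<omega>
  \<comment> \<open>What Isserlis' formula leaves for the covariance of \<open>V x\<close> and
    \<open>V y\<close> once the product of the means is removed.\<close>
  define T where "T x y = \<Gamma> (fst x) (fst y) * \<Gamma> (snd x) (snd y) + \<Gamma> (fst x) (snd y) * \<Gamma> (snd x) (fst y)" for x y
  define \<gamma> where "\<gamma> x = \<Gamma> (fst x) (snd x)" for x
  have grad: "quad_grad K U d \<omega> = (\<Sum>x\<in>?S. w x * V x \<omega>)" for \<omega>
    unfolding quad_grad_def by (simp add: sum.cartesian_product w_def V_def \<Gamma>_def case_prod_unfold)
  have fmV: "finite_moments M (V x)" if "x \<in> ?S" for x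
    unfolding V_def using that U by (intro finite_moments_mult finite_moments_G) auto
  have EV: "expectation (V x) = \<gamma> x" for x by (simp add: V_def[abs_def] \<gamma>_def \<Gamma>_def)
  have EVV: "expectation (\<lambda>\<omega>. V x \<omega> * V y \<omega>) = \<gamma> x * \<gamma> y + T x y" if "x \<in> ?S" "y \<in> ?S" for x y
    using isserlis[of "U (fst x)" "U (snd x)" "U (fst y)" "U (snd y)"] that U
    by (auto simp: V_def \<gamma>_def T_def \<Gamma>_def mult.assoc)
  have Egrad: "expectation (quad_grad K U d) = (\<Sum>x\<in>?S. w x * \<gamma> x)"
  proof -
    have "expectation (quad_grad K U d) = expectation (\<lambda>\<omega>. \<Sum>x\<in>?S. w x * V x \<omega>)"
      using grad by presburger
    also have "\<dots> = (\<Sum>x\<in>?S. expectation (\<lambda>\<omega>. w x * V x \<omega>))"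
      by (intro Bochner_Integration.integral_sum finite_moments_integrable finite_moments_mult finite_moments_const fmV)
    finally show ?thesis by (simp add: EV)
  qed
  have "expectation (\<lambda>\<omega>. (quad_grad K U d \<omega> - expectation (quad_grad K U d))\<^sup>2)
      = expectation (\<lambda>\<omega>. \<Sum>x\<in>?S. \<Sum>y\<in>?S. w x * w y * ((V x \<omega> - \<gamma> x) * (V y \<omega> - \<gamma> y)))"
  proof (rule Bochner_Integration.integral_cong[OF refl])
    fix \<omega>
    have "quad_grad K U d \<omega> - expectation (quad_grad K U d) = (\<Sum>x\<in>?S. w x * (V x \<omega> - \<gamma> x))"
      unfolding grad Egrad by (simp only: sum_subtractf right_diff_distrib)
    then show "(quad_grad K U d \<omega> - expectation (quad_grad K U d))\<^sup>2
        = (\<Sum>x\<in>?S. \<Sum>y\<in>?S. w x * w y * ((V x \<omega> - \<gamma> x) * (V y \<omega> - \<gamma> y)))"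
      by (simp only: power2_eq_square sum_product mult_ac)
  qed
  also have "\<dots> = (\<Sum>x\<in>?S. \<Sum>y\<in>?S. expectation (\<lambda>\<omega>. w x * w y * ((V x \<omega> - \<gamma> x) * (V y \<omega> - \<gamma> y))))"
    by (subst Bochner_Integration.integral_sum, (intro finite_moments_integrable finite_moments_sum finite_moments_mult finite_moments_const finite_moments_diff fmV; assumption),
        intro sum.cong refl Bochner_Integration.integral_sum finite_moments_integrable finite_moments_mult finite_moments_const finite_moments_diff fmV)
  also have "\<dots> = (\<Sum>x\<in>?S. \<Sum>y\<in>?S. w x * w y * T x y)"
  proof (intro sum.cong refl)
    fix x y assume xy: "x \<in> ?S" "y \<in> ?S"
    have i: "integrable M (\<lambda>\<omega>. V x \<omega> * V y \<omega>)" "integrable M (V x)" "integrable M (V y)"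
      using xy by (auto intro!: finite_moments_integrable finite_moments_mult fmV)
    have "expectation (\<lambda>\<omega>. (V x \<omega> - \<gamma> x) * (V y \<omega> - \<gamma> y))
      = expectation (\<lambda>\<omega>. V x \<omega> * V y \<omega> - \<gamma> y * V x \<omega> - \<gamma> x * V y \<omega> + \<gamma> x * \<gamma> y)"
      by (intro Bochner_Integration.integral_cong refl) (simp add: algebra_simps)
    also have "\<dots> = T x y" using i EVV[OF xy] by (simp add: EV prob_space)
    finally show "expectation (\<lambda>\<omega>. w x * w y * ((V x \<omega> - \<gamma> x) * (V y \<omega> - \<gamma> y))) = w x * w y * T x y" by simp
  qed
  also have "\<dots> \<le> (\<Sum>x\<in>?S. \<bar>w x\<bar> * (2 * D ^ 2 * C ^ 3))"
  proof (rule sum_mono)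
    fix x assume x: "x \<in> ?S"
    then obtain k l where kl: "x = (k, l)" "k \<in> K" "l \<in> K" by auto
    have "(\<Sum>y\<in>?S. \<bar>w y\<bar> * \<bar>T x y\<bar>) \<le>
        (\<Sum>y\<in>?S. D\<^sup>2 * C * (\<bar>\<Gamma> k (fst y)\<bar> * \<bar>\<Gamma> l (snd y)\<bar> + \<bar>\<Gamma> k (snd y)\<bar> * \<bar>\<Gamma> l (fst y)\<bar>))"
    proof (intro sum_mono mult_mono)
      fix y assume y: "y \<in> ?S"
      then show "\<bar>w y\<bar> \<le> D\<^sup>2 * C"
        unfolding w_def abs_mult power2_eq_square using D0 C0 by (intro mult_mono d \<Gamma>C) auto
      show "\<bar>T x y\<bar> \<le> \<bar>\<Gamma> k (fst y)\<bar> * \<bar>\<Gamma> l (snd y)\<bar> + \<bar>\<Gamma> k (snd y)\<bar> * \<bar>\<Gamma> l (fst y)\<bar>"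
        unfolding T_def kl fst_conv snd_conv by (metis abs_triangle_ineq abs_mult)
    qed (use D0 C0 in auto)
    also have "\<dots> = D\<^sup>2 * C * ((\<Sum>p\<in>K. \<Sum>q\<in>K. \<bar>\<Gamma> k p\<bar> * \<bar>\<Gamma> l q\<bar>) + (\<Sum>p\<in>K. \<Sum>q\<in>K. \<bar>\<Gamma> l p\<bar> * \<bar>\<Gamma> k q\<bar>))"
      by (simp add: sum.cartesian_product case_prod_unfold sum_distrib_left sum.distrib distrib_left mult_ac)
    also have "\<dots> = D\<^sup>2 * C * (2 * ((\<Sum>p\<in>K. \<bar>\<Gamma> k p\<bar>) * (\<Sum>q\<in>K. \<bar>\<Gamma> l q\<bar>)))"
      by (simp add: sum_product[symmetric])
    also have "\<dots> \<le> D\<^sup>2 * C * (2 * (C * C))"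
      using D0 C0 kl by (intro mult_left_mono mult_mono row) (auto intro!: sum_nonneg)
    finally have *: "(\<Sum>y\<in>?S. \<bar>w y\<bar> * \<bar>T x y\<bar>) \<le> 2 * D ^ 2 * C ^ 3"
      by (simp add: power3_eq_cube mult_ac)
    have "(\<Sum>y\<in>?S. w x * w y * T x y) \<le> (\<Sum>y\<in>?S. \<bar>w x\<bar> * (\<bar>w y\<bar> * \<bar>T x y\<bar>))"
      by (intro sum_mono) (metis abs_ge_self abs_mult mult.assoc)
    also have "\<dots> = \<bar>w x\<bar> * (\<Sum>y\<in>?S. \<bar>w y\<bar> * \<bar>T x y\<bar>)" by (simp add: sum_distrib_left)
    also have "\<dots> \<le> \<bar>w x\<bar> * (2 * D ^ 2 * C ^ 3)"
      using * by (rule mult_left_mono) simp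
    finally show "(\<Sum>y\<in>?S. w x * w y * T x y) \<le> \<bar>w x\<bar> * (2 * D ^ 2 * C ^ 3)" .
  qed
  also have "\<dots> = (\<Sum>x\<in>?S. \<bar>w x\<bar>) * (2 * D ^ 2 * C ^ 3)" by (simp add: sum_distrib_right)
  also have "\<dots> \<le> (D\<^sup>2 * (real (card K) * C)) * (2 * D ^ 2 * C ^ 3)"
  proof (rule mult_right_mono)
    have "(\<Sum>x\<in>?S. \<bar>w x\<bar>) \<le> (\<Sum>x\<in>?S. D\<^sup>2 * \<bar>\<Gamma> (fst x) (snd x)\<bar>)"
      unfolding w_def abs_mult power2_eq_square using D0 by (intro sum_mono mult_mono d) auto
    also have "\<dots> = D\<^sup>2 * (\<Sum>k\<in>K. \<Sum>l\<in>K. \<bar>\<Gamma> k l\<bar>)"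
      by (simp add: sum.cartesian_product case_prod_unfold sum_distrib_left)
    also have "\<dots> \<le> D\<^sup>2 * (real (card K) * C)"
      using sum_mono[OF row] by (intro mult_left_mono) simp_all
    finally show "(\<Sum>x\<in>?S. \<bar>w x\<bar>) \<le> D\<^sup>2 * (real (card K) * C)" .
  qed (use C0 in simp)
  finally show ?thesis
    by (simp add: power4_eq_xxxx power2_eq_square power3_eq_cube mult_ac)
qed

end

section \<open>Central limit theorem for quadratic forms\<close>

context gaussian_space
begin

text \<open>The constant produced by the absorption argument below. Its point is that it depends on
  \<open>A\<close>, \<open>C\<close> and the order alone, hence is uniform along a sequence of
  quadratic forms.\<close>

fun quad_bound :: "real \<Rightarrow> real \<Rightarrow> nat \<Rightarrow> real" where
  "quad_bound A C 0 = 1"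
| "quad_bound A C (Suc q) =
     2 * ((4 * real q + 2) * (2 * (4 * real q + 2)) ^ q * ((A * C) ^ Suc q * gauss_moment C (2 * Suc q)))"

text \<open>A Schur test: each product U k U l is split into half the sum of its squares, and by
  symmetry of the covariances both halves are controlled by the row sums.\<close>

lemma quad_grad_abs_le:
  assumes d: "\<And>k. k \<in> K \<Longrightarrow> \<bar>d k\<bar> \<le> D"
    and C: "\<And>k. k \<in> K \<Longrightarrow> (\<Sum>l\<in>K. \<bar>cov (U k) (U l)\<bar>) \<le> C"
  shows "\<bar>quad_grad K U d \<omega>\<bar> \<le> D\<^sup>2 * C * (\<Sum>k\<in>K. (U k \<omega>)\<^sup>2)"
proof -
  define g where "g k l = \<bar>cov (U k) (U l)\<bar>" for k l
  have sym: "g k l = g l k" for k l by (simp add: g_def mult.commute)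
  have "\<bar>quad_grad K U d \<omega>\<bar> \<le> (\<Sum>k\<in>K. \<Sum>l\<in>K. \<bar>d k * d l * cov (U k) (U l) * (U k \<omega> * U l \<omega>)\<bar>)"
    unfolding quad_grad_def by (intro order_trans[OF sum_abs] sum_mono order_refl)
  also have "\<dots> \<le> (\<Sum>k\<in>K. \<Sum>l\<in>K. D\<^sup>2 * (g k l * (U k \<omega>)\<^sup>2 / 2 + g l k * (U l \<omega>)\<^sup>2 / 2))"
  proof (intro sum_mono)
    fix k l assume kl: "k \<in> K" "l \<in> K"
    have "\<bar>U k \<omega> * U l \<omega>\<bar> \<le> (U k \<omega>)\<^sup>2 / 2 + (U l \<omega>)\<^sup>2 / 2"
      using sum_squares_bound[of "\<bar>U k \<omega>\<bar>" "\<bar>U l \<omega>\<bar>"] by (simp add: abs_mult)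
    moreover have "\<bar>d k * d l\<bar> \<le> D\<^sup>2"
      unfolding abs_mult power2_eq_square using d[OF kl(1)] d[OF kl(2)] by (intro mult_mono) auto
    ultimately have "\<bar>d k * d l\<bar> * (g k l * \<bar>U k \<omega> * U l \<omega>\<bar>) \<le> D\<^sup>2 * (g k l * ((U k \<omega>)\<^sup>2 / 2 + (U l \<omega>)\<^sup>2 / 2))"
      by (intro mult_mono mult_left_mono) (auto simp: g_def)
    then show "\<bar>d k * d l * cov (U k) (U l) * (U k \<omega> * U l \<omega>)\<bar> \<le> D\<^sup>2 * (g k l * (U k \<omega>)\<^sup>2 / 2 + g l k * (U l \<omega>)\<^sup>2 / 2)"
      unfolding sym[of l k] by (simp add: g_def abs_mult mult.assoc distrib_left)
  qed
  also have "\<dots> = D\<^sup>2 * ((\<Sum>k\<in>K. \<Sum>l\<in>K. g k l * (U k \<omega>)\<^sup>2 / 2) + (\<Sum>k\<in>K. \<Sum>l\<in>K. g l k * (U l \<omega>)\<^sup>2 / 2))"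
    by (simp add: sum_distrib_left sum.distrib distrib_left)
  also have "(\<Sum>k\<in>K. \<Sum>l\<in>K. g l k * (U l \<omega>)\<^sup>2 / 2) = (\<Sum>k\<in>K. \<Sum>l\<in>K. g k l * (U k \<omega>)\<^sup>2 / 2)"
    by (rule sum.swap)
  also have "D\<^sup>2 * ((\<Sum>k\<in>K. \<Sum>l\<in>K. g k l * (U k \<omega>)\<^sup>2 / 2) + (\<Sum>k\<in>K. \<Sum>l\<in>K. g k l * (U k \<omega>)\<^sup>2 / 2))
      = D\<^sup>2 * (\<Sum>k\<in>K. (\<Sum>l\<in>K. g k l) * (U k \<omega>)\<^sup>2)"
    by (simp add: sum_distrib_right sum.distrib[symmetric])
  also have "\<dots> \<le> D\<^sup>2 * (\<Sum>k\<in>K. C * (U k \<omega>)\<^sup>2)"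
    using C by (intro mult_left_mono sum_mono mult_right_mono) (auto simp: g_def)
  finally show ?thesis by (simp add: sum_distrib_left mult.assoc)
qed

text \<open>Jensen's inequality is applied to the Schur bound. Its factor card^q and the sum over K
  together give card^(q+1), which matches the power q + 1 of D^2 and so yields a power of A. Each
  variance is at most C, being an entry of a row.\<close>

lemma quad_grad_moment_le:
  assumes U: "\<And>k. k \<in> K \<Longrightarrow> U k \<in> G"
    and d: "\<And>k. k \<in> K \<Longrightarrow> \<bar>d k\<bar> \<le> D"
    and C: "\<And>k. k \<in> K \<Longrightarrow> (\<Sum>l\<in>K. \<bar>cov (U k) (U l)\<bar>) \<le> C"
    and K: "finite K" and A: "D\<^sup>2 * real (card K) \<le> A" and C0: "0 \<le> C"
  shows "expectation (\<lambda>\<omega>. \<bar>quad_grad K U d \<omega>\<bar> ^ Suc q) \<le> (A * C) ^ Suc q * gauss_moment C (2 * Suc q)"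
proof -
  have A0: "0 \<le> A" using A by (rule order_trans[rotated]) simp
  have var: "cov (U k) (U k) \<le> C" if "k \<in> K" for k
    using member_le_sum[of k K "\<lambda>l. \<bar>cov (U k) (U l)\<bar>"] C[OF that] that K by simp
  have var0: "0 \<le> cov (U k) (U k)" for k by (simp add: integral_nonneg_AE)
  have fm: "finite_moments M (quad_grad K U d)" by (rule finite_moments_quad_grad[OF U])
  have "expectation (\<lambda>\<omega>. \<bar>quad_grad K U d \<omega>\<bar> ^ Suc q) \<le>
     expectation (\<lambda>\<omega>. (D\<^sup>2 * C) ^ Suc q * real (card K) ^ q * (\<Sum>k\<in>K. U k \<omega> ^ (2 * Suc q)))"
  proof (rule integral_mono)
    show "integrable M (\<lambda>\<omega>. \<bar>quad_grad K U d \<omega>\<bar> ^ Suc q)"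
      using fm unfolding finite_moments_def by blast
    show "integrable M (\<lambda>\<omega>. (D\<^sup>2 * C) ^ Suc q * real (card K) ^ q * (\<Sum>k\<in>K. U k \<omega> ^ (2 * Suc q)))"
      using U by (intro integrable_mult_right Bochner_Integration.integrable_sum G_moments(1))
    fix \<omega>
    have "\<bar>quad_grad K U d \<omega>\<bar> ^ Suc q \<le> (D\<^sup>2 * C * (\<Sum>k\<in>K. (U k \<omega>)\<^sup>2)) ^ Suc q"
      by (intro power_mono quad_grad_abs_le d C) auto
    also have "\<dots> = (D\<^sup>2 * C) ^ Suc q * (\<Sum>k\<in>K. (U k \<omega>)\<^sup>2) ^ Suc q"
      by (rule power_mult_distrib)
    also have "\<dots> \<le> (D\<^sup>2 * C) ^ Suc q * (real (card K) ^ q * (\<Sum>k\<in>K. ((U k \<omega>)\<^sup>2) ^ Suc q))"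
      using C0 by (intro mult_left_mono sum_power_le_card) auto
    finally show "\<bar>quad_grad K U d \<omega>\<bar> ^ Suc q \<le> (D\<^sup>2 * C) ^ Suc q * real (card K) ^ q * (\<Sum>k\<in>K. U k \<omega> ^ (2 * Suc q))"
      by (simp only: power_mult mult.assoc)
  qed
  also have "\<dots> = (D\<^sup>2 * C) ^ Suc q * real (card K) ^ q * (\<Sum>k\<in>K. gauss_moment (cov (U k) (U k)) (2 * Suc q))"
    unfolding integral_mult_right_zero using U
    by (subst Bochner_Integration.integral_sum)
      (simp_all add: G_moments del: mult_Suc_right power_Suc gauss_moment.simps)
  also have "\<dots> \<le> (D\<^sup>2 * C) ^ Suc q * real (card K) ^ q * (\<Sum>k\<in>K. gauss_moment C (2 * Suc q))"
    using C0 by (intro mult_left_mono sum_mono gauss_moment_mono var var0) auto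
  also have "\<dots> = (D\<^sup>2 * real (card K)) ^ Suc q * (C ^ Suc q * gauss_moment C (2 * Suc q))"
    by (simp add: power_mult_distrib mult_ac del: mult_Suc_right gauss_moment.simps)
  also have "\<dots> \<le> A ^ Suc q * (C ^ Suc q * gauss_moment C (2 * Suc q))"
    using A A0 C0 by (intro mult_right_mono power_mono mult_nonneg_nonneg gauss_moment_even_nonneg) auto
  finally show ?thesis by (simp only: power_mult_distrib mult.assoc)
qed

text \<open>Integration by parts bounds an even moment of F by \<kappa> E[F^(2q) g]. Young's
  inequality with parameter 1 / (2 \<kappa>) makes the contribution of F^(2q+2) exactly one half of
  the left side, where it is absorbed.\<close>

lemma quad_moment_bound:
  assumes U: "\<And>k. k \<in> K \<Longrightarrow> U k \<in> G"
    and d: "\<And>k. k \<in> K \<Longrightarrow> \<bar>d k\<bar> \<le> D"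
    and C: "\<And>k. k \<in> K \<Longrightarrow> (\<Sum>l\<in>K. \<bar>cov (U k) (U l)\<bar>) \<le> C"
    and K: "finite K" and A: "D\<^sup>2 * real (card K) \<le> A" and C0: "0 \<le> C"
  shows "expectation (\<lambda>\<omega>. quad K U d \<omega> ^ (2 * q)) \<le> quad_bound A C q"
proof (cases q)
  case 0
  then show ?thesis by (simp add: prob_space)
next
  case (Suc q)
  let ?F = "quad K U d" and ?g = "quad_grad K U d"
  \<comment> \<open>Twice m = 2q + 1, the factor of the moment identity for exponent m + 1 = 2q +
    2.\<close>
  define \<kappa> where "\<kappa> = 4 * real q + 2"
  have \<kappa>: "0 < \<kappa>" by (simp add: \<kappa>_def)
  define B where "B = (A * C) ^ Suc q * gauss_moment C (2 * Suc q)"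
  have fmF: "finite_moments M ?F" by (rule finite_moments_quad[OF U])
  have fmg: "finite_moments M ?g" by (rule finite_moments_quad_grad[OF U])
  have igk: "integrable M (\<lambda>\<omega>. \<bar>?g \<omega>\<bar> ^ k)" for k using fmg unfolding finite_moments_def by blast
  have iF: "integrable M (\<lambda>\<omega>. ?F \<omega> ^ k)" for k using fmF by (rule finite_moments_integrable_power)
  have m: "2 * Suc q = Suc (2 * q + 1)" "2 * q + 1 - 1 = 2 * q" by simp_all
  have "expectation (\<lambda>\<omega>. ?F \<omega> ^ (2 * Suc q)) = \<kappa> * expectation (\<lambda>\<omega>. ?F \<omega> ^ (2 * q) * ?g \<omega>)"
    using quad_moment_Suc[OF U, where m="2 * q + 1" and d=d] unfolding m by (simp add: \<kappa>_def)
  also have "\<dots> \<le> \<kappa> * expectation (\<lambda>\<omega>. 1 / (2 * \<kappa>) * ?F \<omega> ^ (2 * Suc q) + (2 * \<kappa>) ^ q * \<bar>?g \<omega>\<bar> ^ Suc q)"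
  proof (intro mult_left_mono integral_mono)
    show "integrable M (\<lambda>\<omega>. ?F \<omega> ^ (2 * q) * ?g \<omega>)"
      by (intro finite_moments_integrable finite_moments_mult finite_moments_power fmF fmg)
    show "integrable M (\<lambda>\<omega>. 1 / (2 * \<kappa>) * ?F \<omega> ^ (2 * Suc q) + (2 * \<kappa>) ^ q * \<bar>?g \<omega>\<bar> ^ Suc q)"
      by (intro Bochner_Integration.integrable_add integrable_mult_right iF igk)
    fix \<omega>
    have "?F \<omega> ^ (2 * q) * ?g \<omega> \<le> ((?F \<omega>)\<^sup>2) ^ q * \<bar>?g \<omega>\<bar>"
      unfolding power_mult by (intro mult_left_mono) auto
    also have "\<dots> \<le> 1 / (2 * \<kappa>) * ((?F \<omega>)\<^sup>2) ^ Suc q + (1 / (1 / (2 * \<kappa>))) ^ q * \<bar>?g \<omega>\<bar> ^ Suc q"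
      using \<kappa> by (intro power_mult_le_young) auto
    finally show "?F \<omega> ^ (2 * q) * ?g \<omega> \<le> 1 / (2 * \<kappa>) * ?F \<omega> ^ (2 * Suc q) + (2 * \<kappa>) ^ q * \<bar>?g \<omega>\<bar> ^ Suc q"
      by (simp only: power_mult) simp
  qed (use \<kappa> in simp)
  also have "\<dots> = \<kappa> * (1 / (2 * \<kappa>) * expectation (\<lambda>\<omega>. ?F \<omega> ^ (2 * Suc q)) + (2 * \<kappa>) ^ q * expectation (\<lambda>\<omega>. \<bar>?g \<omega>\<bar> ^ Suc q))"
    using iF[of "2 * Suc q"] igk[of "Suc q"] by (simp del: power_Suc mult_Suc_right)
  also have "\<dots> = expectation (\<lambda>\<omega>. ?F \<omega> ^ (2 * Suc q)) / 2 + \<kappa> * (2 * \<kappa>) ^ q * expectation (\<lambda>\<omega>. \<bar>?g \<omega>\<bar> ^ Suc q)"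
    using \<kappa> by (simp add: distrib_left del: power_Suc mult_Suc_right)
  also have "\<dots> \<le> expectation (\<lambda>\<omega>. ?F \<omega> ^ (2 * Suc q)) / 2 + \<kappa> * (2 * \<kappa>) ^ q * B"
    unfolding B_def using \<kappa> by (intro add_left_mono mult_left_mono quad_grad_moment_le[where D=D] assms) auto
  finally have "expectation (\<lambda>\<omega>. ?F \<omega> ^ (2 * Suc q)) \<le> 2 * (\<kappa> * (2 * \<kappa>) ^ q * B)" by linarith
  then show ?thesis by (simp only: Suc quad_bound.simps \<kappa>_def B_def)
qed

text \<open>As \<open>E F\<^sup>m\<^sup>+\<^sup>1 = 2 m E[F\<^sup>m\<^sup>-\<^sup>1 g]\<close> and the variance of \<open>g = quad_grad K U d\<close> vanishes in the limit, the moments of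
  \<open>F\<close> asymptotically satisfy the recursion \<open>E F\<^sup>m\<^sup>+\<^sup>1 = m (E F\<^sup>2) (E F\<^sup>m\<^sup>-\<^sup>1)\<close> of the normal moments.\<close>

theorem quad_moments_tendsto:
  assumes U: "\<And>n k. k \<in> K n \<Longrightarrow> U n k \<in> G"
    and d: "\<And>n k. k \<in> K n \<Longrightarrow> \<bar>d n k\<bar> \<le> D n"
    and C: "\<And>n k. k \<in> K n \<Longrightarrow> (\<Sum>l\<in>K n. \<bar>cov (U n k) (U n l)\<bar>) \<le> C"
    and K: "\<And>n. finite (K n)" and A: "\<And>n. (D n)\<^sup>2 * real (card (K n)) \<le> A" and C0: "0 \<le> C"
    and D0: "\<And>n. 0 < D n" and D: "D \<longlonglongrightarrow> 0"
    and s: "(\<lambda>n. expectation (\<lambda>\<omega>. (quad (K n) (U n) (d n) \<omega>)\<^sup>2)) \<longlonglongrightarrow> s"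
  shows "(\<lambda>n. expectation (\<lambda>\<omega>. quad (K n) (U n) (d n) \<omega> ^ m)) \<longlonglongrightarrow> gauss_moment s m"
  using s
\<comment> \<open>The recursion of the normal moments advances by two, and so does the moment
  identity: order m + 2 uses only order m and the second moment.\<close>
proof (induction s m rule: gauss_moment.induct)
  case (1 s)
  then show ?case by (simp add: prob_space)
next
  case (2 s)
  have "expectation (\<lambda>\<omega>. quad (K n) (U n) (d n) \<omega> ^ Suc 0) = 0" for n
    using expectation_quad[OF U] by simp
  then show ?case by simp
next
  case (3 s m)
  let ?F = "\<lambda>n. quad (K n) (U n) (d n)" and ?g = "\<lambda>n. quad_grad (K n) (U n) (d n)"
  have fmF: "finite_moments M (?F n)" for n by (rule finite_moments_quad[OF U])
  have fmg: "finite_moments M (?g n)" for n by (rule finite_moments_quad_grad[OF U])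
  define B where "B = quad_bound A C m"
  have Eg: "2 * expectation (?g n) = expectation (\<lambda>\<omega>. (?F n \<omega>)\<^sup>2)" for n
    using quad_second_moment[of "K n" "U n" "d n", OF U] expectation_quad_grad[of "K n" "U n" "d n", OF U] by simp
  define R where "R n = expectation (\<lambda>\<omega>. ?F n \<omega> ^ m * (?g n \<omega> - expectation (?g n)))" for n
  have split: "expectation (\<lambda>\<omega>. ?F n \<omega> ^ Suc (Suc m)) =
      real (Suc m) * (expectation (\<lambda>\<omega>. (?F n \<omega>)\<^sup>2) * expectation (\<lambda>\<omega>. ?F n \<omega> ^ m)) + 2 * real (Suc m) * R n" for n
  proof -
    have "expectation (\<lambda>\<omega>. ?F n \<omega> ^ m * ?g n \<omega>)
      = expectation (\<lambda>\<omega>. expectation (?g n) * ?F n \<omega> ^ m + ?F n \<omega> ^ m * (?g n \<omega> - expectation (?g n)))"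
      by (intro Bochner_Integration.integral_cong refl) (simp add: algebra_simps)
    also have "\<dots> = expectation (\<lambda>\<omega>. expectation (?g n) * ?F n \<omega> ^ m) + R n"
      unfolding R_def by (intro Bochner_Integration.integral_add finite_moments_integrable finite_moments_mult
          finite_moments_const finite_moments_power finite_moments_diff fmF fmg)
    finally have "expectation (\<lambda>\<omega>. ?F n \<omega> ^ m * ?g n \<omega>) = expectation (?g n) * expectation (\<lambda>\<omega>. ?F n \<omega> ^ m) + R n"
      by simp
    then show ?thesis
      using quad_moment_Suc[of "K n" "U n" "d n" "Suc m", OF U] unfolding Eg[symmetric]
      by (simp add: algebra_simps)
  qed
  \<comment> \<open>Young's inequality with parameter \<open>D n\<close> balances the error: the
    even moments of F are bounded, and the variance of g is of order (D n)^2, so that after division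
    by \<open>D n\<close> both terms are of order \<open>D n\<close>.\<close>
  have "norm (R n) \<le> D n * B + D n * (2 * A * C ^ 4)" for n
  proof -
    have "\<bar>R n\<bar> \<le> expectation (\<lambda>\<omega>. \<bar>?F n \<omega> ^ m * (?g n \<omega> - expectation (?g n))\<bar>)"
      unfolding R_def by (rule integral_abs_bound)
    also have "\<dots> \<le> expectation (\<lambda>\<omega>. D n * ?F n \<omega> ^ (2 * m) + 1 / D n * (?g n \<omega> - expectation (?g n))\<^sup>2)"
    proof (rule integral_mono)
      show "integrable M (\<lambda>\<omega>. \<bar>?F n \<omega> ^ m * (?g n \<omega> - expectation (?g n))\<bar>)"
        by (intro integrable_abs finite_moments_integrable finite_moments_mult
          finite_moments_const finite_moments_power finite_moments_diff fmF fmg)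
      show "integrable M (\<lambda>\<omega>. D n * ?F n \<omega> ^ (2 * m) + 1 / D n * (?g n \<omega> - expectation (?g n))\<^sup>2)"
        by (intro finite_moments_integrable finite_moments_mult finite_moments_add
          finite_moments_const finite_moments_power finite_moments_diff fmF fmg)
      fix \<omega>
      have "\<bar>?F n \<omega> ^ m\<bar> ^ 1 * \<bar>?g n \<omega> - expectation (?g n)\<bar> \<le>
         D n * \<bar>?F n \<omega> ^ m\<bar> ^ Suc 1 + (1 / D n) ^ 1 * \<bar>?g n \<omega> - expectation (?g n)\<bar> ^ Suc 1"
        using D0 by (intro power_mult_le_young) auto
      then show "\<bar>?F n \<omega> ^ m * (?g n \<omega> - expectation (?g n))\<bar> \<le>
         D n * ?F n \<omega> ^ (2 * m) + 1 / D n * (?g n \<omega> - expectation (?g n))\<^sup>2"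
        by (simp add: abs_mult power2_eq_square power_even_eq mult.commute[of 2 m] power_mult flip: power2_eq_square)
    qed
    also have "\<dots> = D n * expectation (\<lambda>\<omega>. ?F n \<omega> ^ (2 * m)) + 1 / D n * expectation (\<lambda>\<omega>. (?g n \<omega> - expectation (?g n))\<^sup>2)"
      by (subst Bochner_Integration.integral_add, (intro finite_moments_integrable finite_moments_mult finite_moments_add
          finite_moments_const finite_moments_power finite_moments_diff fmF fmg)+) simp
    also have "\<dots> \<le> D n * B + 1 / D n * (2 * D n ^ 4 * C ^ 4 * real (card (K n)))"
      unfolding B_def using D0[of n]
      by (intro add_mono mult_left_mono quad_moment_bound[where D="D n"] quad_grad_variance U d C A K C0) auto
    also have "1 / D n * (2 * D n ^ 4 * C ^ 4 * real (card (K n))) = D n * (2 * ((D n)\<^sup>2 * real (card (K n))) * C ^ 4)"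
      using D0[of n] by (simp add: power4_eq_xxxx power2_eq_square)
    also have "\<dots> \<le> D n * (2 * A * C ^ 4)"
      using D0[of n] C0 A[of n] by (intro mult_left_mono mult_right_mono) auto
    finally show ?thesis by simp
  qed
  moreover have "(\<lambda>n. D n * B + D n * (2 * A * C ^ 4)) \<longlonglongrightarrow> 0"
    using tendsto_add[OF tendsto_mult_left_zero[OF D, of B] tendsto_mult_left_zero[OF D, of "2 * A * C ^ 4"]] by simp
  ultimately have R: "R \<longlonglongrightarrow> 0"
    by (rule Lim_null_comparison[OF always_eventually, OF allI])
  have "(\<lambda>n. real (Suc m) * (expectation (\<lambda>\<omega>. (?F n \<omega>)\<^sup>2) * expectation (\<lambda>\<omega>. ?F n \<omega> ^ m)) + 2 * real (Suc m) * R n)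
     \<longlonglongrightarrow> real (Suc m) * (s * gauss_moment s m) + 2 * real (Suc m) * 0"
    by (intro tendsto_add tendsto_mult tendsto_const R 3)
  then show ?case unfolding split by (simp add: mult.assoc)
qed

end

section \<open>From moments to weak convergence\<close>

lemma (in prob_space) char_distr_tendsto_of_moments:
  assumes fm: "\<And>n. finite_moments M (X n)"
    and lim: "\<And>k. (\<lambda>n. expectation (\<lambda>\<omega>. X n \<omega> ^ k)) \<longlonglongrightarrow> gauss_moment v k"
  shows "(\<lambda>n. char (distr M borel (X n)) t) \<longlonglongrightarrow> complex_of_real (exp (- v * t\<^sup>2 / 2))"
proof (rule char_tendsto_of_moments)
  have [measurable]: "X n \<in> borel_measurable M" for n using fm by (rule finite_moments_measurable)
  show "real_distribution (distr M borel (X n))" for n by simp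
  show "integrable (distr M borel (X n)) (\<lambda>x. x ^ k)" for n k
    by (subst integrable_distr_eq) (auto intro: finite_moments_integrable_power fm)
  show "(\<lambda>n. \<integral>x. x ^ k \<partial>distr M borel (X n)) \<longlonglongrightarrow> gauss_moment v k" for k
    using lim[of k] by (simp add: integral_distr)
qed

text \<open>Slutsky's argument on characteristic functions: the integrands differ by at most |t| e
  where X and Y are within e, and by at most 2 elsewhere. Levy's continuity theorem
  concludes.\<close>

lemma (in prob_space) weak_conv_normal_slutsky:
  assumes X[measurable]: "\<And>n. X n \<in> borel_measurable M" and Y[measurable]: "\<And>n. Y n \<in> borel_measurable M"
    and lim: "\<And>t. (\<lambda>n. char (distr M borel (X n)) t) \<longlonglongrightarrow> complex_of_real (exp (- v * t\<^sup>2 / 2))"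
    and v: "0 \<le> v"
    and diff: "\<And>e. 0 < e \<Longrightarrow> (\<lambda>n. prob {\<omega>\<in>space M. e < \<bar>Y n \<omega> - X n \<omega>\<bar>}) \<longlonglongrightarrow> 0"
  shows "weak_conv_m (\<lambda>n. distr M borel (Y n)) (normal_law 0 v)"
proof (rule levy_continuity)
  show "real_distribution (distr M borel (Y n))" for n by simp
  show "real_distribution (normal_law 0 v)" using v by (rule real_distribution_normal_law)
  fix t
  have char: "char (distr M borel Z) t = (CLINT \<omega>|M. iexp (t * Z \<omega>))" if [measurable]: "Z \<in> borel_measurable M" for Z
    unfolding char_def by (subst integral_distr) auto
  have int: "integrable M (\<lambda>\<omega>. iexp (t * Z \<omega>))" if [measurable]: "Z \<in> borel_measurable M" for Z
    by (rule integrable_iexp) auto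
  have bound: "norm (char (distr M borel (Y n)) t - char (distr M borel (X n)) t)
      \<le> \<bar>t\<bar> * e + 2 * prob {\<omega>\<in>space M. e < \<bar>Y n \<omega> - X n \<omega>\<bar>}" if e: "0 < e" for n e
  proof -
    let ?E = "{\<omega>\<in>space M. e < \<bar>Y n \<omega> - X n \<omega>\<bar>}"
    have "char (distr M borel (Y n)) t - char (distr M borel (X n)) t = (CLINT \<omega>|M. iexp (t * Y n \<omega>) - iexp (t * X n \<omega>))"
      unfolding char[OF Y] char[OF X] by (rule Bochner_Integration.integral_diff[symmetric]) (rule int, simp)+
    also have "norm \<dots> \<le> expectation (\<lambda>\<omega>. norm (iexp (t * Y n \<omega>) - iexp (t * X n \<omega>)))"
      by (rule integral_norm_bound)
    also have "\<dots> \<le> expectation (\<lambda>\<omega>. \<bar>t\<bar> * e + 2 * indicator ?E \<omega>)"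
    proof (rule integral_mono)
      show "integrable M (\<lambda>\<omega>. norm (iexp (t * Y n \<omega>) - iexp (t * X n \<omega>)))"
        by (intro integrable_norm Bochner_Integration.integrable_diff int) auto
      show "integrable M (\<lambda>\<omega>. \<bar>t\<bar> * e + 2 * indicator ?E \<omega>)" by (auto simp: emeasure_eq_measure)
      fix \<omega> assume \<omega>: "\<omega> \<in> space M"
      show "norm (iexp (t * Y n \<omega>) - iexp (t * X n \<omega>)) \<le> \<bar>t\<bar> * e + 2 * indicator ?E \<omega>"
      proof (cases "\<omega> \<in> ?E")
        case True
        have "norm (iexp (t * Y n \<omega>) - iexp (t * X n \<omega>)) \<le> norm (iexp (t * Y n \<omega>)) + norm (iexp (t * X n \<omega>))"
          by (rule norm_triangle_ineq4)
        also have "\<dots> = 2" by simp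
        finally show ?thesis using True e by (simp add: add_increasing)
      next
        case False
        have "iexp (t * Y n \<omega>) - iexp (t * X n \<omega>) = iexp (t * X n \<omega>) * (iexp (t * (Y n \<omega> - X n \<omega>)) - 1)"
          by (simp add: algebra_simps flip: exp_add)
        then have "norm (iexp (t * Y n \<omega>) - iexp (t * X n \<omega>)) = norm (iexp (t * (Y n \<omega> - X n \<omega>)) - 1)"
          by (simp add: norm_mult)
        also have "\<dots> \<le> \<bar>t * (Y n \<omega> - X n \<omega>)\<bar>" using iexp_approx1[of "t * (Y n \<omega> - X n \<omega>)" 0] by simp
        also have "\<dots> \<le> \<bar>t\<bar> * e" using False \<omega> by (auto simp: abs_mult intro!: mult_left_mono)
        finally show ?thesis using False by simp
      qed
    qed
    also have "\<dots> = \<bar>t\<bar> * e + 2 * prob ?E" by (simp add: prob_space emeasure_eq_measure)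
    finally show ?thesis .
  qed
  have "(\<lambda>n. char (distr M borel (Y n)) t - char (distr M borel (X n)) t) \<longlonglongrightarrow> 0"
  proof (rule LIMSEQ_I)
    fix r :: real assume r: "0 < r"
    \<comment> \<open>At most r/2 is spent on |t| e, and the added 1 covers t = 0.\<close>
    define e where "e = r / (2 * (\<bar>t\<bar> + 1))"
    have e: "0 < e" using r by (simp add: e_def add_nonneg_pos)
    have te: "\<bar>t\<bar> * e \<le> r / 2" using r by (simp add: e_def field_simps)
    from LIMSEQ_D[OF diff[OF e], of "r / 4"] r obtain N where
      N: "\<And>n. n \<ge> N \<Longrightarrow> prob {\<omega>\<in>space M. e < \<bar>Y n \<omega> - X n \<omega>\<bar>} < r / 4" by auto
    have "norm (char (distr M borel (Y n)) t - char (distr M borel (X n)) t - 0) < r" if "n \<ge> N" for n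
      using bound[OF e, of n] te N[OF that] by simp
    then show "\<exists>no. \<forall>n\<ge>no. norm (char (distr M borel (Y n)) t - char (distr M borel (X n)) t - 0) < r" by blast
  qed
  from tendsto_add[OF this lim[of t]]
  show "(\<lambda>n. char (distr M borel (Y n)) t) \<longlonglongrightarrow> char (normal_law 0 v) t"
    by (simp add: char_normal_law[OF v])
qed

section \<open>Averages of Toeplitz arrays\<close>

lemma cesaro_tendsto:
  fixes f :: "nat \<Rightarrow> real"
  assumes "f \<longlonglongrightarrow> L"
  shows "(\<lambda>n. (\<Sum>i<n. f i) / real n) \<longlonglongrightarrow> L"
proof (rule LIMSEQ_I)
  fix r :: real assume r: "0 < r"
  from LIMSEQ_D[OF assms, of "r / 2"] r obtain N where N: "\<And>n. n \<ge> N \<Longrightarrow> \<bar>f n - L\<bar> < r / 2" by auto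
  define S where "S = (\<Sum>i<N. \<bar>f i - L\<bar>)"
  obtain N' where N': "S < real N' * (r / 2)" using reals_Archimedean3[of "r / 2"] r by (metis half_gt_zero)
  have "norm ((\<Sum>i<n. f i) / real n - L) < r" if n: "n \<ge> max (Suc N) N'" for n
  proof -
    have n0: "0 < real n" using n by simp
    have "(\<Sum>i<n. f i) / real n - L = (\<Sum>i<n. f i - L) / real n"
      using n0 by (simp add: sum_subtractf diff_divide_distrib)
    then have "norm ((\<Sum>i<n. f i) / real n - L) = \<bar>\<Sum>i<n. f i - L\<bar> / real n" by simp
    also have "\<dots> \<le> (\<Sum>i<n. \<bar>f i - L\<bar>) / real n" by (intro divide_right_mono sum_abs) simp
    also have "(\<Sum>i<n. \<bar>f i - L\<bar>) = S + (\<Sum>i\<in>{N..<n}. \<bar>f i - L\<bar>)"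
      unfolding S_def using n by (subst sum.union_disjoint[symmetric]) (auto intro!: sum.cong)
    also have "(\<Sum>i\<in>{N..<n}. \<bar>f i - L\<bar>) \<le> (\<Sum>i\<in>{N..<n}. r / 2)"
      using N by (intro sum_mono) (auto intro: less_imp_le)
    also have "\<dots> \<le> real n * (r / 2)" using r by (simp add: mult_right_mono)
    also have "(S + real n * (r / 2)) / real n < (real n * (r / 2) + real n * (r / 2)) / real n"
    proof (rule divide_strict_right_mono[OF _ n0])
      have "S < real n * (r / 2)"
        using N' n r by (intro less_le_trans[OF N'] mult_right_mono) auto
      then show "S + real n * (r / 2) < real n * (r / 2) + real n * (r / 2)" by (rule add_strict_right_mono)
    qed
    also have "\<dots> = r" using n0 by (simp add: field_simps)
    finally show ?thesis by (simp add: divide_right_mono)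
  qed
  then show "\<exists>no. \<forall>n\<ge>no. norm ((\<Sum>i<n. f i) / real n - L) < r" by blast
qed

text \<open>Counting the entries below the diagonal twice, the rows add up to partial sums of the limiting series.\<close>

lemma toeplitz_mean_tendsto:
  fixes \<rho> :: "nat \<Rightarrow> real"
  assumes "summable (\<lambda>m. \<rho> (Suc m))"
    and c: "\<And>i j. c i j = \<rho> (if i \<le> j then j - i else i - j)"
  shows "(\<lambda>n. (\<Sum>i<n. \<Sum>j<n. c i j) / real n) \<longlonglongrightarrow> \<rho> 0 + 2 * (\<Sum>m. \<rho> (Suc m))"
proof -
  have "(\<Sum>i<n. \<Sum>j<n. c i j) = (\<Sum>i<n. \<rho> 0 + 2 * (\<Sum>m<i. \<rho> (Suc m)))" for n
  proof (induction n)
    case (Suc n)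
    have "(\<Sum>j<n. c n j) = (\<Sum>j<n. \<rho> (Suc (n - Suc j)))"
      by (intro sum.cong refl) (simp add: c Suc_diff_Suc)
    also have "\<dots> = (\<Sum>m<n. \<rho> (Suc m))" by (rule sum.nat_diff_reindex)
    finally have row: "(\<Sum>j<n. c n j) = (\<Sum>m<n. \<rho> (Suc m))" .
    moreover have "(\<Sum>i<n. c i n) = (\<Sum>j<n. c n j)" by (intro sum.cong refl) (simp add: c)
    moreover have "c n n = \<rho> 0" by (simp add: c)
    ultimately show ?case using Suc by (simp add: sum.distrib distrib_right)
  qed simp
  moreover have "(\<lambda>i. \<rho> 0 + 2 * (\<Sum>m<i. \<rho> (Suc m))) \<longlonglongrightarrow> \<rho> 0 + 2 * (\<Sum>m. \<rho> (Suc m))"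
    using assms(1) by (intro tendsto_intros summable_LIMSEQ)
  ultimately show ?thesis using cesaro_tendsto by simp
qed

section \<open>Covariances of fractional Brownian increments\<close>

text \<open>Covariance of the increments over \<open>[p, q]\<close> and \<open>[p', q']\<close> of a fractional Brownian motion.\<close>

definition inc_cov :: "real \<Rightarrow> real \<Rightarrow> real \<Rightarrow> real \<Rightarrow> real \<Rightarrow> real" where
  "inc_cov H p q p' q' = (\<bar>q - p'\<bar> powr (2 * H) + \<bar>p - q'\<bar> powr (2 * H)
     - \<bar>q - q'\<bar> powr (2 * H) - \<bar>p - p'\<bar> powr (2 * H)) / 2"

lemma inc_cov_commute: "inc_cov H p q p' q' = inc_cov H p' q' p q"
  by (simp add: inc_cov_def abs_minus_commute)

lemma inc_cov_shift: "inc_cov H (c + p) (c + q) (c + p') (c + q') = inc_cov H p q p' q'"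
  by (simp add: inc_cov_def)

lemma inc_cov_split_right: "inc_cov H p q p' r = inc_cov H p q p' q' + inc_cov H p q q' r"
  by (simp add: inc_cov_def field_simps)

lemma inc_cov_split_left: "inc_cov H p r p' q' = inc_cov H p q p' q' + inc_cov H q r p' q'"
  by (simp add: inc_cov_def field_simps)

text \<open>Concavity: the increment (y + u)^p - y^p does not grow with y, and it is compared at y =
  x and y = x + w. Monotonicity is derived on the open interval only, because at x = 0 the
  derivative may fail to exist.\<close>

lemma powr_add_add_le:
  fixes p x u w :: real
  assumes p: "0 < p" "p < 1" and "0 \<le> x" "0 \<le> u" "0 \<le> w"
  shows "x powr p + (x + u + w) powr p \<le> (x + u) powr p + (x + w) powr p"
proof -
  have "(\<lambda>y. (y + u) powr p - y powr p) x \<ge> (\<lambda>y. (y + u) powr p - y powr p) (x + w)"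
  proof (rule DERIV_nonpos_imp_decreasing_open[of x "x + w" "\<lambda>y. (y + u) powr p - y powr p"])
    show "x \<le> x + w" using assms by simp
    show "continuous_on {x..x + w} (\<lambda>y. (y + u) powr p - y powr p)"
      using assms by (intro continuous_intros continuous_on_powr') auto
    fix y assume y: "x < y" "y < x + w"
    then have y0: "0 < y" "0 < y + u" using assms by auto
    have "((\<lambda>y. (y + u) powr p - y powr p) has_real_derivative p * (y + u) powr (p - 1) - p * y powr (p - 1)) (at y)"
      using y0 by (auto intro!: derivative_eq_intros)
    moreover have "(y + u) powr (p - 1) \<le> y powr (p - 1)"
      using assms y0 by (intro powr_mono2') auto
    ultimately show "\<exists>z. ((\<lambda>y. (y + u) powr p - y powr p) has_real_derivative z) (at y) \<and> z \<le> 0"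
      using p by (auto simp: mult_left_mono)
  qed
  then show ?thesis by (simp add: add_ac)
qed

text \<open>Concavity of the power 2H < 1, with x the gap between the two intervals and u, w their
  lengths.\<close>

lemma inc_cov_nonpos:
  assumes "0 < H" "H < 1/2" "p \<le> q" "q \<le> p'" "p' \<le> q'"
  shows "inc_cov H p q p' q' \<le> 0"
proof -
  have "(p' - q) powr (2 * H) + ((p' - q) + (q - p) + (q' - p')) powr (2 * H)
     \<le> ((p' - q) + (q - p)) powr (2 * H) + ((p' - q) + (q' - p')) powr (2 * H)"
    using assms by (intro powr_add_add_le) auto
  moreover have "\<bar>q - p'\<bar> = p' - q" "\<bar>p - q'\<bar> = (p' - q) + (q - p) + (q' - p')"
     "\<bar>q - q'\<bar> = (p' - q) + (q' - p')" "\<bar>p - p'\<bar> = (p' - q) + (q - p)"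
    using assms by auto
  ultimately show ?thesis unfolding inc_cov_def by simp
qed

text \<open>Covariance is additive when an interval is split, and all pieces have the same sign by
  disjointness, so no piece exceeds the whole in absolute value.\<close>

lemma inc_cov_mono:
  assumes "0 < H" "H < 1/2" "p \<le> p1" "p1 \<le> q1" "q1 \<le> q" "q \<le> p'" "p' \<le> p1'" "p1' \<le> q1'" "q1' \<le> q'"
  shows "\<bar>inc_cov H p1 q1 p1' q1'\<bar> \<le> - inc_cov H p q p' q'"
proof -
  have "inc_cov H p q p' q' = inc_cov H p p1 p' q' + (inc_cov H p1 q1 p' p1' + inc_cov H p1 q1 p1' q1' + inc_cov H p1 q1 q1' q')
      + inc_cov H q1 q p' q'"
    using inc_cov_split_left[of H p q p' q' p1] inc_cov_split_left[of H p1 q p' q' q1]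
      inc_cov_split_right[of H p1 q1 p' q' p1'] inc_cov_split_right[of H p1 q1 p1' q' q1'] by simp
  moreover have "inc_cov H p p1 p' q' \<le> 0" "inc_cov H p1 q1 p' p1' \<le> 0" "inc_cov H p1 q1 p1' q1' \<le> 0"
     "inc_cov H p1 q1 q1' q' \<le> 0" "inc_cov H q1 q p' q' \<le> 0"
    using assms by (auto intro!: inc_cov_nonpos)
  ultimately show ?thesis by simp
qed

lemma inc_cov_abs_le_1:
  assumes "0 < H" "\<bar>q - p'\<bar> \<le> 1" "\<bar>p - q'\<bar> \<le> 1" "\<bar>q - q'\<bar> \<le> 1" "\<bar>p - p'\<bar> \<le> 1"
  shows "\<bar>inc_cov H p q p' q'\<bar> \<le> 1"
proof -
  have gen: "\<bar>(a + b - c - d) / 2\<bar> \<le> 1"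
    if "0 \<le> a" "0 \<le> b" "0 \<le> c" "0 \<le> d" "a \<le> 1" "b \<le> 1" "c \<le> 1" "d \<le> 1" for a b c d :: real
    using that by (simp add: abs_le_iff)
  have *: "\<bar>x\<bar> powr (2 * H) \<le> 1" if "\<bar>x\<bar> \<le> 1" for x :: real
    using powr_mono2[of "2 * H" "\<bar>x\<bar>" 1] that assms(1) by simp
  show ?thesis
    unfolding inc_cov_def
    by (rule gen[OF powr_ge_zero powr_ge_zero powr_ge_zero powr_ge_zero * * * *]) (fact assms)+
qed

definition cov_decay :: "real \<Rightarrow> nat \<Rightarrow> real" where
  "cov_decay H m = (if m = 0 then 1 else - inc_cov H 0 1 (real m) (real m + 1))"

lemma cov_decay_nonneg: "0 < H \<Longrightarrow> H < 1/2 \<Longrightarrow> 0 \<le> cov_decay H m"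
  using inc_cov_nonpos[of H 0 1 "real m" "real m + 1"] by (auto simp: cov_decay_def)

text \<open>Disjoint increments are negatively correlated, so the sum of absolute values telescopes.\<close>

lemma cov_decay_sum:
  assumes "0 < H" "H < 1/2"
  shows "(\<Sum>m<N. cov_decay H (Suc m)) \<le> 1/2"
proof -
  have "(\<Sum>m<N. cov_decay H (Suc m)) = (1 - ((real N + 1) powr (2 * H) - real N powr (2 * H))) / 2"
  proof (induction N)
    case (Suc N)
    have "cov_decay H (Suc N) = (2 * (real N + 1) powr (2 * H) - real N powr (2 * H) - (real N + 2) powr (2 * H)) / 2"
      by (simp add: cov_decay_def inc_cov_def add_ac field_simps)
    with Suc show ?case by (simp add: field_simps)
  qed simp
  moreover have "real N powr (2 * H) \<le> (real N + 1) powr (2 * H)"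
    using assms by (intro powr_mono2) auto
  ultimately show ?thesis by simp
qed

lemma cov_decay_le_1:
  assumes "0 < H" "H < 1/2"
  shows "cov_decay H m \<le> 1"
proof (cases m)
  case (Suc k)
  have "cov_decay H (Suc k) \<le> (\<Sum>m<Suc k. cov_decay H (Suc m))"
    using assms by (intro member_le_sum) (auto simp: cov_decay_nonneg)
  also have "\<dots> \<le> 1/2" by (rule cov_decay_sum[OF assms])
  finally show ?thesis by (simp add: Suc)
qed (simp add: cov_decay_def)

lemma cov_decay_summable:
  assumes "0 < H" "H < 1/2"
  shows "summable (\<lambda>m. cov_decay H (Suc m))"
  using cov_decay_nonneg[OF assms] cov_decay_sum[OF assms]
  by (intro summableI_nonneg_bounded[of _ "1/2"]) auto

definition index_dist :: "nat \<Rightarrow> nat \<Rightarrow> nat" where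
  "index_dist i j = (if i \<le> j then j - i else i - j)"

text \<open>The diagonal entry contributes 1 and each side of it at most 1/2.\<close>

lemma cov_decay_row_sum:
  assumes H: "0 < H" "H < 1/2"
  shows "(\<Sum>j<n. cov_decay H (index_dist i j)) \<le> 2"
proof -
  let ?g = "cov_decay H"
  have nn: "0 \<le> ?g m" for m by (rule cov_decay_nonneg[OF H])
  have "(\<Sum>j<n. ?g (index_dist i j)) \<le> (\<Sum>j\<in>{..<i} \<union> {i} \<union> {i<..<i + Suc n}. ?g (index_dist i j))"
    by (intro sum_mono2) (auto simp: nn)
  also have "\<dots> = (\<Sum>j<i. ?g (index_dist i j)) + ?g 0 + (\<Sum>j\<in>{i<..<i + Suc n}. ?g (index_dist i j))"
    by (subst sum.union_disjoint, simp, simp, fastforce)+ (simp add: index_dist_def)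
  also have "(\<Sum>j<i. ?g (index_dist i j)) = (\<Sum>m<i. ?g (Suc (i - Suc m)))"
    by (intro sum.cong refl) (simp add: index_dist_def Suc_diff_Suc)
  also have "\<dots> = (\<Sum>m<i. ?g (Suc m))" by (rule sum.nat_diff_reindex)
  also have "(\<Sum>j\<in>{i<..<i + Suc n}. ?g (index_dist i j)) = (\<Sum>m<n. ?g (Suc m))"
    by (intro sum.reindex_bij_witness[of _ "\<lambda>m. i + Suc m" "\<lambda>j. j - Suc i"]) (auto simp: index_dist_def Suc_diff_Suc)
  finally show ?thesis
    using cov_decay_sum[OF H, of i] cov_decay_sum[OF H, of n] by (simp add: cov_decay_def)
qed

text \<open>The unit cell \<open>[0, 1]\<close> (index \<open>0\<close>) and its halves (indices \<open>1\<close> and \<open>2\<close>).\<close>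

definition cell_lo :: "nat \<Rightarrow> real" where "cell_lo \<alpha> = (if \<alpha> = 2 then 1/2 else 0)"
definition cell_hi :: "nat \<Rightarrow> real" where "cell_hi \<alpha> = (if \<alpha> = 1 then 1/2 else 1)"

definition cell_cov :: "real \<Rightarrow> nat \<times> nat \<Rightarrow> nat \<times> nat \<Rightarrow> real" where
  "cell_cov H x y = inc_cov H (real (fst x) + cell_lo (snd x)) (real (fst x) + cell_hi (snd x))
     (real (fst y) + cell_lo (snd y)) (real (fst y) + cell_hi (snd y))"

lemma cell_cov_commute: "cell_cov H x y = cell_cov H y x"
  unfolding cell_cov_def by (rule inc_cov_commute)

lemma cell_cov_index_dist:
  "i \<le> j \<Longrightarrow> cell_cov H (i, \<alpha>) (j, \<beta>) = cell_cov H (0, \<alpha>) (index_dist i j, \<beta>)"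
  unfolding cell_cov_def index_dist_def fst_conv snd_conv
  by (subst inc_cov_shift[of H "real i", symmetric]) (simp add: of_nat_diff add_ac)

lemma cell_cov_abs_le:
  assumes H: "0 < H" "H < 1/2"
  shows "\<bar>cell_cov H (i, \<alpha>) (j, \<beta>)\<bar> \<le> cov_decay H (index_dist i j)"
proof -
  have *: "\<bar>cell_cov H (i, \<alpha>) (j, \<beta>)\<bar> \<le> cov_decay H (index_dist i j)" if "i \<le> j" for i j \<alpha> \<beta>
  proof (cases "i = j")
    case True
    have "\<bar>cell_cov H (i, \<alpha>) (j, \<beta>)\<bar> \<le> 1"
      unfolding cell_cov_def using H True
      by (intro inc_cov_abs_le_1) (auto simp: cell_lo_def cell_hi_def)
    then show ?thesis using True by (simp add: cov_decay_def index_dist_def)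
  next
    case False
    have "\<bar>cell_cov H (0, \<alpha>) (j - i, \<beta>)\<bar> \<le> - inc_cov H 0 1 (real (j - i)) (real (j - i) + 1)"
      unfolding cell_cov_def fst_conv snd_conv using H False that
      by (intro inc_cov_mono) (auto simp: cell_lo_def cell_hi_def)
    then show ?thesis unfolding cell_cov_index_dist[OF that]
      using False that by (simp add: cov_decay_def index_dist_def)
  qed
  show ?thesis
  proof (cases "i \<le> j")
    case False
    have "index_dist i j = index_dist j i" by (auto simp: index_dist_def)
    with *[of j i \<beta> \<alpha>] False show ?thesis by (simp add: cell_cov_commute[of H "(i, \<alpha>)"])
  qed (rule *)
qed

text \<open>Three cells per index, each with row sum at most 2.\<close>

lemma cell_cov_row_sum:
  assumes H: "0 < H" "H < 1/2"
  shows "(\<Sum>y\<in>{..<n} \<times> {..<3}. \<bar>cell_cov H x y\<bar>) \<le> 6"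
proof -
  obtain i \<alpha> where x: "x = (i, \<alpha>)" by (cases x)
  have "(\<Sum>y\<in>{..<n} \<times> {..<3::nat}. \<bar>cell_cov H x y\<bar>) \<le> (\<Sum>y\<in>{..<n} \<times> {..<3::nat}. cov_decay H (index_dist i (fst y)))"
    unfolding x by (intro sum_mono) (auto intro: cell_cov_abs_le[OF H])
  also have "\<dots> = 3 * (\<Sum>j<n. cov_decay H (index_dist i j))"
    using sum.cartesian_product[of "\<lambda>j \<beta>. cov_decay H (index_dist i j)" "{..<3::nat}" "{..<n}"]
    by (simp add: case_prod_unfold sum_distrib_left)
  also have "\<dots> \<le> 6" using cov_decay_row_sum[OF H, of i n] by simp
  finally show ?thesis .
qed

text \<open>The weights in \<open>rho'\<close>. Each half has variance 2^(-2H), so 1 - 2 * 2^(2H-1)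
  * 2^(-2H) = 0 and the weighted variances of a cell and its halves cancel.\<close>

definition cell_weight :: "real \<Rightarrow> nat \<Rightarrow> real" where
  "cell_weight H \<alpha> = (if \<alpha> = 0 then 1 else - (2 powr (2 * H - 1)))"

lemma cell_weight_abs_le: "H < 1/2 \<Longrightarrow> \<bar>cell_weight H \<alpha>\<bar> \<le> 1"
  using powr_mono[of "2 * H - 1" 0 2] by (simp add: cell_weight_def)

lemma sum_lessThan_3: "(\<Sum>\<alpha><3. f \<alpha>) = f 0 + f 1 + f (2::nat)"
  by (simp add: eval_nat_numeral)

lemma cell_weight_variance_zero:
  assumes "0 < H"
  shows "(\<Sum>\<alpha><3. cell_weight H \<alpha> * cell_cov H (i, \<alpha>) (i, \<alpha>)) = 0"
proof -
  have v: "inc_cov H p q p q = \<bar>q - p\<bar> powr (2 * H)" for p q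
    by (simp add: inc_cov_def abs_minus_commute)
  have "2 powr (2 * H - 1) * (1 / 2) powr (2 * H) = 1 / 2"
    by (simp add: powr_diff powr_divide)
  then show ?thesis
    unfolding sum_lessThan_3 cell_cov_def v
    by (simp add: cell_weight_def cell_lo_def cell_hi_def)
qed

text \<open>The covariance of the weighted sums of squares belonging to the indices i and j, since
  Cov(X^2, Y^2) = 2 cov(X, Y)^2 for centred jointly normal X, Y.\<close>

definition cell_rho :: "real \<Rightarrow> nat \<Rightarrow> nat \<Rightarrow> real" where
  "cell_rho H i j = (\<Sum>\<alpha><3. \<Sum>\<beta><3. 2 * (cell_weight H \<alpha> * cell_weight H \<beta> * (cell_cov H (i, \<alpha>) (j, \<beta>))\<^sup>2))"

lemma cell_rho_index_dist: "cell_rho H i j = cell_rho H 0 (index_dist i j)"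
proof (cases "i \<le> j")
  case True
  show ?thesis unfolding cell_rho_def by (simp add: cell_cov_index_dist[OF True])
next
  case False
  then have "j \<le> i" by simp
  have "cell_rho H i j = cell_rho H j i"
    unfolding cell_rho_def by (subst sum.swap) (simp add: cell_cov_commute[of H "(i, _)"] mult_ac)
  also have "\<dots> = cell_rho H 0 (index_dist j i)"
    unfolding cell_rho_def by (simp add: cell_cov_index_dist[OF \<open>j \<le> i\<close>])
  also have "index_dist j i = index_dist i j" by (auto simp: index_dist_def)
  finally show ?thesis .
qed

text \<open>Correlations are at most 1, so their squares are dominated by \<open>cov_decay\<close>;
  nine pairs of cells with the factor 2 give 18.\<close>

lemma cell_rho_summable:
  assumes H: "0 < H" "H < 1/2"
  shows "summable (\<lambda>m. cell_rho H 0 (Suc m))"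
proof (rule summable_comparison_test')
  show "summable (\<lambda>m. 18 * cov_decay H (Suc m))"
    by (intro summable_mult cov_decay_summable H)
  fix m
  have "norm (cell_rho H 0 (Suc m)) \<le> (\<Sum>\<alpha><3::nat. \<Sum>\<beta><3::nat. 2 * cov_decay H (Suc m))"
    unfolding cell_rho_def real_norm_def
  proof (intro order_trans[OF sum_abs] sum_mono)
    fix \<alpha> \<beta> :: nat
    have c: "\<bar>cell_cov H (0, \<alpha>) (Suc m, \<beta>)\<bar> \<le> cov_decay H (Suc m)"
      using cell_cov_abs_le[OF H, of 0 \<alpha> "Suc m" \<beta>] by (simp add: index_dist_def)
    have "(cell_cov H (0, \<alpha>) (Suc m, \<beta>))\<^sup>2 = \<bar>cell_cov H (0, \<alpha>) (Suc m, \<beta>)\<bar> * \<bar>cell_cov H (0, \<alpha>) (Suc m, \<beta>)\<bar>"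
      by (simp add: power2_eq_square)
    also have "\<dots> \<le> 1 * cov_decay H (Suc m)"
      using c cov_decay_le_1[OF H, of "Suc m"] by (intro mult_mono) auto
    finally have "\<bar>cell_weight H \<alpha>\<bar> * \<bar>cell_weight H \<beta>\<bar> * (cell_cov H (0, \<alpha>) (Suc m, \<beta>))\<^sup>2 \<le> (1 * 1) * cov_decay H (Suc m)"
      using cell_weight_abs_le H(2) by (intro mult_mono) auto
    then show "\<bar>2 * (cell_weight H \<alpha> * cell_weight H \<beta> * (cell_cov H (0, \<alpha>) (Suc m, \<beta>))\<^sup>2)\<bar> \<le> 2 * cov_decay H (Suc m)"
      by (simp add: abs_mult)
  qed
  then show "norm (cell_rho H 0 (Suc m)) \<le> 18 * cov_decay H (Suc m)" by simp
qed

section \<open>The Gaussian space spanned by a centred Gaussian process\<close>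

lemma normal_law_mean:
  assumes "0 \<le> v"
  shows "integrable (normal_law \<mu> v) (\<lambda>x. x)" "(\<integral>x. x \<partial>normal_law \<mu> v) = \<mu>"
proof -
  have "integrable (normal_law \<mu> v) (\<lambda>x. x) \<and> (\<integral>x. x \<partial>normal_law \<mu> v) = \<mu>"
  proof (cases "v = 0")
    case True
    have "integrable (return borel \<mu>) (\<lambda>x. x)"
      by (subst integrable_iff_bounded) (auto simp: nn_integral_return)
    moreover have "(\<integral>x. x \<partial>return borel \<mu>) = \<mu>" by (subst integral_return) auto
    ultimately show ?thesis using True by (simp add: normal_law_def)
  next
    case False
    then have v: "0 < sqrt v" using assms by auto
    then show ?thesis
      using integrable_normal_moment_nz_1[OF v, of \<mu>] integral_normal_moment_nz_1[OF v, of \<mu>] False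
      by (simp add: normal_law_def integrable_density integral_density)
  qed
  then show "integrable (normal_law \<mu> v) (\<lambda>x. x)" "(\<integral>x. x \<partial>normal_law \<mu> v) = \<mu>" by auto
qed

definition linear_combinations :: "(real \<Rightarrow> 'a \<Rightarrow> real) \<Rightarrow> ('a \<Rightarrow> real) set" where
  "linear_combinations B = {X. \<exists>J c. finite J \<and> J \<subseteq> {0..} \<and> X = (\<lambda>\<omega>. \<Sum>t\<in>J. c t * B t \<omega>)}"

lemma linear_combinationsI:
  assumes "finite J" "J \<subseteq> {0..}" "\<And>\<omega>. X \<omega> = (\<Sum>t\<in>J. c t * B t \<omega>)"
  shows "X \<in> linear_combinations B"
  unfolding linear_combinations_def mem_Collect_eq using assms by (intro exI[of _ J] exI[of _ c]) auto

text \<open>The definition of a Gaussian process leaves the mean of each combination open; linearity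
  of the expectation forces it to be 0.\<close>

lemma (in prob_space) gaussian_space_linear_combinations:
  assumes gauss: "gaussian_process M {0..} B" and mean: "\<And>t. 0 \<le> t \<Longrightarrow> expectation (B t) = 0"
  shows "gaussian_space M (linear_combinations B)"
proof -
  have meas: "B t \<in> borel_measurable M" if "0 \<le> t" for t
    using gauss that by (simp add: gaussian_process_def)
  have law: "\<exists>\<mu> v. v \<ge> 0 \<and> distr M borel (\<lambda>\<omega>. \<Sum>t\<in>J. c t * B t \<omega>) = normal_law \<mu> v"
    if "finite J" "J \<subseteq> {0..}" for J c
    using gauss that unfolding gaussian_process_def by blast
  have int: "integrable M (B t)" if "0 \<le> t" for t
  proof -
    have "\<exists>\<mu> v. v \<ge> 0 \<and> distr M borel (B t) = normal_law \<mu> v"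
      using law[of "{t}" "\<lambda>_. 1"] that by simp
    then obtain \<mu> v where "v \<ge> 0" "distr M borel (B t) = normal_law \<mu> v" by blast
    then have "integrable (distr M borel (B t)) (\<lambda>x. x)" using normal_law_mean(1) by simp
    then show ?thesis using meas[OF that] by (simp add: integrable_distr_eq)
  qed
  show ?thesis
  proof
    show "(\<lambda>_. 0) \<in> linear_combinations B"
      unfolding linear_combinations_def by (auto intro!: exI[of _ "{}"])
  next
    fix X Y assume "X \<in> linear_combinations B" "Y \<in> linear_combinations B"
    then obtain J c J' c' where J: "finite J" "J \<subseteq> {0..}" "X = (\<lambda>\<omega>. \<Sum>t\<in>J. c t * B t \<omega>)"
      and J': "finite J'" "J' \<subseteq> {0..}" "Y = (\<lambda>\<omega>. \<Sum>t\<in>J'. c' t * B t \<omega>)"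
      unfolding linear_combinations_def by blast
    have "(\<Sum>t\<in>J. c t * B t \<omega>) = (\<Sum>t\<in>J \<union> J'. (if t \<in> J then c t else 0) * B t \<omega>)" for \<omega>
      using J J' by (intro sum.mono_neutral_cong_left) auto
    moreover have "(\<Sum>t\<in>J'. c' t * B t \<omega>) = (\<Sum>t\<in>J \<union> J'. (if t \<in> J' then c' t else 0) * B t \<omega>)" for \<omega>
      using J J' by (intro sum.mono_neutral_cong_left) auto
    ultimately have "X \<omega> + Y \<omega> =
        (\<Sum>t\<in>J \<union> J'. ((if t \<in> J then c t else 0) + (if t \<in> J' then c' t else 0)) * B t \<omega>)" for \<omega>
      unfolding J J' by (simp add: sum.distrib distrib_right)
    then show "(\<lambda>\<omega>. X \<omega> + Y \<omega>) \<in> linear_combinations B"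
      using J(1,2) J'(1,2) by (intro linear_combinationsI) auto
  next
    fix X a assume "X \<in> linear_combinations B"
    then obtain J c where J: "finite J" "J \<subseteq> {0..}" "X = (\<lambda>\<omega>. \<Sum>t\<in>J. c t * B t \<omega>)"
      unfolding linear_combinations_def by blast
    then have "a * X \<omega> = (\<Sum>t\<in>J. (a * c t) * B t \<omega>)" for \<omega>
      by (simp add: sum_distrib_left mult.assoc)
    with J(1,2) show "(\<lambda>\<omega>. a * X \<omega>) \<in> linear_combinations B"
      by (intro linear_combinationsI)
  next
    fix X assume "X \<in> linear_combinations B"
    then obtain J c where J: "finite J" "J \<subseteq> {0..}" "X = (\<lambda>\<omega>. \<Sum>t\<in>J. c t * B t \<omega>)"
      unfolding linear_combinations_def by blast
    show X: "X \<in> borel_measurable M"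
      unfolding J using J(2) meas by (intro borel_measurable_sum borel_measurable_times) auto
    obtain \<mu> v where v: "v \<ge> 0" "distr M borel X = normal_law \<mu> v" using law[OF J(1,2)] J(3) by blast
    have "\<mu> = (\<integral>x. x \<partial>distr M borel X)" using normal_law_mean(2)[OF v(1)] v(2) by simp
    also have "\<dots> = expectation X" using X by (subst integral_distr) auto
    also have "\<dots> = (\<Sum>t\<in>J. expectation (\<lambda>\<omega>. c t * B t \<omega>))"
      unfolding J(3) using J(2) int by (intro Bochner_Integration.integral_sum integrable_mult_right) auto
    also have "\<dots> = 0" using J(2) mean by (intro sum.neutral) auto
    finally show "\<exists>v\<ge>0. distr M borel X = normal_law 0 v" using v by auto
  qed
qed

lemma linear_combinations_diff:
  assumes "0 \<le> s" "0 \<le> t"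
  shows "(\<lambda>\<omega>. c * (B t \<omega> - B s \<omega>)) \<in> linear_combinations B"
\<comment> \<open>For s = t the index set {s, t} collapses to one point and cannot carry both
  coefficients, so zero is represented by the empty combination.\<close>
proof (cases "s = t")
  case True
  then show ?thesis unfolding linear_combinations_def by (auto intro!: exI[of _ "{}"])
next
  case False
  have "c * (B t \<omega> - B s \<omega>) = (\<Sum>u\<in>{s, t}. (if u = t then c else - c) * B u \<omega>)" for \<omega>
    using False by (simp add: algebra_simps)
  with assms show ?thesis by (intro linear_combinationsI) auto
qed

section \<open>Quadratic variation of fractional Brownian motion\<close>

text \<open>Self-similarity on the level of covariances; it frees the normalised cells from the mesh
  width.\<close>

lemma inc_cov_scale:
  assumes "0 \<le> h"
  shows "inc_cov H (h * p) (h * q) (h * p') (h * q') = h powr (2 * H) * inc_cov H p q p' q'"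
proof -
  have *: "\<bar>h * x - h * y\<bar> powr (2 * H) = h powr (2 * H) * \<bar>x - y\<bar> powr (2 * H)" for x y
  proof -
    have "\<bar>h * x - h * y\<bar> = h * \<bar>x - y\<bar>" using assms by (simp add: abs_mult flip: right_diff_distrib)
    then show ?thesis using assms by (simp add: powr_mult)
  qed
  show ?thesis unfolding inc_cov_def * by (simp add: algebra_simps)
qed

locale fbm = prob_space M for M :: "'a measure" +
  fixes H :: real and B :: "real \<Rightarrow> 'a \<Rightarrow> real"
  assumes fbm: "fractional_brownian_motion M H B" and H: "0 < H" "H < 1/2"
begin

sublocale gaussian_space M "linear_combinations B"
  using fbm by (intro gaussian_space_linear_combinations) (auto simp: fractional_brownian_motion_def)

lemma B_linear: "0 \<le> t \<Longrightarrow> B t \<in> linear_combinations B"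
  by (rule linear_combinationsI[where J="{t}" and c="\<lambda>_. 1"]) auto

lemma B_measurable: "0 \<le> t \<Longrightarrow> B t \<in> borel_measurable M"
  by (intro G_measurable B_linear)

lemma cov_B: "0 \<le> t \<Longrightarrow> 0 \<le> s \<Longrightarrow> cov (B t) (B s) = 1/2 * (t powr (2*H) + s powr (2*H) - \<bar>t - s\<bar> powr (2*H))"
  using fbm by (simp add: fractional_brownian_motion_def)

lemma cov_increments:
  assumes "0 \<le> p" "0 \<le> q" "0 \<le> p'" "0 \<le> q'"
  shows "cov (\<lambda>\<omega>. B q \<omega> - B p \<omega>) (\<lambda>\<omega>. B q' \<omega> - B p' \<omega>) = inc_cov H p q p' q'"
proof -
  have "cov (\<lambda>\<omega>. B q \<omega> - B p \<omega>) (\<lambda>\<omega>. B q' \<omega> - B p' \<omega>) =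
     expectation (\<lambda>\<omega>. B q \<omega> * B q' \<omega> - B q \<omega> * B p' \<omega> - B p \<omega> * B q' \<omega> + B p \<omega> * B p' \<omega>)"
    by (intro Bochner_Integration.integral_cong refl) (simp add: algebra_simps)
  also have "\<dots> = cov (B q) (B q') - cov (B q) (B p') - cov (B p) (B q') + cov (B p) (B p')"
    using assms by (simp add: integrable_G_mult B_linear)
  also have "\<dots> = inc_cov H p q p' q'"
    using assms by (simp add: cov_B inc_cov_def diff_divide_distrib add_divide_distrib)
  finally show ?thesis .
qed

text \<open>The division by h^H gives full cells variance 1, so every covariance below is a
  \<open>cell_cov\<close> with no trace of h.\<close>

definition cell :: "real \<Rightarrow> nat \<times> nat \<Rightarrow> 'a \<Rightarrow> real" where
  "cell h x \<omega> = 1 / h powr H * (B (h * (real (fst x) + cell_hi (snd x))) \<omega> - B (h * (real (fst x) + cell_lo (snd x))) \<omega>)"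

lemma cell_linear: "0 < h \<Longrightarrow> cell h x \<in> linear_combinations B"
  unfolding cell_def[abs_def] by (intro linear_combinations_diff) (auto simp: cell_lo_def cell_hi_def)

lemma cov_cell:
  assumes "0 < h"
  shows "cov (cell h x) (cell h y) = cell_cov H x y"
proof -
  define p q where "p = h * (real (fst x) + cell_lo (snd x))" and "q = h * (real (fst x) + cell_hi (snd x))"
  define p' q' where "p' = h * (real (fst y) + cell_lo (snd y))" and "q' = h * (real (fst y) + cell_hi (snd y))"
  have nn: "0 \<le> p" "0 \<le> q" "0 \<le> p'" "0 \<le> q'"
    using assms by (auto simp: p_def q_def p'_def q'_def cell_lo_def cell_hi_def)
  have "cov (cell h x) (cell h y) = expectation (\<lambda>\<omega>. 1 / (h powr H * h powr H) * ((B q \<omega> - B p \<omega>) * (B q' \<omega> - B p' \<omega>)))"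
    by (intro Bochner_Integration.integral_cong refl) (simp add: cell_def p_def q_def p'_def q'_def)
  also have "\<dots> = 1 / (h powr H * h powr H) * cov (\<lambda>\<omega>. B q \<omega> - B p \<omega>) (\<lambda>\<omega>. B q' \<omega> - B p' \<omega>)"
    by (rule integral_mult_right_zero)
  also have "\<dots> = 1 / (h powr H * h powr H) * inc_cov H p q p' q'"
    by (simp only: cov_increments[OF nn])
  also have "\<dots> = 1 / (h powr H * h powr H) * (h powr (2 * H) * cell_cov H x y)"
    unfolding p_def q_def p'_def q'_def cell_cov_def using assms by (subst inc_cov_scale) auto
  also have "h powr (2 * H) = h powr H * h powr H" by (simp add: powr_add[symmetric])
  finally show ?thesis using assms by simp
qed

text \<open>The variance at time 0 is 0. This identifies the terms B 1 and B (1/2) in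
  \<open>rho'\<close> with increments from 0.\<close>

lemma B_zero: "AE \<omega> in M. B 0 \<omega> = 0"
proof -
  have "cov (B 0) (B 0) = 0" by (simp add: cov_B)
  then have "AE \<omega> in M. B 0 \<omega> * B 0 \<omega> = 0"
    using integrable_G_mult[OF B_linear B_linear, of 0 0]
    by (subst (asm) integral_nonneg_eq_0_iff_AE) auto
  then show ?thesis by simp
qed

lemma expectation_square_mult_square:
  assumes "X \<in> linear_combinations B" "Y \<in> linear_combinations B"
  shows "expectation (\<lambda>\<omega>. (X \<omega>)\<^sup>2 * (Y \<omega>)\<^sup>2) = cov X X * cov Y Y + 2 * (cov X Y)\<^sup>2"
  using isserlis[OF assms(1) assms(1) assms(2) assms(2)]
  by (simp add: power2_eq_square mult.assoc)

text \<open>\<open>rho'\<close> is a mixed second moment without centring. By Isserlis' formula it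
  splits into a product of means, which vanishes because the weighted variances cancel, and the sum
  of squared covariances.\<close>

lemma rho'_eq: "rho' M H B m = cell_rho H 0 m"
proof -
  define Z where "Z m \<omega> = (\<Sum>\<alpha><3. cell_weight H \<alpha> * (cell 1 (m, \<alpha>) \<omega>)\<^sup>2)" for m \<omega>
  have lin: "cell 1 x \<in> linear_combinations B" for x by (rule cell_linear) simp
  have fm: "finite_moments M (cell 1 x)" for x by (rule finite_moments_G[OF lin])
  have meas[measurable]: "cell 1 x \<in> borel_measurable M" for x by (rule G_measurable[OF lin])
  have [measurable]: "B t \<in> borel_measurable M" if "0 \<le> t" for t using that by (rule B_measurable)
  have "rho' M H B m = expectation (\<lambda>\<omega>. Z 0 \<omega> * Z m \<omega>)"
    unfolding rho'_def
  proof (rule integral_cong_AE)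
    show "AE \<omega> in M. ((B 1 \<omega>)\<^sup>2 - 2 powr (2 * H - 1) * (B (1/2) \<omega>)\<^sup>2 - 2 powr (2 * H - 1) * (B 1 \<omega> - B (1/2) \<omega>)\<^sup>2) *
       ((B (real m + 1) \<omega> - B (real m) \<omega>)\<^sup>2 - 2 powr (2 * H - 1) * (B (real m + 1/2) \<omega> - B (real m) \<omega>)\<^sup>2 -
        2 powr (2 * H - 1) * (B (real m + 1) \<omega> - B (real m + 1/2) \<omega>)\<^sup>2) = Z 0 \<omega> * Z m \<omega>"
      using B_zero
    proof eventually_elim
      case (elim \<omega>)
      then show ?case
        unfolding Z_def sum_lessThan_3 cell_def cell_weight_def by (simp add: cell_lo_def cell_hi_def)
    qed
    show "(\<lambda>\<omega>. Z 0 \<omega> * Z m \<omega>) \<in> borel_measurable M" unfolding Z_def by measurable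
  qed measurable
  also have "\<dots> = expectation (\<lambda>\<omega>. \<Sum>\<alpha><3. \<Sum>\<beta><3. cell_weight H \<alpha> * cell_weight H \<beta> * ((cell 1 (0, \<alpha>) \<omega>)\<^sup>2 * (cell 1 (m, \<beta>) \<omega>)\<^sup>2))"
    unfolding Z_def sum_product by (simp add: mult_ac)
  also have "\<dots> = (\<Sum>\<alpha><3. \<Sum>\<beta><3. expectation (\<lambda>\<omega>. cell_weight H \<alpha> * cell_weight H \<beta> * ((cell 1 (0, \<alpha>) \<omega>)\<^sup>2 * (cell 1 (m, \<beta>) \<omega>)\<^sup>2)))"
    by (subst Bochner_Integration.integral_sum, (intro finite_moments_integrable finite_moments_sum finite_moments_mult finite_moments_const finite_moments_power fm),
        intro sum.cong refl Bochner_Integration.integral_sum finite_moments_integrable finite_moments_mult finite_moments_const finite_moments_power fm)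
  also have "\<dots> = (\<Sum>\<alpha><3. \<Sum>\<beta><3. cell_weight H \<alpha> * cell_weight H \<beta> *
      (cell_cov H (0, \<alpha>) (0, \<alpha>) * cell_cov H (m, \<beta>) (m, \<beta>) + 2 * (cell_cov H (0, \<alpha>) (m, \<beta>))\<^sup>2))"
    by (simp add: expectation_square_mult_square[OF lin lin] cov_cell)
  also have "\<dots> = (\<Sum>\<alpha><3. cell_weight H \<alpha> * cell_cov H (0, \<alpha>) (0, \<alpha>)) * (\<Sum>\<beta><3. cell_weight H \<beta> * cell_cov H (m, \<beta>) (m, \<beta>))
     + cell_rho H 0 m"
    unfolding sum_product cell_rho_def sum.distrib[symmetric]
    by (intro sum.cong refl) (simp add: algebra_simps)
  also have "\<dots> = cell_rho H 0 m" using cell_weight_variance_zero[OF H(1), of m] by simp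
  finally show ?thesis .
qed

lemma rho'_summable: "summable (\<lambda>m. rho' M H B (Suc m))"
  unfolding rho'_eq by (rule cell_rho_summable[OF H])

lemma cell_rho_mean_tendsto:
  "(\<lambda>n. (\<Sum>i<n. \<Sum>j<n. cell_rho H i j) / real n) \<longlonglongrightarrow> rho'_sum M H B"
  unfolding rho'_sum_def rho'_eq
  by (rule toeplitz_mean_tendsto[OF cell_rho_summable[OF H]]) (rule cell_rho_index_dist[unfolded index_dist_def])

text \<open>The factor 1 / (2 ln 2) combines the 1/2 of the estimator with the change from binary to
  natural logarithm; building it in makes \<open>(sigma' M H B)\<^sup>2\<close> the limiting
  variance.\<close>

definition fluct_weight :: "nat \<Rightarrow> nat \<times> nat \<Rightarrow> real" where
  "fluct_weight n x = cell_weight H (snd x) / (2 * ln 2 * sqrt (real n))"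

definition fluct :: "real \<Rightarrow> nat \<Rightarrow> 'a \<Rightarrow> real" where
  "fluct T n = quad ({..<n} \<times> {..<3}) (cell (T / real n)) (fluct_weight n)"

lemma ln2_ge_half: "1 \<le> 2 * ln (2 :: real)"
  using ln_2_less_1 ln2_ge_two_thirds by simp

lemma fluct_second_moment:
  assumes "0 < T" "0 < n"
  shows "expectation (\<lambda>\<omega>. (fluct T n \<omega>)\<^sup>2) = (1 / (2 * ln 2))\<^sup>2 * ((\<Sum>i<n. \<Sum>j<n. cell_rho H i j) / real n)"
proof -
  let ?c = "1 / (2 * ln 2)"
  have h: "0 < T / real n" using assms by simp
  have conv: "(\<Sum>x\<in>{..<n} \<times> {..<3}. f x) = (\<Sum>i<n. \<Sum>\<alpha><3. f (i, \<alpha>))" for f :: "nat \<times> nat \<Rightarrow> real"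
    by (simp add: sum.cartesian_product)
  have "expectation (\<lambda>\<omega>. (fluct T n \<omega>)\<^sup>2) =
     2 * (\<Sum>x\<in>{..<n} \<times> {..<3}. \<Sum>y\<in>{..<n} \<times> {..<3}. fluct_weight n x * fluct_weight n y * (cell_cov H x y)\<^sup>2)"
    unfolding fluct_def using quad_second_moment[OF cell_linear[OF h]] by (simp only: cov_cell[OF h])
  also have "\<dots> = 2 * (\<Sum>i<n. \<Sum>\<alpha><3. \<Sum>j<n. \<Sum>\<beta><3. fluct_weight n (i, \<alpha>) * fluct_weight n (j, \<beta>) * (cell_cov H (i, \<alpha>) (j, \<beta>))\<^sup>2)"
    unfolding conv ..
  also have "\<dots> = 2 * (\<Sum>i<n. \<Sum>j<n. \<Sum>\<alpha><3. \<Sum>\<beta><3. fluct_weight n (i, \<alpha>) * fluct_weight n (j, \<beta>) * (cell_cov H (i, \<alpha>) (j, \<beta>))\<^sup>2)"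
    by (subst sum.swap[of _ "{..<n}" "{..<3}"]) (rule refl)
  also have "\<dots> = (\<Sum>i<n. \<Sum>j<n. ?c\<^sup>2 / real n * cell_rho H i j)"
    unfolding cell_rho_def sum_distrib_left fluct_weight_def snd_conv
    using assms by (intro sum.cong refl) (simp add: power2_eq_square field_simps)
  also have "\<dots> = ?c\<^sup>2 * ((\<Sum>i<n. \<Sum>j<n. cell_rho H i j) / real n)"
    by (simp add: sum_distrib_left sum_divide_distrib)
  finally show ?thesis .
qed

text \<open>A limit of averages that are, up to a positive factor, second moments of
  \<open>fluct\<close>; the choice T = 1 is arbitrary, as these moments do not depend on T.\<close>

lemma rho'_sum_nonneg: "0 \<le> rho'_sum M H B"
proof (rule LIMSEQ_le_const[OF cell_rho_mean_tendsto], intro exI[of _ 1] allI impI)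
  fix n :: nat assume n: "1 \<le> n"
  have "0 \<le> expectation (\<lambda>\<omega>. (fluct 1 n \<omega>)\<^sup>2)" by (intro integral_nonneg_AE) simp
  then have "0 \<le> (1 / (2 * ln 2))\<^sup>2 * ((\<Sum>i<n. \<Sum>j<n. cell_rho H i j) / real n)"
    using n fluct_second_moment[of 1 n] by simp
  moreover have "0 < (1 / (2 * ln 2 :: real))\<^sup>2" by simp
  ultimately show "0 \<le> (\<Sum>i<n. \<Sum>j<n. cell_rho H i j) / real n"
    using mult_pos_neg linorder_not_le by blast
qed

theorem fluct_moments_tendsto:
  assumes T: "0 < T" and n: "\<And>k. 0 < n k" "filterlim n at_top sequentially"
  shows "(\<lambda>k. expectation (\<lambda>\<omega>. fluct T (n k) \<omega> ^ m)) \<longlonglongrightarrow> gauss_moment ((sigma' M H B)\<^sup>2) m"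
  unfolding fluct_def
\<comment> \<open>\<open>C\<close> is the row sum bound. All weights are at most 1 / sqrt n because
  2 ln 2 is at least 1, and with 3n cells this gives D^2 card = 3.\<close>
proof (rule quad_moments_tendsto[where C=6 and A=3 and D="\<lambda>k. 1 / sqrt (real (n k))"])
  have h: "0 < T / real (n k)" for k using T n(1) by simp
  show "cell (T / real (n k)) x \<in> linear_combinations B" for k x by (rule cell_linear[OF h])
  show "\<bar>fluct_weight (n k) x\<bar> \<le> 1 / sqrt (real (n k))" for k x
  proof -
    have "\<bar>cell_weight H (snd x)\<bar> \<le> 2 * ln 2" using cell_weight_abs_le[OF H(2), of "snd x"] ln2_ge_half by linarith
    then have "\<bar>cell_weight H (snd x)\<bar> / (2 * ln 2) / sqrt (real (n k)) \<le> 1 / sqrt (real (n k))"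
      using ln2_ge_half by (intro divide_right_mono) (auto simp: divide_le_eq)
    then show ?thesis using ln2_ge_half by (simp add: fluct_weight_def abs_mult)
  qed
  show "(\<Sum>y\<in>{..<n k} \<times> {..<3}. \<bar>cov (cell (T / real (n k)) x) (cell (T / real (n k)) y)\<bar>) \<le> 6" for k x
    unfolding cov_cell[OF h] by (rule cell_cov_row_sum[OF H])
  show "finite ({..<n k} \<times> {..<3::nat})" for k by simp
  show "(1 / sqrt (real (n k)))\<^sup>2 * real (card ({..<n k} \<times> {..<3::nat})) \<le> 3" for k
    using n(1)[of k] by (simp add: power_divide card_cartesian_product)
  show "0 < 1 / sqrt (real (n k))" for k using n(1)[of k] by simp
  have "filterlim (\<lambda>k. sqrt (real (n k))) at_top sequentially"
    by (intro filterlim_compose[OF sqrt_at_top] filterlim_compose[OF filterlim_real_sequentially] n(2))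
  then show "(\<lambda>k. 1 / sqrt (real (n k))) \<longlonglongrightarrow> 0"
    by (intro tendsto_divide_0[OF tendsto_const] filterlim_at_top_imp_at_infinity)
  have "(\<lambda>k. (1 / (2 * ln 2))\<^sup>2 * ((\<Sum>i<n k. \<Sum>j<n k. cell_rho H i j) / real (n k))) \<longlonglongrightarrow> (1 / (2 * ln 2))\<^sup>2 * rho'_sum M H B"
    by (intro tendsto_mult tendsto_const filterlim_compose[OF cell_rho_mean_tendsto] n(2))
  also have "(1 / (2 * ln 2))\<^sup>2 * rho'_sum M H B = (sigma' M H B)\<^sup>2"
    using rho'_sum_nonneg by (simp add: sigma'_def power_mult_distrib power_divide)
  finally show "(\<lambda>k. expectation (\<lambda>\<omega>. (quad ({..<n k} \<times> {..<3}) (cell (T / real (n k))) (fluct_weight (n k)) \<omega>)\<^sup>2))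
     \<longlonglongrightarrow> (sigma' M H B)\<^sup>2"
    using fluct_second_moment[OF T n(1)] by (simp add: fluct_def)
qed simp

lemma fluct_finite_moments:
  assumes "0 < T" "0 < n"
  shows "finite_moments M (fluct T n)"
  unfolding fluct_def using assms by (intro finite_moments_quad cell_linear) simp

text \<open>The centred, normalised term \<open>P\<^sub>n\<close> of the overview.\<close>

definition qv_dev :: "real \<Rightarrow> nat \<Rightarrow> 'a \<Rightarrow> real" where
  "qv_dev T n \<omega> = quadratic_variation T n B \<omega> / ((T / real n) powr (2 * H) * real n) - 1"

lemma cell_square:
  assumes "0 < h"
  shows "(B (h * (real i + cell_hi \<alpha>)) \<omega> - B (h * (real i + cell_lo \<alpha>)) \<omega>)\<^sup>2 = h powr (2 * H) * (cell h (i, \<alpha>) \<omega>)\<^sup>2"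
proof -
  have "h powr (2 * H) = (h powr H)\<^sup>2" by (simp add: power2_eq_square powr_add[symmetric])
  then show ?thesis using assms by (simp add: cell_def power_mult_distrib power_divide)
qed

lemma quadratic_variation_eq_cell:
  assumes "0 < T" "0 < n"
  shows "quadratic_variation T n B \<omega> = (T / real n) powr (2 * H) * (\<Sum>i<n. (cell (T / real n) (i, 0) \<omega>)\<^sup>2)"
proof -
  have h: "0 < T / real n" using assms by simp
  show ?thesis
    unfolding quadratic_variation_def grid_increment_def sum_distrib_left cell_square[OF h, symmetric]
    by (intro sum.cong refl) (simp add: cell_lo_def cell_hi_def)
qed

lemma sum_lessThan_double: "(\<Sum>i<2 * n. f i) = (\<Sum>i<n. f (2 * i) + f (2 * i + 1))"
  for f :: "nat \<Rightarrow> real"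
  by (induction n) simp_all

text \<open>On the finer grid the increments with even and odd index are the first and second halves
  of the coarse cells, so both quadratic variations are read off the same cells.\<close>

lemma quadratic_variation_double_eq_cell:
  assumes "0 < T" "0 < n"
  shows "quadratic_variation T (2 * n) B \<omega> = (T / real n) powr (2 * H) *
    (\<Sum>i<n. (cell (T / real n) (i, 1) \<omega>)\<^sup>2 + (cell (T / real n) (i, 2) \<omega>)\<^sup>2)"
proof -
  have h: "0 < T / real n" using assms by simp
  have 1: "T * (real (2 * i) + 1) / real (2 * n) = T / real n * (real i + 1/2)"
    "T * real (2 * i) / real (2 * n) = T / real n * real i"
    "T * (real (2 * i + 1) + 1) / real (2 * n) = T / real n * (real i + 1)"
    "T * real (2 * i + 1) / real (2 * n) = T / real n * (real i + 1/2)" for i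
    using assms by (simp_all add: field_simps)
  show ?thesis
    unfolding quadratic_variation_def grid_increment_def sum_lessThan_double sum_distrib_left 1
      distrib_left[of "(T / real n) powr (2 * H)"] cell_square[OF h, symmetric]
    by (intro sum.cong refl) (simp add: cell_lo_def cell_hi_def)
qed

text \<open>The centring inside \<open>fluct\<close> drops out since the weighted variances cancel,
  and the weight 2^(2H-1) of the halves is the ratio of the normalising constants of the two
  grids.\<close>

lemma fluct_eq_qv_dev:
  assumes T: "0 < T" and n: "0 < n"
  shows "fluct T n \<omega> = sqrt (real n) / (2 * ln 2) * (qv_dev T n \<omega> - qv_dev T (2 * n) \<omega>)"
proof -
  have h: "0 < T / real n" using assms by simp
  define S where "S \<alpha> = (\<Sum>i<n. (cell (T / real n) (i, \<alpha>) \<omega>)\<^sup>2)" for \<alpha>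
  define c where "c = 1 / (2 * ln 2 * sqrt (real n))"
  define k where "k = 2 powr (2 * H - 1)"
  have "fluct T n \<omega> = (\<Sum>i<n. \<Sum>\<alpha><3. c * (cell_weight H \<alpha> * ((cell (T / real n) (i, \<alpha>) \<omega>)\<^sup>2 - cell_cov H (i, \<alpha>) (i, \<alpha>))))"
    unfolding fluct_def quad_def cov_cell[OF h] fluct_weight_def c_def
    by (simp add: sum.cartesian_product case_prod_unfold)
  also have "\<dots> = (\<Sum>i<n. c * (\<Sum>\<alpha><3. cell_weight H \<alpha> * (cell (T / real n) (i, \<alpha>) \<omega>)\<^sup>2))"
  proof (intro sum.cong refl)
    fix i
    show "(\<Sum>\<alpha><3. c * (cell_weight H \<alpha> * ((cell (T / real n) (i, \<alpha>) \<omega>)\<^sup>2 - cell_cov H (i, \<alpha>) (i, \<alpha>)))) =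
       c * (\<Sum>\<alpha><3. cell_weight H \<alpha> * (cell (T / real n) (i, \<alpha>) \<omega>)\<^sup>2)"
      using cell_weight_variance_zero[OF H(1), of i]
      by (simp only: sum_distrib_left[symmetric] right_diff_distrib sum_subtractf)
  qed
  also have "\<dots> = c * (\<Sum>i<n. \<Sum>\<alpha><3. cell_weight H \<alpha> * (cell (T / real n) (i, \<alpha>) \<omega>)\<^sup>2)"
    by (simp add: sum_distrib_left)
  also have "(\<Sum>i<n. \<Sum>\<alpha><3. cell_weight H \<alpha> * (cell (T / real n) (i, \<alpha>) \<omega>)\<^sup>2) = S 0 - k * (S 1 + S 2)"
    unfolding sum_lessThan_3 S_def k_def
    by (simp add: cell_weight_def sum.distrib sum_subtractf sum_distrib_left distrib_left)
  finally have F: "fluct T n \<omega> = c * (S 0 - k * (S 1 + S 2))" .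
  have P1: "qv_dev T n \<omega> = S 0 / real n - 1"
    unfolding qv_dev_def quadratic_variation_eq_cell[OF assms] S_def using T by simp
  have half: "(T / real (2 * n)) powr (2 * H) * real (2 * n) = (T / real n) powr (2 * H) * real n / k"
  proof -
    have "T / real (2 * n) = T / real n / 2" by simp
    then have "(T / real (2 * n)) powr (2 * H) = (T / real n) powr (2 * H) / 2 powr (2 * H)"
      using T by (simp add: powr_divide powr_mult)
    then show ?thesis unfolding k_def by (simp add: powr_diff)
  qed
  have "k > 0" by (simp add: k_def)
  have P2: "qv_dev T (2 * n) \<omega> = k * (S 1 + S 2) / real n - 1"
    unfolding qv_dev_def quadratic_variation_double_eq_cell[OF assms] half S_def sum.distrib
    using T \<open>k > 0\<close> by simp
  have "sqrt (real n) / (2 * ln 2) = c * real n"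
    using n by (simp add: c_def field_simps)
  then show ?thesis unfolding F P1 P2 using n by (simp add: field_simps)
qed

lemma qv_dev_eq_quad:
  assumes T: "0 < T" and n: "0 < n"
  shows "qv_dev T n = quad {..<n} (\<lambda>i. cell (T / real n) (i, 0)) (\<lambda>_. 1 / real n)"
proof
  fix \<omega>
  have h: "0 < T / real n" using assms by simp
  have "cell_cov H (i, 0) (i, 0) = 1" for i
    by (simp add: cell_cov_def inc_cov_def cell_lo_def cell_hi_def)
  then have "quad {..<n} (\<lambda>i. cell (T / real n) (i, 0)) (\<lambda>_. 1 / real n) \<omega> = (\<Sum>i<n. (cell (T / real n) (i, 0) \<omega>)\<^sup>2) / real n - 1"
    unfolding quad_def cov_cell[OF h] using n by (simp add: sum_subtractf sum_divide_distrib[symmetric] diff_divide_distrib)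
  then show "qv_dev T n \<omega> = quad {..<n} (\<lambda>i. cell (T / real n) (i, 0)) (\<lambda>_. 1 / real n) \<omega>"
    unfolding qv_dev_def quadratic_variation_eq_cell[OF assms] using assms by simp
qed

text \<open>The second moment is 2/n^2 times the sum of squared correlations. These are at most the
  correlation majorant, so each of the n rows contributes at most 2.\<close>

lemma qv_dev_second_moment:
  assumes T: "0 < T" and n: "0 < n"
  shows "finite_moments M (qv_dev T n)" "expectation (\<lambda>\<omega>. (qv_dev T n \<omega>)\<^sup>2) \<le> 4 / real n"
proof -
  have h: "0 < T / real n" using assms by simp
  show "finite_moments M (qv_dev T n)"
    unfolding qv_dev_eq_quad[OF assms] by (intro finite_moments_quad cell_linear h)
  have "expectation (\<lambda>\<omega>. (qv_dev T n \<omega>)\<^sup>2) = 2 * (\<Sum>i<n. \<Sum>j<n. 1 / real n * (1 / real n) * (cell_cov H (i, 0) (j, 0))\<^sup>2)"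
    unfolding qv_dev_eq_quad[OF assms] by (subst quad_second_moment) (simp_all only: cell_linear[OF h] cov_cell[OF h])
  also have "\<dots> \<le> 2 * (\<Sum>i<n. 1 / real n * (1 / real n) * 2)"
  proof (intro mult_left_mono sum_mono)
    fix i
    have "(\<Sum>j<n. (cell_cov H (i, 0) (j, 0))\<^sup>2) \<le> (\<Sum>j<n. cov_decay H (index_dist i j))"
    proof (intro sum_mono)
      fix j
      have c: "\<bar>cell_cov H (i, 0) (j, 0)\<bar> \<le> cov_decay H (index_dist i j)" by (rule cell_cov_abs_le[OF H])
      have "(cell_cov H (i, 0) (j, 0))\<^sup>2 = \<bar>cell_cov H (i, 0) (j, 0)\<bar> * \<bar>cell_cov H (i, 0) (j, 0)\<bar>"
        by (simp add: power2_eq_square)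
      also have "\<dots> \<le> 1 * cov_decay H (index_dist i j)"
        using c cov_decay_le_1[OF H, of "index_dist i j"] by (intro mult_mono) auto
      finally show "(cell_cov H (i, 0) (j, 0))\<^sup>2 \<le> cov_decay H (index_dist i j)" by simp
    qed
    also have "\<dots> \<le> 2" by (rule cov_decay_row_sum[OF H])
    finally show "(\<Sum>j<n. 1 / real n * (1 / real n) * (cell_cov H (i, 0) (j, 0))\<^sup>2) \<le> 1 / real n * (1 / real n) * 2"
      unfolding sum_distrib_left[symmetric] by (intro mult_left_mono) auto
  qed simp
  also have "\<dots> = 4 / real n" using n by simp
  finally show "expectation (\<lambda>\<omega>. (qv_dev T n \<omega>)\<^sup>2) \<le> 4 / real n" .
qed

end

section \<open>The mixed model\<close>

text \<open>Here s stands for sqrt n. The restriction on \<eta> gives |P| at most 1/4 and |R| at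
  most 1/16, inside the range of the quadratic logarithm bound. With (P + R)^2 at most 2 P^2 + 2 R^2
  the error is 4 \<eta> from P^2, 4 \<eta> from R^2 and \<eta> from R, which is not
  subtracted.\<close>

lemma ln_dev_bound:
  fixes P R s \<eta> :: real
  assumes s: "1 \<le> s" and \<eta>: "0 < \<eta>" "\<eta> \<le> 1/16" and R: "s * \<bar>R\<bar> \<le> \<eta>" and P: "s * P\<^sup>2 \<le> \<eta>"
  shows "1/2 \<le> 1 + P + R" "s * \<bar>ln (1 + P + R) - P\<bar> \<le> 9 * \<eta>"
proof -
  have R1: "\<bar>R\<bar> \<le> \<eta>" using s R mult_right_mono[of 1 s "\<bar>R\<bar>"] by simp
  have "P\<^sup>2 \<le> 1/16" using s P \<eta> mult_right_mono[of 1 s "P\<^sup>2"] by simp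
  then have "P\<^sup>2 \<le> (1/4)\<^sup>2" by (simp add: power2_eq_square)
  then have P1: "\<bar>P\<bar> \<le> 1/4" using abs_le_square_iff[of P "1/4"] by simp
  have x: "\<bar>P + R\<bar> \<le> 1/2" using R1 P1 \<eta> by linarith
  then show "1/2 \<le> 1 + P + R" by linarith
  have "\<bar>ln (1 + (P + R)) - (P + R)\<bar> \<le> 2 * (P + R)\<^sup>2" by (rule abs_ln_one_plus_x_minus_x_bound[OF x])
  also have "(P + R)\<^sup>2 \<le> 2 * P\<^sup>2 + 2 * R\<^sup>2"
    using sum_squares_bound[of P R] by (simp add: power2_sum)
  finally have "\<bar>ln (1 + P + R) - P\<bar> \<le> 4 * P\<^sup>2 + 4 * R\<^sup>2 + \<bar>R\<bar>" by (simp add: add.assoc)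
  then have "s * \<bar>ln (1 + P + R) - P\<bar> \<le> s * (4 * P\<^sup>2 + 4 * R\<^sup>2 + \<bar>R\<bar>)"
    using s by (intro mult_left_mono) auto
  also have "\<dots> = 4 * (s * P\<^sup>2) + 4 * ((s * \<bar>R\<bar>) * \<bar>R\<bar>) + s * \<bar>R\<bar>"
    by (simp add: algebra_simps power2_eq_square)
  also have "(s * \<bar>R\<bar>) * \<bar>R\<bar> \<le> \<eta> * 1"
    using R R1 \<eta> by (intro mult_mono) auto
  finally show "s * \<bar>ln (1 + P + R) - P\<bar> \<le> 9 * \<eta>" using P R by linarith
qed

lemma (in prob_space) markov_gt:
  assumes "integrable M X" "\<And>\<omega>. 0 \<le> X \<omega>" "0 < c"
  shows "prob {\<omega>\<in>space M. c < X \<omega>} \<le> expectation X / c"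
proof -
  have [measurable]: "X \<in> borel_measurable M" using assms(1) by simp
  have "prob {\<omega>\<in>space M. c < X \<omega>} \<le> prob {\<omega>\<in>space M. c \<le> X \<omega>}"
    by (intro finite_measure_mono) auto
  also have "\<dots> \<le> expectation X / c"
    using assms by (intro integral_Markov_inequality_measure[where A="space M"]) auto
  finally show ?thesis .
qed

locale mixed_model = fbm M H B for M :: "'a measure" and H B +
  fixes T a b :: real and W :: "real \<Rightarrow> 'a \<Rightarrow> real"
  assumes H4: "H < 1/4" and T: "0 < T" and a: "0 < a" and b: "0 < b"
    and wiener: "wiener_process M W" and indep: "independent_processes M B W"
begin

section \<open>Increments of the two processes and their products\<close>

lemma W_measurable: "0 \<le> t \<Longrightarrow> W t \<in> borel_measurable M"
  using wiener by (simp add: wiener_process_def)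

definition mesh :: "nat \<Rightarrow> real" where "mesh n = T / real n"

lemma mesh_pos: "0 < n \<Longrightarrow> 0 < mesh n" using T by (simp add: mesh_def)

abbreviation dB :: "nat \<Rightarrow> nat \<Rightarrow> 'a \<Rightarrow> real" where "dB n i \<equiv> grid_increment T n i B"
abbreviation dW :: "nat \<Rightarrow> nat \<Rightarrow> 'a \<Rightarrow> real" where "dW n i \<equiv> grid_increment T n i W"

lemma grid_nonneg: "0 \<le> T * (real i + 1) / real n" "0 \<le> T * real i / real n"
  using T by auto

lemma dW_moments:
  assumes "0 < n"
  shows "finite_moments M (dW n i)" "expectation (dW n i) = 0" "expectation (\<lambda>\<omega>. dW n i \<omega> * dW n i \<omega>) = mesh n"
proof -
  have meas: "dW n i \<in> borel_measurable M"
    unfolding grid_increment_def[abs_def] by (intro borel_measurable_diff W_measurable grid_nonneg)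
  have diff: "T * (real i + 1) / real n - T * real i / real n = mesh n"
    by (simp add: mesh_def field_simps flip: diff_divide_distrib)
  have "distr M borel (dW n i) = normal_law 0 (T * (real i + 1) / real n - T * real i / real n)"
    using wiener grid_nonneg(2) diff mesh_pos[OF assms] unfolding wiener_process_def grid_increment_def[abs_def] by simp
  then have law: "distr M borel (dW n i) = normal_law 0 (mesh n)" unfolding diff .
  note m = distr_normal_moments[OF meas less_imp_le[OF mesh_pos[OF assms]] law]
  show "finite_moments M (dW n i)" by (rule m(3))
  show "expectation (dW n i) = 0" using m(2)[of 1] by simp
  show "expectation (\<lambda>\<omega>. dW n i \<omega> * dW n i \<omega>) = mesh n" using m(2)[of "Suc (Suc 0)"] by simp
qed

lemma dW_uncorrelated:
  assumes "0 < n" "i < n" "j < n" "i \<noteq> j"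
  shows "expectation (\<lambda>\<omega>. dW n i \<omega> * dW n j \<omega>) = 0"
proof -
  \<comment> \<open>Independence is assumed for consecutive increments along a nondecreasing
    sequence of times; the grid, continued beyond T, is such a sequence.\<close>
  define \<tau> where "\<tau> k = T * real k / real n" for k
  have "mono \<tau>" unfolding \<tau>_def using T by (intro monoI divide_right_mono mult_left_mono) auto
  moreover have "0 \<le> \<tau> 0" by (simp add: \<tau>_def)
  ultimately have "indep_vars (\<lambda>_. borel) (\<lambda>i \<omega>. W (\<tau> (Suc i)) \<omega> - W (\<tau> i) \<omega>) {..<n}"
    using wiener unfolding wiener_process_def by blast
  also have "(\<lambda>i \<omega>. W (\<tau> (Suc i)) \<omega> - W (\<tau> i) \<omega>) = dW n"
    by (simp add: \<tau>_def grid_increment_def fun_eq_iff add.commute)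
  finally have "indep_vars (\<lambda>_. borel) (dW n) {i, j}"
    by (rule indep_vars_subset) (use assms in auto)
  from indep_vars_lebesgue_integral[OF _ this]
  have "expectation (\<lambda>\<omega>. \<Prod>k\<in>{i, j}. dW n k \<omega>) = (\<Prod>k\<in>{i, j}. expectation (dW n k))"
    using dW_moments(1)[OF assms(1)] by (simp add: finite_moments_integrable)
  then show ?thesis using assms(4) dW_moments(2)[OF assms(1)] by simp
qed

lemma dB_linear: "dB n i \<in> linear_combinations B"
  using linear_combinations_diff[OF grid_nonneg(2) grid_nonneg(1), where c=1 and B=B]
  unfolding grid_increment_def[abs_def] by simp

lemma cov_dB_self:
  assumes "0 < n"
  shows "cov (dB n i) (dB n i) = mesh n powr (2 * H)"
proof -
  have "cov (dB n i) (dB n i) = inc_cov H (T * real i / real n) (T * (real i + 1) / real n) (T * real i / real n) (T * (real i + 1) / real n)"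
    unfolding grid_increment_def[abs_def] by (rule cov_increments[OF grid_nonneg(2,1,2,1)])
  also have "\<dots> = \<bar>T * (real i + 1) / real n - T * real i / real n\<bar> powr (2 * H)"
    by (simp add: inc_cov_def abs_minus_commute)
  also have "T * (real i + 1) / real n - T * real i / real n = mesh n"
    by (simp add: mesh_def field_simps flip: diff_divide_distrib)
  finally show ?thesis using mesh_pos[OF assms] by simp
qed

text \<open>One functional \<Phi> of a path, the product of two grid increments, is measurable for
  the product \<sigma>-algebra; applied to both independent paths it yields independent
  variables.\<close>

lemma expectation_dB_dW:
  assumes n: "0 < n"
  shows "expectation (\<lambda>\<omega>. (dB n i \<omega> * dB n j \<omega>) * (dW n i \<omega> * dW n j \<omega>)) =
      cov (dB n i) (dB n j) * expectation (\<lambda>\<omega>. dW n i \<omega> * dW n j \<omega>)" (is ?A)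
    and "integrable M (\<lambda>\<omega>. (dB n i \<omega> * dB n j \<omega>) * (dW n i \<omega> * dW n j \<omega>))" (is ?B)
proof -
  define \<Phi> :: "(real \<Rightarrow> real) \<Rightarrow> real" where
    "\<Phi> f = (f (T * (real i + 1) / real n) - f (T * real i / real n)) * (f (T * (real j + 1) / real n) - f (T * real j / real n))" for f
  have [measurable]: "(\<lambda>f. f (T * (real k + 1) / real n)) \<in> PiM {0..} (\<lambda>_. borel) \<rightarrow>\<^sub>M (borel :: real measure)"
     "(\<lambda>f. f (T * real k / real n)) \<in> PiM {0..} (\<lambda>_. borel) \<rightarrow>\<^sub>M (borel :: real measure)" for k
    using grid_nonneg[of k n] by (auto intro: measurable_component_singleton)
  have \<Phi>: "\<Phi> \<in> PiM {0..} (\<lambda>_. borel) \<rightarrow>\<^sub>M borel" unfolding \<Phi>_def by measurable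
  have "indep_var borel (\<Phi> \<circ> (\<lambda>\<omega>. \<lambda>t\<in>{0..}. B t \<omega>)) borel (\<Phi> \<circ> (\<lambda>\<omega>. \<lambda>t\<in>{0..}. W t \<omega>))"
    using indep unfolding independent_processes_def by (rule indep_var_compose) (rule \<Phi>)+
  moreover have "\<Phi> \<circ> (\<lambda>\<omega>. \<lambda>t\<in>{0..}. X t \<omega>) = (\<lambda>\<omega>. grid_increment T n i X \<omega> * grid_increment T n j X \<omega>)" for X :: "real \<Rightarrow> 'a \<Rightarrow> real"
    using grid_nonneg by (simp add: \<Phi>_def grid_increment_def fun_eq_iff)
  ultimately have ind: "indep_var borel (\<lambda>\<omega>. dB n i \<omega> * dB n j \<omega>) borel (\<lambda>\<omega>. dW n i \<omega> * dW n j \<omega>)" by simp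
  have int: "integrable M (\<lambda>\<omega>. dB n i \<omega> * dB n j \<omega>)" "integrable M (\<lambda>\<omega>. dW n i \<omega> * dW n j \<omega>)"
    by (intro integrable_G_mult dB_linear)
      (intro finite_moments_integrable finite_moments_mult dW_moments(1)[OF n])
  show ?A by (rule indep_var_lebesgue_integral[OF ind int])
  show ?B by (rule indep_var_integrable[OF ind int])
qed

definition cross :: "nat \<Rightarrow> 'a \<Rightarrow> real" where
  "cross n \<omega> = (\<Sum>i<n. dB n i \<omega> * dW n i \<omega>)"

text \<open>Off the diagonal the uncorrelated Wiener increments annihilate every term, so the
  correlations of the fractional part never enter.\<close>

lemma cross_second_moment:
  assumes n: "0 < n"
  shows "integrable M (\<lambda>\<omega>. (cross n \<omega>)\<^sup>2)"
    and "expectation (\<lambda>\<omega>. (cross n \<omega>)\<^sup>2) = real n * mesh n powr (2 * H) * mesh n"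
proof -
  have eq: "(\<lambda>\<omega>. (cross n \<omega>)\<^sup>2) = (\<lambda>\<omega>. \<Sum>i<n. \<Sum>j<n. (dB n i \<omega> * dB n j \<omega>) * (dW n i \<omega> * dW n j \<omega>))"
    unfolding cross_def power2_eq_square sum_product by (simp add: mult_ac)
  show "integrable M (\<lambda>\<omega>. (cross n \<omega>)\<^sup>2)"
    unfolding eq by (intro Bochner_Integration.integrable_sum expectation_dB_dW n)
  have "expectation (\<lambda>\<omega>. (cross n \<omega>)\<^sup>2) = (\<Sum>i<n. \<Sum>j<n. expectation (\<lambda>\<omega>. (dB n i \<omega> * dB n j \<omega>) * (dW n i \<omega> * dW n j \<omega>)))"
    unfolding eq
    by (subst Bochner_Integration.integral_sum, intro Bochner_Integration.integrable_sum expectation_dB_dW n,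
        intro sum.cong refl Bochner_Integration.integral_sum expectation_dB_dW n)
  also have "\<dots> = (\<Sum>i<n. \<Sum>j<n. if j = i then mesh n powr (2 * H) * mesh n else 0)"
  proof (intro sum.cong refl)
    fix i j assume "i \<in> {..<n}" "j \<in> {..<n}"
    then show "expectation (\<lambda>\<omega>. (dB n i \<omega> * dB n j \<omega>) * (dW n i \<omega> * dW n j \<omega>)) = (if j = i then mesh n powr (2 * H) * mesh n else 0)"
      unfolding expectation_dB_dW(1)[OF n]
      using dW_uncorrelated[OF n, of i j] dW_moments(3)[OF n, of i] cov_dB_self[OF n, of i] by auto
  qed
  also have "\<dots> = real n * mesh n powr (2 * H) * mesh n" by (simp add: sum.delta mult.assoc)
  finally show "expectation (\<lambda>\<omega>. (cross n \<omega>)\<^sup>2) = real n * mesh n powr (2 * H) * mesh n" .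
qed

lemma quadratic_variation_W:
  assumes n: "0 < n"
  shows "integrable M (quadratic_variation T n W)" "expectation (quadratic_variation T n W) = T"
proof -
  have eq: "quadratic_variation T n W = (\<lambda>\<omega>. \<Sum>i<n. dW n i \<omega> * dW n i \<omega>)"
    by (simp add: quadratic_variation_def fun_eq_iff power2_eq_square)
  have int: "integrable M (\<lambda>\<omega>. dW n i \<omega> * dW n i \<omega>)" for i
    by (intro finite_moments_integrable finite_moments_mult dW_moments(1)[OF n])
  show "integrable M (quadratic_variation T n W)" unfolding eq by (intro Bochner_Integration.integrable_sum int)
  show "expectation (quadratic_variation T n W) = T"
    unfolding eq using n by (subst Bochner_Integration.integral_sum) (simp_all add: int dW_moments(3) mesh_def)
qed

definition qv_scale :: "nat \<Rightarrow> real" where "qv_scale n = a\<^sup>2 * (mesh n powr (2 * H) * real n)"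

lemma qv_scale_pos:
  assumes "0 < n"
  shows "0 < qv_scale n"
  using assms a mesh_pos[OF assms] by (simp add: qv_scale_def)

abbreviation X :: "real \<Rightarrow> 'a \<Rightarrow> real" where "X \<equiv> mixed_process a b B W"

definition noise :: "nat \<Rightarrow> 'a \<Rightarrow> real" where
  "noise n \<omega> = (2 * a * b * cross n \<omega> + b\<^sup>2 * quadratic_variation T n W \<omega>) / qv_scale n"

lemma quadratic_variation_mixed:
  assumes n: "0 < n"
  shows "quadratic_variation T n X \<omega> = qv_scale n * (1 + qv_dev T n \<omega> + noise n \<omega>)"
proof -
  have "quadratic_variation T n X \<omega> = a\<^sup>2 * quadratic_variation T n B \<omega> + (2 * a * b * cross n \<omega> + b\<^sup>2 * quadratic_variation T n W \<omega>)"
    unfolding quadratic_variation_def cross_def sum_distrib_left sum.distrib[symmetric]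
    by (intro sum.cong refl) (simp add: grid_increment_def mixed_process_def power2_eq_square algebra_simps)
  also have "a\<^sup>2 * quadratic_variation T n B \<omega> = qv_scale n * (1 + qv_dev T n \<omega>)"
    unfolding qv_dev_def qv_scale_def mesh_def[symmetric] using mesh_pos[OF n] n by simp
  also have "2 * a * b * cross n \<omega> + b\<^sup>2 * quadratic_variation T n W \<omega> = qv_scale n * noise n \<omega>"
    using qv_scale_pos[OF n] by (simp add: noise_def)
  finally show ?thesis by (simp only: distrib_left)
qed

lemma noise_measurable: "0 < n \<Longrightarrow> noise n \<in> borel_measurable M"
proof -
  assume n: "0 < n"
  have [measurable]: "dB n i \<in> borel_measurable M" "dW n i \<in> borel_measurable M" for i
    using G_measurable[OF dB_linear] finite_moments_measurable[OF dW_moments(1)[OF n]] by auto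
  show ?thesis unfolding noise_def[abs_def] cross_def quadratic_variation_def by measurable
qed

text \<open>Off this event the smallness conditions of \<open>ln_dev_bound\<close> hold with s =
  sqrt n.\<close>

definition bad :: "nat \<Rightarrow> real \<Rightarrow> 'a set" where
  "bad n \<eta> = {\<omega>\<in>space M. \<eta> < sqrt (real n) * \<bar>noise n \<omega>\<bar> \<or> \<eta> < sqrt (real n) * (qv_dev T n \<omega>)\<^sup>2}"

lemma bad_sets: "0 < n \<Longrightarrow> bad n \<eta> \<in> sets M"
proof -
  assume n: "0 < n"
  have [measurable]: "noise n \<in> borel_measurable M" "qv_dev T n \<in> borel_measurable M"
    using noise_measurable[OF n] finite_moments_measurable[OF qv_dev_second_moment(1)[OF T n]] by auto
  show ?thesis unfolding bad_def by measurable
qed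

text \<open>Three applications of Markov's inequality: to the square of the cross term, to the
  nonnegative quadratic variation of W, whose mean is T, and to the square of \<open>qv_dev\<close>.
  The first two share the threshold \<eta> equally.\<close>

lemma prob_bad_le:
  assumes n: "0 < n" and \<eta>: "0 < \<eta>"
  shows "prob (bad n \<eta>) \<le> 16 * b\<^sup>2 / (a\<^sup>2 * \<eta>\<^sup>2) * (mesh n powr (1 - 2 * H))
     + 2 * b\<^sup>2 * T powr (1 - 2 * H) / (a\<^sup>2 * \<eta>) * real n powr (2 * H - 1/2) + 4 / \<eta> * real n powr (- 1/2)"
proof -
  have [measurable]: "dB n i \<in> borel_measurable M" "dW n i \<in> borel_measurable M" for i
    using G_measurable[OF dB_linear] finite_moments_measurable[OF dW_moments(1)[OF n]] by auto
  have [measurable]: "noise n \<in> borel_measurable M" "qv_dev T n \<in> borel_measurable M"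
    using noise_measurable[OF n] finite_moments_measurable[OF qv_dev_second_moment(1)[OF T n]] by auto
  have [measurable]: "cross n \<in> borel_measurable M" unfolding cross_def[abs_def] by measurable
  have QW[measurable]: "quadratic_variation T n W \<in> borel_measurable M" using quadratic_variation_W(1)[OF n] by simp
  \<comment> \<open>Scaled so that sqrt n times \<open>noise\<close> splits into a cross part whose
    square is \<open>c1\<close> times the square of \<open>cross\<close>, and \<open>c2\<close>
    times the quadratic variation of W.\<close>
  define c1 c2 where "c1 = real n * (2 * a * b / qv_scale n)\<^sup>2" and "c2 = sqrt (real n) * b\<^sup>2 / qv_scale n"
  have sc: "0 < qv_scale n" by (rule qv_scale_pos[OF n])
  have c: "0 \<le> c1" "0 \<le> c2" using sc by (simp_all add: c1_def c2_def)
  have QW0: "0 \<le> quadratic_variation T n W \<omega>" for \<omega> by (simp add: quadratic_variation_def sum_nonneg)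
  let ?E1 = "{\<omega>\<in>space M. (\<eta> / 2)\<^sup>2 < c1 * (cross n \<omega>)\<^sup>2}"
  let ?E2 = "{\<omega>\<in>space M. \<eta> / 2 < c2 * quadratic_variation T n W \<omega>}"
  let ?E3 = "{\<omega>\<in>space M. \<eta> < sqrt (real n) * (qv_dev T n \<omega>)\<^sup>2}"
  have "bad n \<eta> \<subseteq> ?E1 \<union> (?E2 \<union> ?E3)"
  proof
    fix \<omega> assume \<omega>: "\<omega> \<in> bad n \<eta>"
    show "\<omega> \<in> ?E1 \<union> (?E2 \<union> ?E3)"
    proof (rule ccontr)
      assume neg: "\<omega> \<notin> ?E1 \<union> (?E2 \<union> ?E3)"
      then have 1: "c1 * (cross n \<omega>)\<^sup>2 \<le> (\<eta> / 2)\<^sup>2" and 2: "c2 * quadratic_variation T n W \<omega> \<le> \<eta> / 2"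
        and 3: "\<eta> < sqrt (real n) * \<bar>noise n \<omega>\<bar>" using \<omega> by (auto simp: bad_def)
      have "(sqrt (real n) * (2 * a * b / qv_scale n) * cross n \<omega>)\<^sup>2 = c1 * (cross n \<omega>)\<^sup>2"
        by (simp add: c1_def power_mult_distrib power_divide)
      with 1 have x: "\<bar>sqrt (real n) * (2 * a * b / qv_scale n) * cross n \<omega>\<bar> \<le> \<eta> / 2"
        using \<eta> abs_le_square_iff[of "sqrt (real n) * (2 * a * b / qv_scale n) * cross n \<omega>" "\<eta> / 2"] by simp
      have "sqrt (real n) * \<bar>noise n \<omega>\<bar> = \<bar>sqrt (real n) * noise n \<omega>\<bar>" by (simp add: abs_mult)
      also have "sqrt (real n) * noise n \<omega> = sqrt (real n) * (2 * a * b / qv_scale n) * cross n \<omega> + c2 * quadratic_variation T n W \<omega>"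
        using sc by (simp add: noise_def c2_def field_simps)
      also have "\<bar>\<dots>\<bar> \<le> \<eta> / 2 + \<eta> / 2"
        using x 2 c QW0[of \<omega>] by (intro order_trans[OF abs_triangle_ineq] add_mono) (simp_all add: abs_mult)
      finally show False using 3 by simp
    qed
  qed
  then have "prob (bad n \<eta>) \<le> prob (?E1 \<union> (?E2 \<union> ?E3))"
    by (intro finite_measure_mono) measurable
  also have "\<dots> \<le> prob ?E1 + (prob ?E2 + prob ?E3)"
    by (intro order_trans[OF measure_Un_le] add_left_mono measure_Un_le) measurable
  also have "prob ?E1 \<le> expectation (\<lambda>\<omega>. c1 * (cross n \<omega>)\<^sup>2) / (\<eta> / 2)\<^sup>2"
    using c \<eta> by (intro markov_gt) (simp_all add: cross_second_moment[OF n])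
  also have "expectation (\<lambda>\<omega>. c1 * (cross n \<omega>)\<^sup>2) / (\<eta> / 2)\<^sup>2 = 16 * b\<^sup>2 / (a\<^sup>2 * \<eta>\<^sup>2) * (mesh n powr (1 - 2 * H))"
  proof -
    define p where "p = mesh n powr (2 * H)"
    have p0: "0 < p" using mesh_pos[OF n] by (simp add: p_def)
    have pw: "mesh n powr (1 - 2 * H) = mesh n / p" using mesh_pos[OF n] by (simp add: p_def powr_diff)
    have E: "expectation (\<lambda>\<omega>. c1 * (cross n \<omega>)\<^sup>2) = c1 * (real n * p * mesh n)"
      by (simp add: cross_second_moment(2)[OF n] p_def)
    have c1: "c1 = real n * (2 * a * b / (a\<^sup>2 * (p * real n)))\<^sup>2" by (simp add: c1_def qv_scale_def p_def)
    show ?thesis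
      unfolding E unfolding pw c1 using n a \<eta> p0 by (simp add: power2_eq_square field_simps)
  qed
  also have "prob ?E2 \<le> expectation (\<lambda>\<omega>. c2 * quadratic_variation T n W \<omega>) / (\<eta> / 2)"
    using c \<eta> QW0 by (intro markov_gt) (simp_all add: quadratic_variation_W(1)[OF n])
  also have "expectation (\<lambda>\<omega>. c2 * quadratic_variation T n W \<omega>) / (\<eta> / 2)
     = 2 * b\<^sup>2 * T powr (1 - 2 * H) / (a\<^sup>2 * \<eta>) * real n powr (2 * H - 1/2)"
  proof -
    have 1: "T powr (1 - 2 * H) = T / T powr (2 * H)" using T by (simp add: powr_diff)
    have 2: "real n powr (2 * H - 1/2) = real n powr (2 * H) / sqrt (real n)" using n by (simp add: powr_diff powr_half_sqrt)
    have 3: "mesh n powr (2 * H) = T powr (2 * H) / real n powr (2 * H)" using T by (simp add: mesh_def powr_divide)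
    define p q r where "p = T powr (2 * H)" and "q = real n powr (2 * H)" and "r = sqrt (real n)"
    have pos: "0 < p" "0 < q" "0 < r" using T n by (simp_all add: p_def q_def r_def)
    have rn: "real n = r * r" by (simp add: r_def)
    show ?thesis
      using n a \<eta> pos
      by (simp add: quadratic_variation_W(2)[OF n] c2_def qv_scale_def 1 2 3 p_def[symmetric] q_def[symmetric] r_def[symmetric])
        (simp add: rn power2_eq_square field_simps)
  qed
  also have "prob ?E3 \<le> expectation (\<lambda>\<omega>. sqrt (real n) * (qv_dev T n \<omega>)\<^sup>2) / \<eta>"
    using \<eta> by (intro markov_gt)
      (auto intro!: integrable_mult_right finite_moments_integrable_power qv_dev_second_moment(1)[OF T n])
  also have "\<dots> \<le> (sqrt (real n) * (4 / real n)) / \<eta>"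
    unfolding integral_mult_right_zero using \<eta> qv_dev_second_moment(2)[OF T n]
    by (intro divide_right_mono mult_left_mono) simp_all
  also have "\<dots> = 4 / \<eta> * real n powr (- 1/2)"
  proof -
    have "real n powr (- 1/2) = 1 / sqrt (real n)" using n by (simp add: powr_minus_divide powr_half_sqrt)
    moreover have "sqrt (real n) / real n = 1 / sqrt (real n)" using n by (simp add: field_simps)
    moreover have "sqrt (real n) * (4 / real n) / \<eta> = 4 / \<eta> * (sqrt (real n) / real n)" by (simp add: mult_ac)
    ultimately show ?thesis by (simp only:)
  qed
  finally show ?thesis by simp
qed

lemma prob_bad_tendsto:
  assumes \<eta>: "0 < \<eta>"
  shows "(\<lambda>n. prob (bad n \<eta>)) \<longlonglongrightarrow> 0"
proof -
  have neg: "(\<lambda>n. real n powr s) \<longlonglongrightarrow> 0" if "s < 0" for s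
    by (rule tendsto_neg_powr[OF that filterlim_real_sequentially])
  have "mesh n powr (1 - 2 * H) = T powr (1 - 2 * H) * real n powr (2 * H - 1)" for n
  proof -
    have "mesh n powr (1 - 2 * H) = T powr (1 - 2 * H) / real n powr (1 - 2 * H)" using T by (simp add: mesh_def powr_divide)
    also have "\<dots> = T powr (1 - 2 * H) * real n powr (- (1 - 2 * H))" by (simp only: powr_minus_divide) simp
    finally show ?thesis by simp
  qed
  then have step: "(\<lambda>n. mesh n powr (1 - 2 * H)) \<longlonglongrightarrow> T powr (1 - 2 * H) * 0"
    using H by (simp only:) (intro tendsto_mult tendsto_const neg, simp)
  have lim: "(\<lambda>n. 16 * b\<^sup>2 / (a\<^sup>2 * \<eta>\<^sup>2) * (mesh n powr (1 - 2 * H))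
     + 2 * b\<^sup>2 * T powr (1 - 2 * H) / (a\<^sup>2 * \<eta>) * real n powr (2 * H - 1/2) + 4 / \<eta> * real n powr (- 1/2))
     \<longlonglongrightarrow> 16 * b\<^sup>2 / (a\<^sup>2 * \<eta>\<^sup>2) * (T powr (1 - 2 * H) * 0)
       + 2 * b\<^sup>2 * T powr (1 - 2 * H) / (a\<^sup>2 * \<eta>) * 0 + 4 / \<eta> * 0"
    \<comment> \<open>The exponent 2H - 1/2 of the middle term is negative exactly for H <
      1/4.\<close>
    using H4 by (intro tendsto_add tendsto_mult tendsto_const step neg) auto
  have ev: "eventually (\<lambda>n::nat. 0 < n) sequentially" by (rule eventually_gt_at_top)
  show ?thesis
  proof (rule tendsto_sandwich[OF _ _ tendsto_const])
    show "eventually (\<lambda>n. 0 \<le> prob (bad n \<eta>)) sequentially" by simp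
    show "eventually (\<lambda>n. prob (bad n \<eta>) \<le> 16 * b\<^sup>2 / (a\<^sup>2 * \<eta>\<^sup>2) * (mesh n powr (1 - 2 * H))
     + 2 * b\<^sup>2 * T powr (1 - 2 * H) / (a\<^sup>2 * \<eta>) * real n powr (2 * H - 1/2) + 4 / \<eta> * real n powr (- 1/2)) sequentially"
      using ev by eventually_elim (rule prob_bad_le[OF _ \<eta>])
  qed (use lim in simp)
qed

section \<open>Linearisation of the estimator\<close>

definition est_dev :: "nat \<Rightarrow> 'a \<Rightarrow> real" where
  "est_dev k \<omega> = 2 powr (real k / 2) * (H_estimator T X k \<omega> - H)"

lemma est_dev_measurable: "est_dev k \<in> borel_measurable M"
proof -
  have [measurable]: "quadratic_variation T n X \<in> borel_measurable M" for n
  proof -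
    have [measurable]: "B (T * (real i + 1) / real n) \<in> borel_measurable M" "B (T * real i / real n) \<in> borel_measurable M"
      "W (T * (real i + 1) / real n) \<in> borel_measurable M" "W (T * real i / real n) \<in> borel_measurable M" for i
      using B_measurable W_measurable grid_nonneg by auto
    show ?thesis unfolding quadratic_variation_def[abs_def] grid_increment_def mixed_process_def by measurable
  qed
  show ?thesis unfolding est_dev_def[abs_def] H_estimator_def by measurable
qed

text \<open>The deterministic part of the ratio of quadratic variations; its binary logarithm 2H - 1
  is what the estimator converts into \<open>H\<close>.\<close>

lemma qv_scale_double:
  assumes "0 < n"
  shows "qv_scale n / qv_scale (2 * n) = 2 powr (2 * H - 1)"
proof -
  have half: "mesh (2 * n) = mesh n / 2" by (simp add: mesh_def)
  have "mesh (2 * n) powr (2 * H) = mesh n powr (2 * H) / 2 powr (2 * H)"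
    unfolding half using mesh_pos[OF assms] by (simp add: powr_divide)
  then show ?thesis using a mesh_pos[OF assms] assms unfolding qv_scale_def by (simp add: powr_diff)
qed

text \<open>Each of the two logarithms is replaced by its linear part at cost 9 \<eta>. At the finer
  level the error is controlled with the larger factor sqrt(2n), which dominates sqrt n, and the
  division by 2 ln 2, at least 1, only helps.\<close>

lemma est_dev_close:
  assumes \<eta>: "0 < \<eta>" "\<eta> \<le> 1/16" and \<omega>: "\<omega> \<in> space M" "\<omega> \<notin> bad (2 ^ k) \<eta>" "\<omega> \<notin> bad (2 ^ (k + 1)) \<eta>"
  shows "\<bar>est_dev k \<omega> - fluct T (2 ^ k) \<omega>\<bar> \<le> 18 * \<eta>"
proof -
  define n :: nat where "n = 2 ^ k"
  have n: "0 < n" and n2: "0 < 2 * n" and pw: "2 ^ (k + 1) = 2 * n" by (simp_all add: n_def)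
  define s where "s = sqrt (real n)"
  define s' where "s' = sqrt (real (2 * n))"
  have s: "1 \<le> s" "s \<le> s'" using n by (simp_all add: s_def s'_def)
  define P R P' R' where "P = qv_dev T n \<omega>" and "R = noise n \<omega>"
    and "P' = qv_dev T (2 * n) \<omega>" and "R' = noise (2 * n) \<omega>"
  have "s * \<bar>R\<bar> \<le> \<eta>" "s * P\<^sup>2 \<le> \<eta>"
    using \<omega>(1,2) unfolding bad_def n_def[symmetric] by (auto simp: s_def R_def P_def)
  note d = ln_dev_bound[OF s(1) \<eta> this]
  have "s' * \<bar>R'\<bar> \<le> \<eta>" "s' * P'\<^sup>2 \<le> \<eta>"
    using \<omega>(1,3) unfolding bad_def pw by (auto simp: s'_def R'_def P'_def)
  note d' = ln_dev_bound[OF order_trans[OF s] \<eta> this]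
  define p p' where "p = 1 + P + R" and "p' = 1 + P' + R'"
  have p: "0 < p" "0 < p'" using d(1) d'(1) by (simp_all add: p_def p'_def)
  have sc: "0 < qv_scale n" "0 < qv_scale (2 * n)" using qv_scale_pos[OF n] qv_scale_pos[OF n2] .
  have "quadratic_variation T (2 ^ k) X \<omega> / quadratic_variation T (2 ^ (k + 1)) X \<omega> = (qv_scale n / qv_scale (2 * n)) * (p / p')"
    unfolding pw n_def[symmetric] quadratic_variation_mixed[OF n] quadratic_variation_mixed[OF n2]
    by (simp add: p_def p'_def P_def R_def P'_def R'_def)
  also have "\<dots> = 2 powr (2 * H - 1) * (p / p')" by (simp only: qv_scale_double[OF n])
  finally have *: "quadratic_variation T (2 ^ k) X \<omega> / quadratic_variation T (2 ^ (k + 1)) X \<omega> = 2 powr (2 * H - 1) * (p / p')" .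
  have "log 2 (quadratic_variation T (2 ^ k) X \<omega> / quadratic_variation T (2 ^ (k + 1)) X \<omega>)
     = (2 * H - 1) + (ln p - ln p') / ln 2"
  proof -
    have "log 2 (2 powr (2 * H - 1) * (p / p')) = (2 * H - 1) + log 2 (p / p')"
      using p by (subst log_mult) auto
    also have "log 2 (p / p') = (ln p - ln p') / ln 2" using p by (simp add: log_def ln_div)
    finally show ?thesis unfolding * .
  qed
  then have "H_estimator T X k \<omega> - H = (ln p - ln p') / (2 * ln 2)"
    unfolding H_estimator_def by (simp add: field_simps)
  moreover have "2 powr (real k / 2) = s"
    by (simp add: s_def n_def powr_half_sqrt[symmetric] powr_powr flip: powr_realpow)
  ultimately have Y: "est_dev k \<omega> = s * (ln p - ln p') / (2 * ln 2)" by (simp add: est_dev_def)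
  have "fluct T (2 ^ k) \<omega> = s * (P - P') / (2 * ln 2)"
    unfolding n_def[symmetric] fluct_eq_qv_dev[OF T n] by (simp add: s_def P_def P'_def)
  then have "\<bar>est_dev k \<omega> - fluct T (2 ^ k) \<omega>\<bar> = \<bar>s * (ln p - P) - s * (ln p' - P')\<bar> / (2 * ln 2)"
    unfolding Y by (simp add: algebra_simps flip: diff_divide_distrib)
  also have "\<dots> \<le> \<bar>s * (ln p - P) - s * (ln p' - P')\<bar> / 1"
    using ln2_ge_half by (intro divide_left_mono) auto
  also have "\<dots> \<le> \<bar>s * (ln p - P)\<bar> + \<bar>s * (ln p' - P')\<bar>" by (simp add: abs_triangle_ineq4)
  also have "\<bar>s * (ln p - P)\<bar> \<le> 9 * \<eta>" using d(2) s by (simp add: abs_mult p_def)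
  also have "\<bar>s * (ln p' - P')\<bar> = s * \<bar>ln p' - P'\<bar>" using s by (simp add: abs_mult)
  also have "\<dots> \<le> s' * \<bar>ln p' - P'\<bar>" using s(2) by (rule mult_right_mono) simp
  also have "\<dots> \<le> 9 * \<eta>" using d'(2) by (simp add: p'_def)
  finally show ?thesis by simp
qed

theorem est_dev_weak_conv:
  "weak_conv_m (\<lambda>k. distr M borel (est_dev k)) (normal_law 0 ((sigma' M H B)\<^sup>2))"
proof (rule weak_conv_normal_slutsky)
  have n: "0 < (2::nat) ^ k" for k by simp
  have lim: "filterlim (\<lambda>k. (2::nat) ^ k) at_top sequentially"
    by (rule filterlim_at_top_mono[OF filterlim_ident]) (auto intro: less_imp_le)
  show "fluct T (2 ^ k) \<in> borel_measurable M" for k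
    by (rule finite_moments_measurable[OF fluct_finite_moments[OF T n]])
  show "est_dev k \<in> borel_measurable M" for k by (rule est_dev_measurable)
  show "(\<lambda>k. char (distr M borel (fluct T (2 ^ k))) t) \<longlonglongrightarrow> complex_of_real (exp (- (sigma' M H B)\<^sup>2 * t\<^sup>2 / 2))" for t
    by (rule char_distr_tendsto_of_moments[OF fluct_finite_moments[OF T n] fluct_moments_tendsto[OF T n lim]])
  fix e :: real assume e: "0 < e"
  \<comment> \<open>The cap 1/16 is the range of the logarithm estimate, and e/18 turns its error 18
    \<eta> into at most e.\<close>
  define \<eta> where "\<eta> = min (1/16) (e / 18)"
  have \<eta>: "0 < \<eta>" "\<eta> \<le> 1/16" "18 * \<eta> \<le> e" using e by (auto simp: \<eta>_def)
  have le: "prob {\<omega>\<in>space M. e < \<bar>est_dev k \<omega> - fluct T (2 ^ k) \<omega>\<bar>} \<le> prob (bad (2 ^ k) \<eta>) + prob (bad (2 ^ (k + 1)) \<eta>)" for k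
  proof -
    have "{\<omega>\<in>space M. e < \<bar>est_dev k \<omega> - fluct T (2 ^ k) \<omega>\<bar>} \<subseteq> bad (2 ^ k) \<eta> \<union> bad (2 ^ (k + 1)) \<eta>"
      using est_dev_close[OF \<eta>(1,2)] \<eta>(3) by (smt (verit) UnCI mem_Collect_eq subsetI)
    then have "prob {\<omega>\<in>space M. e < \<bar>est_dev k \<omega> - fluct T (2 ^ k) \<omega>\<bar>} \<le> prob (bad (2 ^ k) \<eta> \<union> bad (2 ^ (k + 1)) \<eta>)"
      by (intro finite_measure_mono sets.Un bad_sets) auto
    also have "\<dots> \<le> prob (bad (2 ^ k) \<eta>) + prob (bad (2 ^ (k + 1)) \<eta>)"
      by (intro measure_Un_le bad_sets) auto
    finally show ?thesis .
  qed
  have 1: "(\<lambda>k. prob (bad (2 ^ k) \<eta>)) \<longlonglongrightarrow> 0"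
    by (rule filterlim_compose[OF prob_bad_tendsto[OF \<eta>(1)] lim])
  have "(\<lambda>k. prob (bad (2 ^ k) \<eta>) + prob (bad (2 ^ (k + 1)) \<eta>)) \<longlonglongrightarrow> 0"
    using tendsto_add[OF 1 LIMSEQ_Suc[OF 1]] by simp
  then show "(\<lambda>k. prob {\<omega>\<in>space M. e < \<bar>est_dev k \<omega> - fluct T (2 ^ k) \<omega>\<bar>}) \<longlonglongrightarrow> 0"
    by (rule tendsto_sandwich[OF always_eventually always_eventually tendsto_const, rotated 2]) (simp_all only: le measure_nonneg simp_thms)
qed simp

end

text \<open>Summability and nonnegativity belong to the claim because they make the infinite sum and
  the square root in \<open>sigma'\<close> genuine, rather than values of a totalised function
  outside its domain.\<close>

theorem proposition3p1:
  fixes M :: "'a measure"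
    and H T a b :: real
    and B W :: "real \<Rightarrow> 'a \<Rightarrow> real"
  assumes "prob_space M"
    and "0 < H" and "H < 1/4"
    and "0 < T" and "0 < a" and "0 < b"
    and "fractional_brownian_motion M H B"
    and "wiener_process M W"
    and "independent_processes M B W"
  shows "summable (\<lambda>m. rho' M H B (Suc m)) \<and>
         0 \<le> rho'_sum M H B \<and>
         weak_conv_m
           (\<lambda>k. distr M borel
              (\<lambda>\<omega>. 2 powr (real k / 2) * (H_estimator T (mixed_process a b B W) k \<omega> - H)))
           (normal_law 0 ((sigma' M H B)\<^sup>2))"
proof -
  interpret prob_space M by fact
  interpret mixed_model M H B T a b W
    by unfold_locales (use assms in auto)
  show ?thesis
    using rho'_summable rho'_sum_nonneg est_dev_weak_conv unfolding est_dev_def[abs_def] by simp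
qed

end
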